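(* In the setting described in the context, let $\mathcal M$ be the set of dimer coverings of $G$ and $\mathcal T$ the set of spanning trees of $H$. Then for every $M\in\mathcal M$ there is a unique $M'\in\mathcal M$ with $M'\stackrel{t}{\sim}M$ and $e_1^*\in M'$, and the map $$\bar\varphi:\mathcal M/\!\stackrel{t}{\sim}\ \longrightarrow\ \mathcal T,\qquad [M]\longmapsto \varphi(\pi(M))=\{\{x,2b-x\}: x\in V(H),\ b\in B,\ \{x,b\}\in M'\setminus\{e_1^*\}\}$$ is well defined and is a bijection.
   Context: Let $\Gamma$ be the graph with vertex set $\mathbb Z^2$, divided into white vertices $W=\{(x,y): x+y \text{ even}\}$ and black vertices $B=\mathbb Z^2\setminus W$; $v,v'$ are adjacent iff $v-v'\in\{\pm(1,0),\pm(0,1)\}$, or $v,v'\in W$ and $v-v'\in\{\pm(1,1),\pm(1,-1)\}$ (diagonal edges, forming the set $E_2$; $E_1$ is the set of other edges). A subgraph of $\Gamma$ is normal if it is induced by a finite vertex set and both it and the subgraph induced by the complementary vertex set are connected. A dimer covering of a graph is a set of its edges covering every vertex exactly once; an impurity is a dimer in $E_2$. A $t$-move on a dimer covering $M$: if $\{a,b\},\{c,d\}\in M$ with $\{a,b\},\{b,c\}\in E_2$ and $\{c,d\},\{d,a\}\in E_1$ edges of the graph, replace $\{a,b\},\{c,d\}$ by $\{b,c\},\{d,a\}$. Write $M_1\stackrel{t}{\sim}M_2$ if $M_1$ can be transformed into $M_2$ by a finite sequence of $t$-moves; this is an equivalence relation and $[M]$ denotes the class of $M$. Let $W_0=2\mathbb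 Z\times 2\mathbb Z$, $W_1=W_0+(1,1)$; $\Lambda$ is the graph on $W_0$ with edges $\{v,v'\}$, $v-v'\in\{\pm(2,0),\pm(0,2)\}$, and $\Lambda^\perp$ the analogous graph on $W_1$. Setting: $H$ is a finite subgraph of $\Lambda$ formed by the boundaries of a finite set $\mathcal F$ of faces of $\Lambda$ (squares of side $2$ with corners in $W_0$), with simply connected union; the centres of these faces lie in $W_1$. $f^*\in W_1$ is a point which is not a centre of a face in $\mathcal F$, chosen so that the subgraph of $\Lambda^\perp$ induced by the face-centres together with $f^*$ is simply connected. $H^\perp$ is the planar dual of $H$ whose outer-face vertex is $f^*$: $V(H^\perp)$ consists of the face centres and $f^*$, and for every edge $e$ of $H$ there is one edge $e^\perp$ of $H^\perp$ joining the vertices representing the two faces on either side of $e$. $v^*$ is a vertex of $H$ on the boundary of the outer face with $v^*-f^*\in\{\pm(1,1),\pm(1,-1)\}$, and $e_1^*=\{f^*,v^*\}$. $G$ is the subgraph of $\Gamma$ induced by $V(H)\cup V(H^\perp)\cup\{\text{midpoints of edges of }H\}$ (these midpoints are black), assumed normal. $N$ is the graph obtained from $G$ by deleting $v^*$, $f^*$ and all diagonal edges; $\pi(M)=M'\setminus\{e_1^*\}$ is a dimer covering of $N$, and $\varphi$ (the Temperley bijection) sends a dimer covering $D$ of $N$ to the spanning tree $\{\{x,2b-x\}: x\in V(H), \{x,b\}\in D\}$ of $H$. *)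

theory Defs
  imports "HOL-Analysis.Analysis"
begin

type_synonym pt = "int \<times> int"

definition white :: "pt \<Rightarrow> bool" where
  "white v \<longleftrightarrow> even (fst v + snd v)"

definition black :: "pt \<Rightarrow> bool" where
  "black v \<longleftrightarrow> \<not> white v"

definition E1adj :: "pt \<Rightarrow> pt \<Rightarrow> bool" where
  "E1adj v w \<longleftrightarrow> \<bar>fst v - fst w\<bar> + \<bar>snd v - snd w\<bar> = 1"

definition E2adj :: "pt \<Rightarrow> pt \<Rightarrow> bool" where
  "E2adj v w \<longleftrightarrow> white v \<and> white w \<and> \<bar>fst v - fst w\<bar> = 1 \<and> \<bar>snd v - snd w\<bar> = 1"

definition gamma_adj :: "pt \<Rightarrow> pt \<Rightarrow> bool" where
  "gamma_adj v w \<longleftrightarrow> E1adj v w \<or> E2adj v w"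

definition induced_connected :: "pt set \<Rightarrow> bool" where
  "induced_connected S \<longleftrightarrow>
     (\<forall>v\<in>S. \<forall>w\<in>S. (\<lambda>x y. x \<in> S \<and> y \<in> S \<and> gamma_adj x y)\<^sup>*\<^sup>* v w)"

text \<open>Normal subgraph (identified with its finite inducing vertex set).\<close>
definition normal_set :: "pt set \<Rightarrow> bool" where
  "normal_set S \<longleftrightarrow> finite S \<and> induced_connected S \<and> induced_connected (UNIV - S)"

definition induced_edges :: "pt set \<Rightarrow> pt set set" where
  "induced_edges V = {{v, w} | v w. v \<in> V \<and> w \<in> V \<and> gamma_adj v w}"

definition dimer_covering :: "pt set \<Rightarrow> pt set set \<Rightarrow> bool" where
  "dimer_covering V M \<longleftrightarrow> M \<subseteq> induced_edges V \<and> (\<forall>v\<in>V. \<exists>!e. e \<in> M \<and> v \<in> e)"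

text \<open>t-moves (the graph being an induced subgraph of Gamma containing all covered vertices,
  the edge conditions reduce to adjacency in Gamma).\<close>
definition tmove :: "pt set set \<Rightarrow> pt set set \<Rightarrow> bool" where
  "tmove M M' \<longleftrightarrow> (\<exists>a b c d. {a, b} \<in> M \<and> {c, d} \<in> M \<and>
       E2adj a b \<and> E2adj b c \<and> E1adj c d \<and> E1adj d a \<and>
       M' = (M - {{a, b}, {c, d}}) \<union> {{b, c}, {d, a}})"

definition t_equiv :: "pt set set \<Rightarrow> pt set set \<Rightarrow> bool" where
  "t_equiv = tmove\<^sup>*\<^sup>*"

definition W0 :: "pt set" where "W0 = {v. even (fst v) \<and> even (snd v)}"
definition W1 :: "pt set" where "W1 = {v. odd (fst v) \<and> odd (snd v)}"

text \<open>Face of Lambda with centre c (in W1): corners, sides, side midpoints.\<close>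
definition face_corners :: "pt \<Rightarrow> pt set" where
  "face_corners c = (case c of (x, y) \<Rightarrow>
     {(x + 1, y + 1), (x + 1, y - 1), (x - 1, y + 1), (x - 1, y - 1)})"

definition face_sides :: "pt \<Rightarrow> pt set set" where
  "face_sides c = (case c of (x, y) \<Rightarrow>
     {{(x + 1, y + 1), (x + 1, y - 1)}, {(x + 1, y - 1), (x - 1, y - 1)},
      {(x - 1, y - 1), (x - 1, y + 1)}, {(x - 1, y + 1), (x + 1, y + 1)}})"

definition face_mids :: "pt \<Rightarrow> pt set" where
  "face_mids c = (case c of (x, y) \<Rightarrow> {(x + 1, y), (x - 1, y), (x, y + 1), (x, y - 1)})"

definition VH :: "pt set \<Rightarrow> pt set" where "VH F = (\<Union>c\<in>F. face_corners c)"
definition EH :: "pt set \<Rightarrow> pt set set" where "EH F = (\<Union>c\<in>F. face_sides c)"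
definition mids :: "pt set \<Rightarrow> pt set" where "mids F = (\<Union>c\<in>F. face_mids c)"

text \<open>Vertex set of G: V(H), V(H-perp) = F plus f*, and the edge midpoints.\<close>
definition VG :: "pt set \<Rightarrow> pt \<Rightarrow> pt set" where
  "VG F f = VH F \<union> (F \<union> {f}) \<union> mids F"

definition to_real :: "pt \<Rightarrow> real \<times> real" where
  "to_real p = (real_of_int (fst p), real_of_int (snd p))"

definition face_region :: "pt \<Rightarrow> (real \<times> real) set" where
  "face_region c = cbox (to_real (fst c - 1, snd c - 1)) (to_real (fst c + 1, snd c + 1))"

definition face_union :: "pt set \<Rightarrow> (real \<times> real) set" where
  "face_union F = (\<Union>c\<in>F. face_region c)"

definition lperp_adj :: "pt \<Rightarrow> pt \<Rightarrow> bool" where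
  "lperp_adj v w \<longleftrightarrow> (\<bar>fst v - fst w\<bar> = 2 \<and> snd v = snd w) \<or> (fst v = fst w \<and> \<bar>snd v - snd w\<bar> = 2)"

definition lperp_complex :: "pt set \<Rightarrow> (real \<times> real) set" where
  "lperp_complex S =
     to_real ` S
     \<union> \<Union>{closed_segment (to_real v) (to_real w) | v w. v \<in> S \<and> w \<in> S \<and> lperp_adj v w}
     \<union> \<Union>{cbox (to_real v) (to_real (fst v + 2, snd v + 2)) | v.
            v \<in> S \<and> (fst v + 2, snd v) \<in> S \<and> (fst v, snd v + 2) \<in> S \<and> (fst v + 2, snd v + 2) \<in> S}"

definition on_outer_face :: "pt set \<Rightarrow> pt \<Rightarrow> bool" where
  "on_outer_face F v \<longleftrightarrow>
     (\<exists>C. C \<in> components (- face_union F) \<and> \<not> bounded C \<and> to_real v \<in> closure C)"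

definition reach :: "pt set set \<Rightarrow> pt \<Rightarrow> pt \<Rightarrow> bool" where
  "reach T = (\<lambda>x y. {x, y} \<in> T)\<^sup>*\<^sup>*"

definition has_cycle :: "pt set set \<Rightarrow> bool" where
  "has_cycle T \<longleftrightarrow> (\<exists>vs. length vs \<ge> 3 \<and> distinct vs \<and>
      (\<forall>i < length vs. {vs ! i, vs ! ((i + 1) mod length vs)} \<in> T))"

definition spanning_tree :: "pt set \<Rightarrow> pt set set \<Rightarrow> pt set set \<Rightarrow> bool" where
  "spanning_tree V E T \<longleftrightarrow> T \<subseteq> E \<and> (\<forall>v\<in>V. \<forall>w\<in>V. reach T v w) \<and> \<not> has_cycle T"

definition pi_map :: "pt set \<Rightarrow> pt set set \<Rightarrow> pt set set" where
  "pi_map e1 M = M - {e1}"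

definition phi_map :: "pt set \<Rightarrow> pt set set \<Rightarrow> pt set set" where
  "phi_map V D = {{x, (2 * fst b - fst x, 2 * snd b - snd x)} | x b. x \<in> V \<and> {x, b} \<in> D}"

end

theory Submission
  imports Defs "HOL-Complex_Analysis.Winding_Numbers"
begin

text \<open>
  By Euler's formula \<open>G\<close> has two more white than black vertices, so every dimer covering has exactly one
  impurity \<open>{x, c}\<close>. Its other dimers orient the edges of a subgraph \<open>T\<close> of \<open>H\<close> towards \<open>x\<close> and those of the
  complementary dual subgraph towards \<open>c\<close>; counting inside a directed cycle shows that \<open>T\<close> is a spanning tree.
  A \<open>t\<close>-move shifts the impurity one step along the contour of \<open>T\<close> and leaves \<open>T\<close> unchanged. The impurity can
  always be shifted to \<open>e\<^sub>1\<^sup>*\<close>, and \<open>T\<close> together with the position of the impurity determines the covering.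
  Euler's formula and all separation arguments come from the mod 2 homology of the square lattice: a finite
  even set of edges is the boundary of a unique finite set of faces.
\<close>

section \<open>Mod 2 boundaries in the square lattice\<close>

text \<open>The outer vertex of the dual graph is represented by a single point \<open>f\<close>,
  although a boundary edge of \<open>H\<close> may lead to any point of \<open>W1\<close> outside
  \<open>F\<close>. An arrow of the dual tree can thus leave \<open>insert f F\<close>, and regions
  are first found as finite sets in the whole lattice and only then shown to lie in
  \<open>F\<close>. This makes the absence of holes, for \<open>F\<close> and for
  \<open>insert f F\<close>, the form in which planarity is used; it comes from normality of
  \<open>G\<close> and simple connectivity of the union. The second obstacle is at \<open>f\<close>
  itself: the square around \<open>f\<close> is not a face of \<open>H\<close>, only some of its
  sides and corners need belong to \<open>H\<close>, and a shift of the impurity along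
  \<open>f\<close> requires a side in \<open>H\<close>. Bringing the impurity to some corner of
  \<open>f\<close> is therefore not enough for reaching \<open>v\<close>; the corners of
  \<open>f\<close> in \<open>H\<close> have to be joined by sides in \<open>H\<close>. Walks, cuts
  and counts are all expressed in midpoints, \<open>opp b w\<close> being the far end of the edge
  from \<open>w\<close> through \<open>b\<close>.\<close>

definition opp :: "pt \<Rightarrow> pt \<Rightarrow> pt" where
  "opp b w = (2 * fst b - fst w, 2 * snd b - snd w)"

text \<open>\<open>lat True\<close> is \<open>W0\<close> and \<open>lat False\<close> is \<open>W1\<close>, so that each lemma on \<open>lat P\<close> serves \<open>\<Lambda>\<close> and its dual. An edge of
  either lattice is represented by its black midpoint, and \<open>bnd S\<close> is the set of dual edges separating \<open>S\<close>
  from its complement.\<close>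
definition lat :: "bool \<Rightarrow> pt set" where
  "lat P = {w. white w \<and> even (fst w) = P}"

definition bnd :: "pt set \<Rightarrow> pt set" where
  "bnd S = {b. \<exists>w\<in>S. E1adj w b \<and> opp b w \<notin> S}"

text \<open>\<open>Z\<close> is a set of midpoints: for \<open>w\<close> in \<open>W0\<close> this
  is the degree condition of a cycle in \<open>\<Lambda>\<close>, for \<open>w\<close> in
  \<open>W1\<close> that of a cycle in the dual.\<close>

definition even_at :: "pt set \<Rightarrow> pt \<Rightarrow> bool" where
  "even_at Z w \<longleftrightarrow> even (card {b \<in> Z. E1adj w b})"

lemma W0_lat: "W0 = lat True" and W1_lat: "W1 = lat False"
  by (auto simp: W0_def W1_def lat_def white_def)

lemma opp_opp [simp]: "opp b (opp b w) = w"
  by (simp add: opp_def)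

lemma opp_eq_self: "opp b w = w \<longleftrightarrow> b = w"
  by (cases b; cases w) (auto simp: opp_def)

lemma E1adj_iff:
  "E1adj w b \<longleftrightarrow> b \<in> {(fst w + 1, snd w), (fst w - 1, snd w), (fst w, snd w + 1), (fst w, snd w - 1)}"
  by (cases b; cases w; simp add: E1adj_def; arith)

lemma E1adj_sym: "E1adj v w \<longleftrightarrow> E1adj w v"
  by (simp add: E1adj_def abs_minus_commute)

lemma E2adj_sym: "E2adj v w \<longleftrightarrow> E2adj w v"
  by (auto simp add: E2adj_def abs_minus_commute)

lemma E1adj_opp [simp]: "E1adj (opp b w) b \<longleftrightarrow> E1adj w b"
  by (simp add: E1adj_def opp_def abs_if)

lemma E1adj_white_black: "E1adj w b \<Longrightarrow> white w \<longleftrightarrow> black b"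
  by (cases b; cases w) (auto simp: E1adj_iff white_def black_def)

lemma opp_in_lat: "w \<in> lat P \<Longrightarrow> opp b w \<in> lat P"
  by (auto simp: lat_def opp_def white_def)

lemma lat_black: "w \<in> lat P \<Longrightarrow> E1adj w b \<Longrightarrow> black b"
  using E1adj_white_black by (auto simp: lat_def)

lemma E1adj_cases:
  assumes "w \<in> lat P" "w' \<in> lat P" "E1adj w b" "E1adj w' b"
  shows "w' = w \<or> w' = opp b w"
  using assms by (cases b; cases w; cases w') (auto simp: E1adj_iff lat_def opp_def white_def)

lemma opp_neq: "E1adj w b \<Longrightarrow> opp b w \<noteq> w"
  by (auto simp: opp_eq_self E1adj_def)

lemma lat_nbrs:
  assumes "w \<in> lat P" "E1adj w b"
  shows "{x \<in> lat P. E1adj x b} = {w, opp b w}"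
  using E1adj_cases[OF assms(1) _ assms(2)] opp_in_lat[OF assms(1), of b] assms E1adj_opp by blast

lemma black_nbr_ex: assumes "black b" obtains w where "w \<in> lat P" "E1adj w b"
proof -
  obtain i j where b: "b = (i,j)" by force
  consider "(i+1,j) \<in> lat P" | "(i,j+1) \<in> lat P"
    using assms b by (cases P) (auto simp: lat_def black_def white_def)
  then show ?thesis
    by cases (use that b in \<open>auto simp: E1adj_def\<close>)
qed

lemma bnd_iff:
  assumes "S \<subseteq> lat P" "w \<in> lat P" "E1adj w b"
  shows "b \<in> bnd S \<longleftrightarrow> (w \<in> S) \<noteq> (opp b w \<in> S)"
proof
  assume "b \<in> bnd S"
  then obtain w' where w': "w' \<in> S" "E1adj w' b" "opp b w' \<notin> S" by (auto simp: bnd_def)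
  then have "w' = w \<or> w' = opp b w" using E1adj_cases[OF assms(2) _ assms(3)] assms(1) by blast
  then show "(w \<in> S) \<noteq> (opp b w \<in> S)" using w' by auto
next
  assume "(w \<in> S) \<noteq> (opp b w \<in> S)"
  then show "b \<in> bnd S" using assms(3) unfolding bnd_def
    by (cases "w \<in> S") (auto intro: bexI[of _ "opp b w"])
qed

lemma card_E1nbrs:
  "card {b \<in> Z. E1adj (x,y) b} = of_bool ((x+1,y) \<in> Z) + of_bool ((x-1,y) \<in> Z)
     + of_bool ((x,y+1) \<in> Z) + of_bool ((x,y-1) \<in> Z)"
proof -
  have "{b \<in> Z. E1adj (x,y) b} =
     (if (x+1,y) \<in> Z then {(x+1,y)} else {}) \<union> (if (x-1,y) \<in> Z then {(x-1,y)} else {})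
   \<union> (if (x,y+1) \<in> Z then {(x,y+1)} else {}) \<union> (if (x,y-1) \<in> Z then {(x,y-1)} else {})"
    by (auto simp: E1adj_iff split: if_splits)
  then show ?thesis by auto
qed

text \<open>Parity of four indicators as an iterated equivalence, so that parity claims at a point
  become propositional.\<close>

lemma even_at_iff:
  "even_at Z (x,y) \<longleftrightarrow> (((x+1,y) \<in> Z) = ((x-1,y) \<in> Z)) = (((x,y+1) \<in> Z) = ((x,y-1) \<in> Z))"
  unfolding even_at_def card_E1nbrs by auto

text \<open>The boundary of a boundary vanishes: on a turn around \<open>w\<close> through its four
  diagonal neighbours, which lie in \<open>lat P\<close>, membership in \<open>S\<close> changes an
  even number of times.\<close>

lemma even_at_bnd:
  assumes "S \<subseteq> lat P" "w \<in> lat (\<not> P)"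
  shows "even_at (bnd S) w"
proof -
  obtain x y where w: "w = (x,y)" by force
  have l: "(x+i,y+j) \<in> lat P" if "odd i" "odd j" for i j
    using that assms(2) w by (auto simp: lat_def white_def)
  have c: "(x+i,y) \<in> bnd S \<longleftrightarrow> ((x+i,y+1) \<in> S) \<noteq> ((x+i,y-1) \<in> S)" if "odd i" for i
    using bnd_iff[OF assms(1) l[of i 1], of "(x+i,y)"] that by (simp add: E1adj_def opp_def algebra_simps)
  have d: "(x,y+i) \<in> bnd S \<longleftrightarrow> ((x+1,y+i) \<in> S) \<noteq> ((x-1,y+i) \<in> S)" if "odd i" for i
    using bnd_iff[OF assms(1) l[of 1 i], of "(x,y+i)"] that by (simp add: E1adj_def opp_def algebra_simps)
  show ?thesis unfolding w even_at_iff using c[of 1] c[of "-1"] d[of 1] d[of "-1"] by simp argo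
qed

text \<open>A rightmost point of a nonempty finite \<open>S\<close> has its right neighbour outside
  \<open>S\<close>.\<close>

lemma bnd_empty_imp:
  assumes "S \<subseteq> lat P" "finite S" "bnd S = {}"
  shows "S = {}"
proof (rule ccontr)
  assume ne: "S \<noteq> {}"
  define m where "m = Max (fst ` S)"
  have "m \<in> fst ` S" unfolding m_def using assms ne by (intro Max_in) auto
  then obtain w where w: "w \<in> S" "fst w = m" by auto
  let ?b = "(fst w + 1, snd w)"
  have "opp ?b w \<in> S" using assms(3) w(1) unfolding bnd_def by (auto simp: E1adj_iff)
  then have "m + 2 \<in> fst ` S" using w by (force simp: opp_def)
  then have "m + 2 \<le> m" unfolding m_def using assms by (intro Max_ge) auto
  then show False by simp
qed

text \<open>\<open>bnd\<close> is additive for symmetric differences, so injectivity reduces to a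
  trivial kernel.\<close>

lemma bnd_inj:
  assumes "S \<subseteq> lat P" "finite S" "S' \<subseteq> lat P" "finite S'" "bnd S = bnd S'"
  shows "S = S'"
proof -
  let ?D = "sym_diff S S'"
  have D: "?D \<subseteq> lat P" "finite ?D" using assms by auto
  have "bnd ?D = {}"
  proof (rule equals0I)
    fix b assume "b \<in> bnd ?D"
    then obtain w where w: "w \<in> ?D" "E1adj w b" "opp b w \<notin> ?D" by (auto simp: bnd_def)
    then have wl: "w \<in> lat P" using D by auto
    show False
      using bnd_iff[OF assms(1) wl w(2)] bnd_iff[OF assms(3) wl w(2)] assms(5) w(1,3) by blast
  qed
  with bnd_empty_imp[OF D] show ?thesis by auto
qed

lemma finite_bnd: "finite S \<Longrightarrow> finite (bnd S)"
  by (rule finite_subset[of _ "\<Union>w\<in>S. {(fst w + 1, snd w), (fst w - 1, snd w), (fst w, snd w + 1), (fst w, snd w - 1)}"])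
     (force simp: bnd_def E1adj_iff)+

text \<open>\<open>S\<close> collects the points from which a horizontal ray crosses \<open>Z\<close> an odd number of times.\<close>
lemma fill:
  assumes fin: "finite Z" and bl: "\<And>b. b \<in> Z \<Longrightarrow> black b"
    and ev: "\<And>w. w \<in> lat (\<not> P) \<Longrightarrow> even_at Z w"
  obtains S where "finite S" "S \<subseteq> lat P" "bnd S = Z"
proof -
  define ray where "ray x y = {b \<in> Z. snd b = y \<and> fst b > x}" for x y
  define q where "q x y = odd (card (ray x y))" for x y
  have finr: "finite (ray x y)" for x y using fin by (simp add: ray_def)
  have q1: "q x y \<longleftrightarrow> ((x+1,y) \<in> Z) \<noteq> q (x+1) y" for x y
  proof -
    have "ray x y = (if (x+1,y) \<in> Z then insert (x+1,y) (ray (x+1) y) else ray (x+1) y)"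
    proof -
      have "b \<in> ray x y \<longleftrightarrow> b = (x+1,y) \<and> b \<in> Z \<or> b \<in> ray (x+1) y" for b
      proof -
        have "x < fst b \<longleftrightarrow> fst b = x + 1 \<or> x + 1 < fst b" by arith
        then show ?thesis unfolding ray_def prod_eq_iff by auto
      qed
      then show ?thesis by (intro set_eqI) auto
    qed
    moreover have "(x+1,y) \<notin> ray (x+1) y" by (simp add: ray_def)
    ultimately show ?thesis using finr[of "x+1" y] by (cases "(x+1,y) \<in> Z") (simp_all add: q_def)
  qed
  \<comment> \<open>One lattice step to the right passes two points; the second is white, so only
    the first can lie in \<open>Z\<close>.\<close>
  have q2: "q x y \<longleftrightarrow> ((x+1,y) \<in> Z) \<noteq> q (x+2) y" if "even (x + y)" for x y
  proof -
    have "(x+2,y) \<notin> Z" using that bl[of "(x+2,y)"] by (auto simp: black_def white_def)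
    with q1[of x y] q1[of "x+1" y] show ?thesis by (simp add: algebra_simps)
  qed
  obtain B where B: "\<And>b. b \<in> Z \<Longrightarrow> \<bar>fst b\<bar> < B \<and> \<bar>snd b\<bar> < B" "B > 0"
  proof -
    define B where "B = 1 + Max (insert 0 ((\<lambda>b. \<bar>fst b\<bar> + \<bar>snd b\<bar>) ` Z))"
    have "\<bar>fst b\<bar> + \<bar>snd b\<bar> \<le> B - 1" if "b \<in> Z" for b
      unfolding B_def using that fin by (auto intro!: Max_ge)
    moreover have "0 \<le> B - 1" unfolding B_def using fin by (auto intro!: Max_ge)
    ultimately have "\<And>b. b \<in> Z \<Longrightarrow> \<bar>fst b\<bar> < B \<and> \<bar>snd b\<bar> < B" "B > 0"
      by (smt (verit))+
    then show ?thesis using that by blast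
  qed
  have qbig: "\<not> q x y" if "x \<ge> B \<or> \<bar>y\<bar> \<ge> B" for x y
  proof -
    have "ray x y = {}" using that B unfolding ray_def by (smt (verit) Collect_empty_eq)
    then show ?thesis by (simp add: q_def)
  qed
  \<comment> \<open>The boundary condition across a vertical lattice step. To the right of
    \<open>Z\<close> nothing is crossed; evenness at \<open>(i+1,j)\<close>, a point of the other
    lattice, carries the claim from abscissa \<open>i+2\<close> to \<open>i\<close>.\<close>
  have vert: "(q i (j-1) \<noteq> q i (j+1)) = ((i,j) \<in> Z)" if "(i,j+1) \<in> lat P" for i j
    using that
  proof (induction "nat (B + 2 - i)" arbitrary: i rule: less_induct)
    case less
    show ?case
    proof (cases "i \<ge> B")
      case True
      then show ?thesis using qbig[of i] B(1)[of "(i,j)"] by fastforce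
    next
      case False
      have "(i+2,j+1) \<in> lat P" using less.prems by (auto simp: lat_def white_def)
      then have IH: "(q (i+2) (j-1) \<noteq> q (i+2) (j+1)) = ((i+2,j) \<in> Z)"
        using less.hyps[of "i+2"] False by auto
      have "(i+1,j) \<in> lat (\<not> P)" using less.prems by (auto simp: lat_def white_def)
      from ev[OF this] have e: "(((i+2,j) \<in> Z) = ((i,j) \<in> Z)) = (((i+1,j+1) \<in> Z) = ((i+1,j-1) \<in> Z))"
          by (simp add: even_at_iff algebra_simps)
      have "even (i + (j+1))" "even (i + (j-1))" using less.prems by (auto simp: lat_def white_def)
      from q2[OF this(1)] q2[OF this(2)] IH e show ?thesis by argo
    qed
  qed
  \<comment> \<open>Left of \<open>Z\<close> a vertical step meets no point of \<open>Z\<close>, so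
    \<open>q\<close> keeps the value false that it has above \<open>Z\<close>. This bounds
    \<open>S\<close> on the left.\<close>
  have qleft: "\<not> q x y" if "(x,y) \<in> lat P" "x \<le> - B" for x y
    using that
  proof (induction "nat (B + 2 - y)" arbitrary: y rule: less_induct)
    case less
    show ?case
    proof (cases "y \<ge> B")
      case True
      then have "\<bar>y\<bar> \<ge> B" by linarith
      then show ?thesis using qbig by blast
    next
      case False
      have l: "(x,y+2) \<in> lat P" using less.prems by (auto simp: lat_def white_def)
      have "\<not> q x (y+2)" using less.hyps[of "y+2"] l less.prems False by auto
      moreover have "(x,y+1) \<notin> Z" using B(1)[of "(x,y+1)"] less.prems by auto
      ultimately show ?thesis using vert[of x "y+1"] l by (simp add: algebra_simps)
    qed
  qed
  define S where "S = {w \<in> lat P. q (fst w) (snd w)}"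
  have S: "S \<subseteq> lat P" by (auto simp: S_def)
  have "S \<subseteq> {-B..B} \<times> {-B..B}"
  proof
    fix w assume "w \<in> S"
    then have "q (fst w) (snd w)" "w \<in> lat P" by (auto simp: S_def)
    with qbig[of "fst w" "snd w"] qleft[of "fst w" "snd w"]
    have "fst w < B" "\<bar>snd w\<bar> < B" "\<not> fst w \<le> - B" by (auto simp: not_le[symmetric])
    then show "w \<in> {-B..B} \<times> {-B..B}" by (auto simp: mem_Times_iff)
  qed
  then have finS: "finite S" by (rule finite_subset) simp
  have "b \<in> bnd S \<longleftrightarrow> b \<in> Z" for b
  proof (cases "black b")
    case False
    then show ?thesis using bl S lat_black unfolding bnd_def by blast
  next
    case True
    obtain i j where b: "b = (i,j)" by force
    show ?thesis
    proof (cases "(i,j+1) \<in> lat P")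
      case True
      have "(i,j-1) \<in> lat P" using True by (auto simp: lat_def white_def)
      then show ?thesis
        using bnd_iff[OF S True, of b] vert[OF True] True b
        by (auto simp: E1adj_def opp_def S_def algebra_simps)
    next
      case False
      then have l: "(i-1,j) \<in> lat P" using \<open>black b\<close> b by (auto simp: lat_def white_def black_def)
      then have l': "(i+1,j) \<in> lat P" by (auto simp: lat_def white_def)
      have "even (i - 1 + j)" using l by (auto simp: lat_def white_def)
      from q2[OF this] show ?thesis
        using bnd_iff[OF S l, of b] b l l'
        by (auto simp: E1adj_def opp_def S_def algebra_simps)
    qed
  qed
  then show ?thesis using that finS S by blast
qed

section \<open>Euler's formula and cycles\<close>

lemma opp_in_W0: "x \<in> W0 \<Longrightarrow> opp b x \<in> W0" and opp_in_W1: "c \<in> W1 \<Longrightarrow> opp b c \<in> W1"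
  unfolding W0_lat W1_lat by (rule opp_in_lat, assumption)+

section \<open>Vertices and edges of \<open>H\<close> through their midpoints\<close>

lemma mids_iff: "b \<in> mids F \<longleftrightarrow> (\<exists>c\<in>F. E1adj c b)"
proof -
  have "b \<in> face_mids c \<longleftrightarrow> E1adj c b" for c by (cases c) (simp add: face_mids_def E1adj_iff)
  then show ?thesis by (simp add: mids_def)
qed

lemma VH_iff: "x \<in> VH F \<longleftrightarrow> (\<exists>c\<in>F. \<bar>fst x - fst c\<bar> = 1 \<and> \<bar>snd x - snd c\<bar> = 1)"
proof -
  have "x \<in> face_corners c \<longleftrightarrow> \<bar>fst x - fst c\<bar> = 1 \<and> \<bar>snd x - snd c\<bar> = 1" for c
    by (cases x; cases c; simp add: face_corners_def; arith)
  then show ?thesis by (simp add: VH_def)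
qed

lemma corner_of_mid:
  assumes "c \<in> W1" "x \<in> W0" "E1adj c b" "E1adj x b"
  shows "\<bar>fst x - fst c\<bar> = 1 \<and> \<bar>snd x - snd c\<bar> = 1"
  using assms by (cases x; cases c; cases b) (auto simp: E1adj_iff W0_def W1_def)

lemma VH_subset: "F \<subseteq> W1 \<Longrightarrow> VH F \<subseteq> W0"
proof
  fix x assume F: "F \<subseteq> W1" and "x \<in> VH F"
  then obtain c where c: "c \<in> W1" "\<bar>fst x - fst c\<bar> = 1" "\<bar>snd x - snd c\<bar> = 1"
    unfolding VH_iff by blast
  then have "fst x = fst c + 1 \<or> fst x = fst c - 1" "snd x = snd c + 1 \<or> snd x = snd c - 1" by arith+
  then show "x \<in> W0" using c(1) by (auto simp: W0_def W1_def)
qed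

lemma VH_if_mid: "F \<subseteq> W1 \<Longrightarrow> b \<in> mids F \<Longrightarrow> x \<in> W0 \<Longrightarrow> E1adj x b \<Longrightarrow> x \<in> VH F"
  using corner_of_mid unfolding VH_iff mids_iff by (meson subsetD)

lemma finite_mids: "finite F \<Longrightarrow> finite (mids F)"
  by (auto simp: mids_def face_mids_def split: prod.splits)

lemma finite_VH: "finite F \<Longrightarrow> finite (VH F)"
  by (auto simp: VH_def face_corners_def split: prod.splits)

lemma mids_black: "F \<subseteq> W1 \<Longrightarrow> b \<in> mids F \<Longrightarrow> black b"
  unfolding mids_iff W1_lat using lat_black by blast

lemma bnd_subset_mids: "S \<subseteq> F \<Longrightarrow> bnd S \<subseteq> mids F"
  unfolding bnd_def mids_iff subset_iff by blast

text \<open>Passes from a midpoint to the two-element edges that spanning trees are made of;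
  collecting the ends in \<open>W0\<close> avoids choosing one of them.\<close>

definition ed :: "pt \<Rightarrow> pt set" where
  "ed b = {x \<in> W0. E1adj x b}"

lemma ed_eq: "x \<in> W0 \<Longrightarrow> E1adj x b \<Longrightarrow> ed b = {x, opp b x}"
  unfolding ed_def W0_lat by (rule lat_nbrs)

lemma ed_inj:
  assumes "black b" "ed b = ed b'"
  shows "b = b'"
proof -
  obtain w where w: "w \<in> W0" "E1adj w b" using black_nbr_ex[OF assms(1)] W0_lat by metis
  then have e: "ed b' = {w, opp b w}" using ed_eq assms(2) by simp
  then have "E1adj w b'" unfolding ed_def by blast
  then have "{w, opp b w} = {w, opp b' w}" using ed_eq w(1) e by metis
  then have "opp b w = opp b' w" by (auto simp: doubleton_eq_iff)
  then show ?thesis by (cases b; cases b') (auto simp: opp_def)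
qed

lemma EH_eq:
  assumes "F \<subseteq> W1"
  shows "EH F = ed ` mids F"
proof -
  have "face_sides c = ed ` face_mids c" if c: "c \<in> W1" for c
  proof -
    obtain x y where xy: "c = (x,y)" by force
    have w: "(x+1,y+1) \<in> W0" "(x+1,y-1) \<in> W0" "(x-1,y+1) \<in> W0" "(x-1,y-1) \<in> W0"
      using c xy by (auto simp: W0_def W1_def)
    have "ed (x+1,y) = {(x+1,y+1), (x+1,y-1)}"
      using ed_eq[OF w(1), of "(x+1,y)"] by (simp add: E1adj_def opp_def)
    moreover have "ed (x-1,y) = {(x-1,y-1), (x-1,y+1)}"
      using ed_eq[OF w(4), of "(x-1,y)"] by (simp add: E1adj_def opp_def)
    moreover have "ed (x,y+1) = {(x-1,y+1), (x+1,y+1)}"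
      using ed_eq[OF w(3), of "(x,y+1)"] by (simp add: E1adj_def opp_def)
    moreover have "ed (x,y-1) = {(x+1,y-1), (x-1,y-1)}"
      using ed_eq[OF w(2), of "(x,y-1)"] by (simp add: E1adj_def opp_def)
    ultimately show ?thesis unfolding xy by (auto simp: face_sides_def face_mids_def)
  qed
  then show ?thesis using assms unfolding EH_def mids_def by (auto simp: image_UN subset_iff)
qed

text \<open>\<open>K\<close> is a finite union of components of the complement of \<open>S\<close>
  in the lattice on \<open>W1\<close>, so bounded components are excluded. Steps are horizontal or
  vertical: two squares of \<open>S\<close> meeting in a corner block the passage between
  them.\<close>

definition no_holes :: "pt set \<Rightarrow> bool" where
  "no_holes S \<longleftrightarrow> (\<forall>K. finite K \<longrightarrow> K \<subseteq> W1 - S \<longrightarrow>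
     (\<forall>c\<in>K. \<forall>b. E1adj c b \<longrightarrow> opp b c \<notin> S \<longrightarrow> opp b c \<in> K) \<longrightarrow> K = {})"

text \<open>\<open>x\<close> may lie in either lattice, so the relation describes walks in
  \<open>\<Lambda>\<close> along the edges in \<open>B\<close> as well as walks in the dual across
  them.\<close>

definition hstep :: "pt set \<Rightarrow> pt \<Rightarrow> pt \<Rightarrow> bool" where
  "hstep B x y \<longleftrightarrow> (\<exists>b\<in>B. E1adj x b \<and> y = opp b x)"

definition hconn :: "pt set \<Rightarrow> bool" where
  "hconn F \<longleftrightarrow> (\<forall>x\<in>VH F. \<forall>y\<in>VH F. (hstep (mids F))\<^sup>*\<^sup>* x y)"

text \<open>Every point of \<open>Z\<close> has exactly two ends in \<open>lat P\<close>, so the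
  degrees add up to an even number and a single odd degree is impossible.\<close>

lemma even_at_handshake:
  assumes fin: "finite Z" and bl: "\<And>b. b \<in> Z \<Longrightarrow> black b"
    and r: "r \<in> lat P" and ev: "\<And>w. w \<in> lat P \<Longrightarrow> w \<noteq> r \<Longrightarrow> even_at Z w"
  shows "even_at Z r"
proof -
  define A where "A = insert r (\<Union>b\<in>Z. {w \<in> lat P. E1adj w b})"
  have two: "card {w \<in> lat P. E1adj w b} = 2" "finite {w \<in> lat P. E1adj w b}" if b: "b \<in> Z" for b
  proof -
    obtain w where w: "w \<in> lat P" "E1adj w b" using black_nbr_ex[OF bl[OF b]] by metis
    show "card {w \<in> lat P. E1adj w b} = 2" "finite {w \<in> lat P. E1adj w b}"
      unfolding lat_nbrs[OF w] using opp_neq[OF w(2)] by auto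
  qed
  have finA: "finite A" unfolding A_def using fin two by auto
  have sub: "A \<subseteq> lat P" using r by (auto simp: A_def)
  have "{w \<in> A. E1adj w b} = {w \<in> lat P. E1adj w b}" if "b \<in> Z" for b
    using that sub by (auto simp: A_def)
  then have "(\<Sum>w\<in>A. card {b \<in> Z. E1adj w b}) = 2 * card Z"
    using two by (intro sum_multicount[OF finA fin]) auto
  moreover have "(\<Sum>w\<in>A. card {b \<in> Z. E1adj w b})
      = card {b \<in> Z. E1adj r b} + (\<Sum>w\<in>A - {r}. card {b \<in> Z. E1adj w b})"
    using finA by (intro sum.remove) (auto simp: A_def)
  moreover have "even (\<Sum>w\<in>A - {r}. card {b \<in> Z. E1adj w b})"
    using ev sub by (intro dvd_sum) (auto simp: even_at_def)
  ultimately have "even (card {b \<in> Z. E1adj r b} + (\<Sum>w\<in>A - {r}. card {b \<in> Z. E1adj w b}))"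
    and "even (\<Sum>w\<in>A - {r}. card {b \<in> Z. E1adj w b})"
    by simp_all
  then show ?thesis unfolding even_at_def even_add by blast
qed

text \<open>The filling cannot leave \<open>F\<close>: its boundary consists of sides of faces in
  \<open>F\<close>, so its part outside \<open>F\<close> is closed under steps in the complement of
  \<open>F\<close> and would be a hole.\<close>

lemma fill_subset:
  assumes F: "F \<subseteq> W1" "no_holes F" and Z: "finite Z" "Z \<subseteq> mids F" "\<And>w. w \<in> W0 \<Longrightarrow> even_at Z w"
  obtains S where "S \<subseteq> F" "finite S" "bnd S = Z"
proof -
  have "\<And>b. b \<in> Z \<Longrightarrow> black b" using Z(2) F(1) mids_black by blast
  then obtain S where S: "finite S" "S \<subseteq> W1" "bnd S = Z"
    using fill[of Z False] Z unfolding W1_lat W0_lat by auto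
  have "S - F = {}"
  proof (rule F(2)[unfolded no_holes_def, rule_format])
    fix c b assume c: "c \<in> S - F" "E1adj c b" "opp b c \<notin> F"
    have cl: "c \<in> lat False" using c S W1_lat by auto
    have "b \<notin> mids F"
    proof
      assume "b \<in> mids F"
      then obtain c' where c': "c' \<in> F" "E1adj c' b" by (auto simp: mids_iff)
      then have "c' \<in> lat False" using F(1) W1_lat by auto
      from E1adj_cases[OF cl this c(2) c'(2)] c c' show False by auto
    qed
    then have "b \<notin> bnd S" using S(3) Z(2) by auto
    with bnd_iff[of S False c b] S(2) c cl show "opp b c \<in> S - F" unfolding W1_lat by auto
  qed (use S in auto)
  then show ?thesis using that S by blast
qed

lemma odd_card_sym_diff:
  assumes "finite A" "finite B"
  shows "odd (card (sym_diff A B)) \<longleftrightarrow> odd (card A) \<noteq> odd (card B)"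
proof -
  have "card A = card (A - B) + card (A \<inter> B)" "card B = card (B - A) + card (A \<inter> B)"
    using card_Int_Diff[of A B] card_Int_Diff[of B A] assms by (auto simp: Int_commute)
  moreover have "card (sym_diff A B) = card (A - B) + card (B - A)"
    using assms by (intro card_Un_disjoint) auto
  ultimately show ?thesis by auto
qed

text \<open>Order of the kernel times order of the image, for a homomorphism on the group
  \<open>Pow E\<close> under symmetric difference; the fibres are translates of the kernel.\<close>

lemma card_Pow_hom:
  fixes h :: "'a set \<Rightarrow> 'b set"
  assumes fin: "finite E"
    and hom: "\<And>A B. A \<subseteq> E \<Longrightarrow> B \<subseteq> E \<Longrightarrow> h (sym_diff A B) = sym_diff (h A) (h B)"
  shows "card (Pow E) = card {Z \<in> Pow E. h Z = {}} * card (h ` Pow E)"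
proof -
  have "card {Z \<in> Pow E. h Z = y} = card {Z \<in> Pow E. h Z = {}}" if y: "y \<in> h ` Pow E" for y
  proof -
    obtain Z0 where Z0: "Z0 \<subseteq> E" "h Z0 = y" using y by auto
    have "bij_betw (\<lambda>Z. sym_diff Z Z0) {Z \<in> Pow E. h Z = {}} {Z \<in> Pow E. h Z = y}"
    proof (rule bij_betwI[where g = "\<lambda>Z. sym_diff Z Z0"])
      show "(\<lambda>Z. sym_diff Z Z0) \<in> {Z \<in> Pow E. h Z = {}} \<rightarrow> {Z \<in> Pow E. h Z = y}"
        using Z0 hom[OF _ Z0(1)] by auto
      show "(\<lambda>Z. sym_diff Z Z0) \<in> {Z \<in> Pow E. h Z = y} \<rightarrow> {Z \<in> Pow E. h Z = {}}"
        using Z0 hom[OF _ Z0(1)] by auto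
    qed auto
    from bij_betw_same_card[OF this] show ?thesis by simp
  qed
  then have "(\<Sum>y\<in>h ` Pow E. card {Z \<in> Pow E. h Z = y})
      = card {Z \<in> Pow E. h Z = {}} * card (h ` Pow E)" by simp
  moreover have "card (Pow E) = (\<Sum>y\<in>h ` Pow E. card {Z \<in> Pow E. h Z = y})"
    using sum.image_gen[of "Pow E" "\<lambda>_. 1::nat" h] fin by simp
  ultimately show ?thesis by simp
qed

declare split_paired_All [simp del] split_paired_Ex [simp del]
text \<open>Over the two-element field, \<open>bnd\<close> identifies \<open>Pow F\<close> with the cycle space of \<open>H\<close>.\<close>
lemma euler:
  assumes F: "finite F" "F \<subseteq> W1" "F \<noteq> {}" and conn: "hconn F" and nh: "no_holes F"
  shows "card F + card (VH F) = card (mids F) + 1"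
proof -
  let ?V = "VH F" and ?E = "mids F"
  have fV: "finite ?V" and fE: "finite ?E" using F by (auto intro: finite_VH finite_mids)
  have VW: "?V \<subseteq> W0" using F VH_subset by auto
  have "VH F \<noteq> {}" using F(3) by (auto simp: VH_def face_corners_def split: prod.splits)
  then obtain r where r: "r \<in> ?V" by blast
  \<comment> \<open>The boundary map with the vertex \<open>r\<close> left out: by the handshake
    argument the parity at \<open>r\<close> follows from the others, and without it the map is
    onto.\<close>
  define h where "h Z = {x \<in> ?V. x \<noteq> r \<and> odd (card {b \<in> Z. E1adj x b})}" for Z
  have hom: "h (sym_diff A B) = sym_diff (h A) (h B)" if "A \<subseteq> ?E" "B \<subseteq> ?E" for A B
  proof -
    have "odd (card {b \<in> sym_diff A B. E1adj x b}) \<longleftrightarrow>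
        odd (card {b \<in> A. E1adj x b}) \<noteq> odd (card {b \<in> B. E1adj x b})" for x
    proof -
      have "{b \<in> sym_diff A B. E1adj x b} = sym_diff {b \<in> A. E1adj x b} {b \<in> B. E1adj x b}" by auto
      moreover have "finite {b \<in> A. E1adj x b}" "finite {b \<in> B. E1adj x b}"
        using finite_subset[OF that(1) fE] finite_subset[OF that(2) fE] by simp_all
      ultimately show ?thesis by (simp only: odd_card_sym_diff not_False_eq_True)
    qed
    then show ?thesis unfolding h_def by auto
  qed
  have single: "h {b} = {x, opp b x} - {r}" if "b \<in> ?E" "x \<in> ?V" "E1adj x b" for b x
  proof -
    have xl: "x \<in> lat True" using VW that W0_lat by auto
    have "{b' \<in> {b}. E1adj y b'} = (if E1adj y b then {b} else {})" for y by auto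
    then have "h {b} = {y \<in> ?V. y \<noteq> r \<and> E1adj y b}" unfolding h_def by auto
    moreover have "{y \<in> ?V. E1adj y b} = {x, opp b x}"
      using VH_if_mid[OF F(2) that(1)] VW lat_nbrs[OF xl that(3)] unfolding W0_lat by auto
    ultimately show ?thesis by blast
  qed
  \<comment> \<open>The mod 2 sum of the edges of a walk from \<open>r\<close> to \<open>x\<close>
    has only its two ends as boundary, so connectedness of \<open>H\<close> puts every singleton
    into the image.\<close>
  have ex1: "\<exists>Z \<subseteq> ?E. h Z = {x} - {r}" if "(hstep ?E)\<^sup>*\<^sup>* r x" "x \<in> ?V" for x
  proof -
    have "x \<in> ?V \<and> (\<exists>Z \<subseteq> ?E. h Z = {x} - {r})" using that(1)
    proof (induction rule: rtranclp_induct)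
      case base
      have "h {} = {r} - {r}" by (auto simp: h_def)
      then show ?case using r by blast
    next
      case (step y z)
      then obtain Z where Z: "Z \<subseteq> ?E" "h Z = {y} - {r}" "y \<in> ?V" by auto
      obtain b where b: "b \<in> ?E" "E1adj y b" "z = opp b y" using step by (auto simp: hstep_def)
      have zW: "z \<in> W0" "E1adj z b" using b VW Z(3) opp_in_W0[of y b] by auto
      then have "z \<in> ?V" using VH_if_mid[OF F(2) b(1)] by auto
      moreover have "h (sym_diff Z {b}) = {z} - {r}"
      proof -
        have bE: "{b} \<subseteq> ?E" using b(1) by blast
        have "h (sym_diff Z {b}) = sym_diff ({y} - {r}) ({y, opp b y} - {r})"
          unfolding hom[OF Z(1) bE] single[OF b(1) Z(3) b(2)] Z(2) ..
        also have "\<dots> = {z} - {r}" unfolding b(3) using opp_neq[OF b(2)] by auto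
        finally show ?thesis .
      qed
      ultimately show ?case using Z(1) b(1) by (intro conjI exI[of _ "sym_diff Z {b}"]) auto
    qed
    then show ?thesis by blast
  qed
  have img: "h ` Pow ?E = Pow (?V - {r})"
  proof
    show "h ` Pow ?E \<subseteq> Pow (?V - {r})" by (auto simp: h_def)
    show "Pow (?V - {r}) \<subseteq> h ` Pow ?E"
    proof
      fix U assume U: "U \<in> Pow (?V - {r})"
      then have "finite U" using fV finite_subset by blast
      then show "U \<in> h ` Pow ?E" using U
      proof (induction U rule: finite_induct)
        case empty
        have "h {} = {}" by (auto simp: h_def)
        then show ?case using image_eqI[of "{}" h "{}" "Pow ?E"] by simp
      next
        case (insert x U)
        then obtain Z where Z: "Z \<subseteq> ?E" "h Z = U" by auto
        have x: "x \<in> ?V" "x \<noteq> r" using insert by auto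
        then obtain Z' where Z': "Z' \<subseteq> ?E" "h Z' = {x} - {r}"
          using ex1 conn r unfolding hconn_def by blast
        have "h (sym_diff Z Z') = sym_diff U ({x} - {r})" unfolding hom[OF Z(1) Z'(1)] Z(2) Z'(2) ..
        also have "\<dots> = insert x U" using x(2) insert(2) by auto
        finally have "h (sym_diff Z Z') = insert x U" .
        moreover have "sym_diff Z Z' \<in> Pow ?E" using Z Z' by auto
        ultimately show ?case using image_eqI[of "insert x U" h "sym_diff Z Z'" "Pow ?E"] by simp
      qed
    qed
  qed
  have "bij_betw bnd (Pow F) {Z \<in> Pow ?E. h Z = {}}"
  proof (rule bij_betw_imageI)
    show "inj_on bnd (Pow F)"
    proof (rule inj_onI)
      fix S S' assume "S \<in> Pow F" "S' \<in> Pow F" "bnd S = bnd S'"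
      then show "S = S'" using bnd_inj[of S False S'] F finite_subset unfolding W1_lat by blast
    qed
    show "bnd ` Pow F = {Z \<in> Pow ?E. h Z = {}}"
    proof (intro equalityI subsetI)
      fix Z assume "Z \<in> bnd ` Pow F"
      then obtain S where S: "S \<subseteq> F" "Z = bnd S" by auto
      have "even_at Z x" if "x \<in> ?V" for x
        using even_at_bnd[of S False x] S that VW F(2) unfolding W1_lat W0_lat by auto
      then show "Z \<in> {Z \<in> Pow ?E. h Z = {}}"
        using bnd_subset_mids[OF S(1)] S(2) unfolding h_def even_at_def by auto
    next
      fix Z assume "Z \<in> {Z \<in> Pow ?E. h Z = {}}"
      then have Z: "Z \<subseteq> ?E" "h Z = {}" by auto
      have fZ: "finite Z" using Z fE finite_subset by auto
      have bl: "\<And>b. b \<in> Z \<Longrightarrow> black b" using Z mids_black F by blast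
      have ev: "even_at Z w" if "w \<in> W0" "w \<noteq> r" for w
      proof (cases "w \<in> ?V")
        case True
        then show ?thesis using Z(2) that unfolding h_def even_at_def by blast
      next
        case False
        then have "{b \<in> Z. E1adj w b} = {}" using VH_if_mid[OF F(2)] that(1) Z(1) by blast
        then show ?thesis unfolding even_at_def by (simp only: card.empty dvd_0_right)
      qed
      have "even_at Z r"
        using even_at_handshake[OF fZ bl, of r True] ev r VW unfolding W0_lat by blast
      then have "\<And>w. w \<in> W0 \<Longrightarrow> even_at Z w" using ev by blast
      then obtain S where "S \<subseteq> F" "bnd S = Z" using fill_subset[OF F(2) nh fZ Z(1)] by blast
      then show "Z \<in> bnd ` Pow F" by blast
    qed
  qed
  from bij_betw_same_card[OF this] have "card {Z \<in> Pow ?E. h Z = {}} = 2 ^ card F"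
    using card_Pow[OF F(1)] by simp
  moreover have "card (h ` Pow ?E) = 2 ^ (card ?V - 1)"
    unfolding img using card_Pow[of "?V - {r}"] fV r by simp
  \<comment> \<open>Edge sets are counted as kernel times image; comparing exponents gives Euler's
    formula.\<close>
  ultimately have "(2::nat) ^ card ?E = 2 ^ (card F + (card ?V - 1))"
    using card_Pow_hom[OF fE hom] card_Pow[OF fE] by (simp add: power_add)
  then have "card ?E = card F + (card ?V - 1)" by simp
  moreover have "card ?V > 0" using r fV card_gt_0_iff by blast
  ultimately show ?thesis by simp
qed

text \<open>Each \<open>x\<close> in \<open>A\<close> sends an arrow through
  \<open>\<beta> x\<close> to the far end. A minimal nonempty invariant set \<open>C\<close> is a
  single directed cycle: the successor map permutes it, and each of its points meets exactly the
  edge of its predecessor and its own. The last conclusion says that the cycle is simple, having no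
  proper nonempty even subset.\<close>

lemma closed_cycle:
  assumes A: "finite A" "A \<noteq> {}" "A \<subseteq> lat P"
    and adj: "\<And>x. x \<in> A \<Longrightarrow> E1adj x (\<beta> x)" and inj: "inj_on \<beta> A"
    and cl: "\<And>x. x \<in> A \<Longrightarrow> opp (\<beta> x) x \<in> A"
  obtains C where "C \<subseteq> A" "C \<noteq> {}" "\<And>x. x \<in> C \<Longrightarrow> opp (\<beta> x) x \<in> C"
    "\<And>w. w \<in> lat P \<Longrightarrow> even_at (\<beta> ` C) w"
    "\<And>Z. Z \<subseteq> \<beta> ` C \<Longrightarrow> (\<And>w. w \<in> lat P \<Longrightarrow> even_at Z w) \<Longrightarrow> Z = {} \<or> Z = \<beta> ` C"
proof -
  define g where "g x = opp (\<beta> x) x" for x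
  define Q where "Q C \<longleftrightarrow> C \<subseteq> A \<and> C \<noteq> {} \<and> g ` C \<subseteq> C" for C
  have "Q A" using A cl by (auto simp: Q_def g_def)
  then obtain C where C: "Q C" and min: "\<And>C'. Q C' \<Longrightarrow> card C \<le> card C'"
    using ex_has_least_nat[of Q A card] by blast
  have CA: "C \<subseteq> A" "finite C" "C \<subseteq> lat P" using C A finite_subset by (auto simp: Q_def)
  have "Q (g ` C)" using C by (auto simp: Q_def)
  then have "card C \<le> card (g ` C)" by (rule min)
  then have gC: "g ` C = C" using C CA by (intro card_seteq) (auto simp: Q_def)
  then have gi: "inj_on g C" using CA(2) by (intro eq_card_imp_inj_on) auto
  have inc: "{b \<in> Z. E1adj (g y) b} = {b \<in> Z. b = \<beta> y \<or> b = \<beta> (g y)}" "\<beta> (g y) \<noteq> \<beta> y"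
    if y: "y \<in> C" and Z: "Z \<subseteq> \<beta> ` C" for y Z
  proof -
    have gy: "g y \<in> C" using gC y by blast
    have a: "E1adj y (\<beta> y)" "E1adj (g y) (\<beta> (g y))" using adj CA y gy by blast+
    show "\<beta> (g y) \<noteq> \<beta> y"
      using opp_neq[OF a(1)] inj CA(1) y gy unfolding g_def inj_on_def by blast
    show "{b \<in> Z. E1adj (g y) b} = {b \<in> Z. b = \<beta> y \<or> b = \<beta> (g y)}"
    proof (intro Collect_cong conj_cong refl iffI)
      fix b assume b: "b \<in> Z" "E1adj (g y) b"
      then obtain z where z: "z \<in> C" "b = \<beta> z" using Z by blast
      have az: "E1adj z b" using adj CA z by blast
      have "g y = z \<or> g y = g z"
        using E1adj_cases[OF _ _ az b(2)] z gy CA(3) unfolding g_def by auto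
      then show "b = \<beta> y \<or> b = \<beta> (g y)" using gi y z by (auto dest: inj_onD)
    next
      fix b assume "b = \<beta> y \<or> b = \<beta> (g y)"
      then show "E1adj (g y) b" using a by (auto simp: g_def)
    qed
  qed
  have ev: "even_at Z (g y) \<longleftrightarrow> (\<beta> y \<in> Z) = (\<beta> (g y) \<in> Z)" if "y \<in> C" "Z \<subseteq> \<beta> ` C" for y Z
  proof -
    have "{b \<in> Z. b = \<beta> y \<or> b = \<beta> (g y)} =
       (if \<beta> y \<in> Z then {\<beta> y} else {}) \<union> (if \<beta> (g y) \<in> Z then {\<beta> (g y)} else {})" by auto
    then show ?thesis unfolding even_at_def inc(1)[OF that] using inc(2)[OF that] by auto
  qed
  show ?thesis
  proof
    show "C \<subseteq> A" "C \<noteq> {}" using C by (auto simp: Q_def)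
    show "opp (\<beta> x) x \<in> C" if "x \<in> C" for x using gC that unfolding g_def by blast
    show "even_at (\<beta> ` C) w" if w: "w \<in> lat P" for w
    proof (cases "w \<in> C")
      case True
      then obtain y where "y \<in> C" "w = g y" using gC by blast
      then show ?thesis using ev[of y "\<beta> ` C"] True by auto
    next
      case False
      have "\<not> E1adj w (\<beta> z)" if z: "z \<in> C" for z
      proof
        assume "E1adj w (\<beta> z)"
        then have "w = z \<or> w = g z"
          using E1adj_cases[OF _ w, of z "\<beta> z"] adj z CA unfolding g_def by blast
        then show False using False z gC by blast
      qed
      then have "{b \<in> \<beta> ` C. E1adj w b} = {}" by blast
      then show ?thesis unfolding even_at_def by (simp only: card.empty dvd_0_right)
    qed
    show "Z = {} \<or> Z = \<beta> ` C" if Z: "Z \<subseteq> \<beta> ` C" "\<And>w. w \<in> lat P \<Longrightarrow> even_at Z w" for Z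
    proof (rule ccontr)
      assume n: "\<not> (Z = {} \<or> Z = \<beta> ` C)"
      \<comment> \<open>Evenness at \<open>g y\<close> passes membership in \<open>Z\<close> from
        the edge entering that point to the edge leaving it, so \<open>?C'\<close> is invariant and
        contradicts minimality.\<close>
      let ?C' = "{y \<in> C. \<beta> y \<in> Z}"
      have "g y \<in> ?C'" if "y \<in> ?C'" for y
      proof -
        have y: "y \<in> C" "\<beta> y \<in> Z" using that by auto
        then have gy: "g y \<in> C" using gC by blast
        then have "even_at Z (g y)" using Z(2) CA(3) by blast
        then show ?thesis using ev[OF y(1) Z(1)] y gy by blast
      qed
      moreover have "?C' \<noteq> {}" using n Z(1) by blast
      ultimately have "Q ?C'" using CA(1) unfolding Q_def by blast
      from min[OF this] have "?C' = C" using CA by (intro card_seteq) auto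
      then show False using n Z(1) by blast
    qed
  qed
qed

text \<open>The first vertex of a longest simple path has two edges in \<open>Z\<close>, and by
  maximality both lead back to the path.\<close>

lemma even_imp_has_cycle:
  assumes fin: "finite Z" and ne: "Z \<noteq> {}" and bl: "\<And>b. b \<in> Z \<Longrightarrow> black b"
    and ev: "\<And>w. w \<in> W0 \<Longrightarrow> even_at Z w"
  shows "has_cycle (ed ` Z)"
proof -
  define V where "V = (\<Union>b\<in>Z. ed b)"
  define Q where "Q vs \<longleftrightarrow> vs \<noteq> [] \<and> distinct vs \<and> set vs \<subseteq> V
     \<and> (\<forall>i. Suc i < length vs \<longrightarrow> {vs ! i, vs ! Suc i} \<in> ed ` Z)" for vs
  have edb: "\<exists>w. ed b = {w, opp b w}" if "b \<in> Z" for b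
    using black_nbr_ex[OF bl[OF that]] ed_eq W0_lat by metis
  then have "finite (ed b)" if "b \<in> Z" for b using that by fastforce
  then have fV: "finite V" unfolding V_def using fin by auto
  have VW: "V \<subseteq> W0" by (auto simp: V_def ed_def)
  obtain b0 where "b0 \<in> Z" using ne by blast
  then obtain w where "w \<in> V" using edb unfolding V_def by blast
  then have Q0: "Q [w]" by (auto simp: Q_def)
  have "length vs < Suc (card V)" if "Q vs" for vs
    using that distinct_card[of vs] card_mono[OF fV, of "set vs"] by (auto simp: Q_def)
  then obtain vs where vs: "Q vs" and max: "\<And>us. Q us \<Longrightarrow> length us \<le> length vs"
    using ex_has_greatest_nat[of Q "[w]" length "Suc (card V)"] Q0 by (metis less_imp_le)
  obtain x vs' where x: "vs = x # vs'" using vs by (cases vs) (auto simp: Q_def)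
  have xV: "x \<in> V" "x \<in> W0" using vs x VW by (auto simp: Q_def)
  then obtain b1 where b1: "b1 \<in> Z" "E1adj x b1" by (auto simp: V_def ed_def)
  have "\<exists>b2. b2 \<in> Z \<and> E1adj x b2 \<and> b2 \<noteq> b1"
  proof (rule ccontr)
    assume "\<not> ?thesis"
    then have "{b \<in> Z. E1adj x b} = {b1}" using b1 by blast
    then have "card {b \<in> Z. E1adj x b} = 1" by (simp only: is_singletonI is_singleton_altdef[symmetric])
    then show False using ev[OF xV(2)] unfolding even_at_def by simp
  qed
  then obtain b2 where b2: "b2 \<in> Z" "E1adj x b2" "b2 \<noteq> b1" by blast
  have pos: "\<exists>i < length vs. i > 0 \<and> vs ! i = opp b x" if b: "b \<in> Z" "E1adj x b" for b
  proof -
    have e: "ed b = {x, opp b x}" using ed_eq xV b by blast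
    have yV: "opp b x \<in> V" using e b unfolding V_def by blast
    have "opp b x \<in> set vs"
    proof (rule ccontr)
      assume n: "opp b x \<notin> set vs"
      have "Q (opp b x # vs)"
        unfolding Q_def
      proof (intro conjI allI impI)
        show "opp b x # vs \<noteq> []" by simp
        show "distinct (opp b x # vs)" using n vs by (auto simp: Q_def)
        show "set (opp b x # vs) \<subseteq> V" using yV vs by (auto simp: Q_def)
        fix i assume "Suc i < length (opp b x # vs)"
        then show "{(opp b x # vs) ! i, (opp b x # vs) ! Suc i} \<in> ed ` Z"
          using vs e b x unfolding Q_def by (cases i) (auto simp: insert_commute)
      qed
      from max[OF this] show False by simp
    qed
    then obtain i where "i < length vs" "vs ! i = opp b x" by (auto simp: in_set_conv_nth)
    moreover have "i > 0" using calculation opp_neq[OF b(2)] x by (cases i) auto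
    ultimately show ?thesis by blast
  qed
  obtain i1 where i1: "i1 < length vs" "i1 > 0" "vs ! i1 = opp b1 x" using pos[OF b1] by blast
  obtain i2 where i2: "i2 < length vs" "i2 > 0" "vs ! i2 = opp b2 x" using pos[OF b2(1,2)] by blast
  have "opp b1 x \<noteq> opp b2 x" using b2(3) by (cases b1; cases b2) (auto simp: opp_def)
  then have "i1 \<noteq> i2" using i1 i2 by auto
  \<comment> \<open>Two different neighbours cannot both be at position 1; the one further along
    gives a cycle of at least three vertices.\<close>
  then obtain i b where i: "i < length vs" "i \<ge> 2" "vs ! i = opp b x" and b: "b \<in> Z" "E1adj x b"
    using i1 i2 b1 b2 by (cases "i1 < i2") fastforce+
  show ?thesis unfolding has_cycle_def
  proof (intro exI[of _ "take (Suc i) vs"] conjI allI impI)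
    show "3 \<le> length (take (Suc i) vs)" using i by simp
    show "distinct (take (Suc i) vs)" using vs by (simp add: Q_def)
    fix j assume "j < length (take (Suc i) vs)"
    then have j: "j \<le> i" "length (take (Suc i) vs) = Suc i" using i by auto
    show "{take (Suc i) vs ! j, take (Suc i) vs ! ((j + 1) mod length (take (Suc i) vs))} \<in> ed ` Z"
    proof (cases "j = i")
      case True
      have "{vs ! i, vs ! 0} = ed b" using i x ed_eq[OF xV(2) b(2)] by auto
      then show ?thesis using True b j by auto
    next
      case False
      then show ?thesis using j i vs unfolding Q_def by auto
    qed
  qed
qed

section \<open>From topology to combinatorics\<close>

lemma hstep_sym:
  assumes "hstep B x y" shows "hstep B y x"
  using assms unfolding hstep_def by (metis E1adj_opp opp_opp)

lemma hstep_rtranclp_sym: "(hstep B)\<^sup>*\<^sup>* x y \<Longrightarrow> (hstep B)\<^sup>*\<^sup>* y x"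
  by (induction rule: rtranclp_induct) (auto intro: hstep_sym converse_rtranclp_into_rtranclp)

lemma hstep_rtranclp_mono: "A \<subseteq> B \<Longrightarrow> (hstep A)\<^sup>*\<^sup>* x y \<Longrightarrow> (hstep B)\<^sup>*\<^sup>* x y"
  by (erule rtranclp_mono[THEN predicate2D, rotated]) (unfold hstep_def, blast)

lemma VH_single: "VH {(a,c)} = {(a+1,c+1), (a+1,c-1), (a-1,c+1), (a-1,c-1)}"
  by (simp add: VH_def face_corners_def)

lemma mids_single: "mids {(a,c)} = {(a+1,c), (a-1,c), (a,c+1), (a,c-1)}"
  by (simp add: mids_def face_mids_def)

lemma corners_connected:
  assumes "x \<in> VH {c}" "y \<in> VH {c}"
  shows "(hstep (mids {c}))\<^sup>*\<^sup>* x y"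
proof -
  obtain p q where c: "c = (p,q)" by force
  let ?R = "(hstep (mids {c}))\<^sup>*\<^sup>*"
  have s: "hstep (mids {c}) (p+1,q+1) (p+1,q-1)" "hstep (mids {c}) (p+1,q+1) (p-1,q+1)"
    "hstep (mids {c}) (p+1,q-1) (p-1,q-1)"
    unfolding hstep_def c mids_single
    by (rule bexI[of _ "(p+1,q)"], simp add: E1adj_def opp_def, simp,
        rule bexI[of _ "(p,q+1)"], simp add: E1adj_def opp_def, simp,
        rule bexI[of _ "(p,q-1)"], simp add: E1adj_def opp_def, simp)
  have "?R (p+1,q+1) z" if "z \<in> VH {c}" for z
    using that s unfolding c VH_single
    by (elim insertE emptyE) (auto intro: rtranclp.rtrancl_into_rtrancl)
  then show ?thesis using assms hstep_rtranclp_sym by (meson rtranclp_trans)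
qed

lemma VH_insert: "VH (insert c F) = VH {c} \<union> VH F" and mids_insert: "mids (insert c F) = mids {c} \<union> mids F"
  by (auto simp: VH_def mids_def)

lemma VH_mono: "F \<subseteq> F' \<Longrightarrow> VH F \<subseteq> VH F'" and mids_mono: "F \<subseteq> F' \<Longrightarrow> mids F \<subseteq> mids F'"
  by (auto simp: VH_def mids_def)

text \<open>A criterion on faces instead of vertices. Its hypothesis is supplied by topological
  connectedness for \<open>F\<close>, and by minimality of the bounding cycle for a disc inside
  \<open>F\<close>.\<close>

lemma hconn_if:
  assumes "\<And>A. A \<subseteq> F \<Longrightarrow> A \<noteq> {} \<Longrightarrow>
    (\<And>c c'. c \<in> A \<Longrightarrow> c' \<in> F \<Longrightarrow> VH {c} \<inter> VH {c'} \<noteq> {} \<Longrightarrow> c' \<in> A) \<Longrightarrow> A = F"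
  shows "hconn F"
  unfolding hconn_def
proof (intro ballI)
  fix x y assume x: "x \<in> VH F" and y: "y \<in> VH F"
  let ?R = "(hstep (mids F))\<^sup>*\<^sup>*"
  have cc: "?R z w" if "c \<in> F" "z \<in> VH {c}" "w \<in> VH {c}" for c z w
    using hstep_rtranclp_mono[OF mids_mono[of "{c}" F] corners_connected[OF that(2,3)]] that(1) by simp
  define A where "A = {c \<in> F. \<exists>z\<in>VH {c}. ?R x z}"
  have "A = F"
  proof (rule assms)
    show "A \<subseteq> F" by (auto simp: A_def)
    obtain c where "c \<in> F" "x \<in> VH {c}" using x by (auto simp: VH_def)
    then show "A \<noteq> {}" unfolding A_def by blast
    fix c c' assume c: "c \<in> A" "c' \<in> F" "VH {c} \<inter> VH {c'} \<noteq> {}"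
    then obtain z w where "c \<in> F" "z \<in> VH {c}" "?R x z" "w \<in> VH {c}" "w \<in> VH {c'}" unfolding A_def by blast
    then have "?R x w" using cc by (meson rtranclp_trans)
    then show "c' \<in> A" unfolding A_def using c(2) \<open>w \<in> VH {c'}\<close> by blast
  qed
  moreover obtain c where c: "c \<in> F" "y \<in> VH {c}" using y by (auto simp: VH_def)
  ultimately obtain z where "z \<in> VH {c}" "?R x z" unfolding A_def by blast
  then show "?R x y" using cc c by (meson rtranclp_trans)
qed

lemma face_region_iff:
  "p \<in> face_region c \<longleftrightarrow> \<bar>fst p - of_int (fst c)\<bar> \<le> 1 \<and> \<bar>snd p - of_int (snd c)\<bar> \<le> 1"
  by (cases p; cases c; simp add: face_region_def to_real_def cbox_Pair_eq abs_le_iff; linarith)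

text \<open>Coordinatewise: two odd integers within distance 1 of the same real number are equal or
  differ by 2, and so have a common even neighbour.\<close>

lemma regions_share_corner:
  assumes W: "c \<in> W1" "c' \<in> W1" and p: "p \<in> face_region c" "p \<in> face_region c'"
  shows "VH {c} \<inter> VH {c'} \<noteq> {}"
proof -
  have one: "\<exists>k. \<bar>k - i\<bar> = 1 \<and> \<bar>k - j\<bar> = 1"
    if "odd i" "odd j" "\<bar>t - of_int i\<bar> \<le> 1" "\<bar>t - of_int j\<bar> \<le> 1" for i j :: int and t :: real
  proof -
    have "\<bar>of_int (i - j)\<bar> \<le> (2::real)" using that by (simp add: abs_le_iff)
    then have "\<bar>i - j\<bar> \<le> 2" by linarith
    moreover have "even (i - j)" using that by simp
    ultimately have "i - j = 0 \<or> i - j = 2 \<or> i - j = -2" by presburger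
    then show ?thesis
    proof (elim disjE)
      assume "i - j = 0" then show ?thesis by (intro exI[of _ "i+1"]) simp
    next
      assume "i - j = 2" then show ?thesis by (intro exI[of _ "i-1"]) simp
    next
      assume "i - j = -2" then show ?thesis by (intro exI[of _ "i+1"]) simp
    qed
  qed
  have o: "odd (fst c)" "odd (snd c)" "odd (fst c')" "odd (snd c')" using W by (auto simp: W1_def)
  from p obtain k l where "\<bar>k - fst c\<bar> = 1" "\<bar>k - fst c'\<bar> = 1" "\<bar>l - snd c\<bar> = 1" "\<bar>l - snd c'\<bar> = 1"
    using one[OF o(1,3)] one[OF o(2,4)] unfolding face_region_iff by blast
  then have "(k,l) \<in> VH {c} \<inter> VH {c'}" by (simp add: VH_iff)
  then show ?thesis by blast
qed

text \<open>A proper nonempty set of faces closed under sharing corners would split the union into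
  two disjoint nonempty closed sets.\<close>

lemma hconn_if_connected:
  assumes fin: "finite F" and F: "F \<subseteq> W1" and conn: "connected (face_union F)"
  shows "hconn F"
proof (rule hconn_if, rule ccontr)
  fix A assume A: "A \<subseteq> F" "A \<noteq> {}"
    and cl: "\<And>c c'. c \<in> A \<Longrightarrow> c' \<in> F \<Longrightarrow> VH {c} \<inter> VH {c'} \<noteq> {} \<Longrightarrow> c' \<in> A" and ne: "A \<noteq> F"
  have clo: "closed (face_union B)" if "B \<subseteq> F" for B
    unfolding face_union_def face_region_def using that fin finite_subset by (intro closed_UN) auto
  have c: "closed (face_union A)" "closed (face_union (F - A))" using clo A(1) by auto
  have self: "to_real x \<in> face_region x" for x by (simp add: face_region_iff to_real_def)
  have "face_union F \<subseteq> face_union A \<union> face_union (F - A)" unfolding face_union_def by blast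
  moreover have "face_union A \<inter> face_union (F - A) \<inter> face_union F = {}"
  proof (rule ccontr)
    assume "\<not> ?thesis"
    then obtain p x y where "x \<in> A" "y \<in> F - A" "p \<in> face_region x" "p \<in> face_region y"
      unfolding face_union_def by blast
    then show False using cl[of x y] regions_share_corner[of x y p] A F by blast
  qed
  moreover have "face_union A \<inter> face_union F \<noteq> {}" "face_union (F - A) \<inter> face_union F \<noteq> {}"
    using A ne self unfolding face_union_def by blast+
  ultimately show False using conn c unfolding connected_closed by blast
qed

text \<open>The boundary of the square around \<open>f\<close> would be a loop in the union with winding number 1
  around \<open>f\<close>.\<close>
lemma not_all_neighbours:
  assumes sc: "simply_connected (face_union F)" and F: "F \<subseteq> W1" and f: "f \<in> W1" "f \<notin> F"
  shows "\<exists>b. E1adj f b \<and> opp b f \<notin> F"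
proof (rule ccontr)
  assume n: "\<not> ?thesis"
  obtain u v where uv: "f = (u,v)" by force
  have nb: "(u+2,v) \<in> F" "(u-2,v) \<in> F" "(u,v+2) \<in> F" "(u,v-2) \<in> F"
  proof -
    have "opp b f \<in> F" if "E1adj f b" for b using n that by blast
    from this[of "(u+1,v)"] this[of "(u-1,v)"] this[of "(u,v+1)"] this[of "(u,v-1)"]
    show "(u+2,v) \<in> F" "(u-2,v) \<in> F" "(u,v+2) \<in> F" "(u,v-2) \<in> F"
      by (simp_all add: uv E1adj_def opp_def)
  qed
  \<comment> \<open>Winding numbers live in the complex plane, so the union is carried there by the
    evident homeomorphism.\<close>
  define h :: "real \<times> real \<Rightarrow> complex" where "h p = Complex (fst p) (snd p)" for p
  define S where "S = h ` face_union F"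
  have "continuous_on UNIV h" unfolding h_def Complex_eq by (intro continuous_intros)
  moreover have "continuous_on UNIV (\<lambda>z. (Re z, Im z))" by (intro continuous_intros)
  ultimately have "homeomorphism (face_union F) S h (\<lambda>z. (Re z, Im z))"
    unfolding homeomorphism_def S_def
    by (auto simp: h_def image_image intro: continuous_on_subset)
  then have scS: "simply_connected S"
    using sc homeomorphic_simply_connected unfolding homeomorphic_def by blast
  define z where "z = Complex (of_int u) (of_int v)"
  let ?a = "Complex (of_int u - 1) (of_int v - 1)" and ?b = "Complex (of_int u + 1) (of_int v + 1)"
  let ?g = "rectpath ?a ?b"
  have mem: "w \<in> S" if "c \<in> F" "(Re w, Im w) \<in> face_region c" for w c
    using that unfolding S_def face_union_def by (intro image_eqI[of _ _ "(Re w, Im w)"]) (auto simp: h_def)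
  \<comment> \<open>All centres have odd coordinates, so a face region containing the centre
    \<open>f\<close> must be centred at \<open>f\<close>.\<close>
  have zS: "z \<notin> S"
  proof
    assume "z \<in> S"
    then obtain p where "p \<in> face_union F" "h p = z" unfolding S_def by blast
    moreover then have "p = (of_int u, of_int v)" by (simp add: h_def z_def complex_eq_iff prod_eq_iff)
    ultimately have "(of_int u, of_int v) \<in> face_union F" by simp
    then obtain c where c: "c \<in> F" "(of_int u, of_int v) \<in> face_region c" unfolding face_union_def by blast
    then have "\<bar>of_int (u - fst c)\<bar> \<le> (1::real)" "\<bar>of_int (v - snd c)\<bar> \<le> (1::real)"
      unfolding face_region_iff by simp_all
    then have "\<bar>u - fst c\<bar> \<le> 1" "\<bar>v - snd c\<bar> \<le> 1" by linarith+
    moreover have "odd (fst c)" "odd (snd c)" "odd u" "odd v" using c F f uv by (auto simp: W1_def)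
    ultimately have "u = fst c" "v = snd c" by presburger+
    then show False using c f uv by simp
  qed
  have g: "path_image ?g \<subseteq> S"
  proof
    fix w assume "w \<in> path_image ?g"
    then consider "Re w = of_int u - 1" "\<bar>Im w - of_int v\<bar> \<le> 1" | "Re w = of_int u + 1" "\<bar>Im w - of_int v\<bar> \<le> 1"
      | "Im w = of_int v - 1" "\<bar>Re w - of_int u\<bar> \<le> 1" | "Im w = of_int v + 1" "\<bar>Re w - of_int u\<bar> \<le> 1"
      by (auto simp: path_image_rectpath abs_le_iff)
    then show "w \<in> S"
    proof cases
      case 1 then show ?thesis using mem[OF nb(2), of w] by (simp add: face_region_iff)
    next
      case 2 then show ?thesis using mem[OF nb(1), of w] by (simp add: face_region_iff)
    next
      case 3 then show ?thesis using mem[OF nb(4), of w] by (simp add: face_region_iff)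
    next
      case 4 then show ?thesis using mem[OF nb(3), of w] by (simp add: face_region_iff)
    qed
  qed
  have aS: "?a \<in> S" using g by (auto simp: path_image_rectpath)
  have "homotopic_loops S ?g (linepath ?a ?a)"
    using scS g aS unfolding simply_connected_def by simp
  then have "homotopic_loops (- {z}) ?g (linepath ?a ?a)"
    using zS homotopic_loops_subset by blast
  then have "winding_number ?g z = winding_number (linepath ?a ?a) z"
    by (rule winding_number_homotopic_loops)
  moreover have "winding_number ?g z = 1"
    by (rule winding_number_rectpath) (simp add: in_box_complex_iff z_def)
  moreover have "z \<noteq> ?a" by (simp add: z_def)
  ultimately show False by simp
qed

text \<open>Normality joins a point of a hole \<open>K\<close> to a far point of \<open>W1\<close>
  by a walk in \<open>\<Gamma>\<close> outside \<open>G\<close>. Along the walk every square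
  containing the current point, except possibly that of \<open>f\<close>, stays centred in
  \<open>K\<close>. The exception is needed because sides and corners of the square around
  \<open>f\<close> need not belong to \<open>G\<close>, so the walk may run along them.\<close>

lemma no_holes_insert:
  assumes normal: "normal_set (VG F f)" and finF: "finite F" and F: "F \<subseteq> W1" and f: "f \<in> W1"
  shows "no_holes (insert f F)"
  unfolding no_holes_def
proof (intro allI impI, rule ccontr)
  fix K assume finK: "finite K" and K: "K \<subseteq> W1 - insert f F"
    and cl: "\<forall>c\<in>K. \<forall>b. E1adj c b \<longrightarrow> opp b c \<notin> insert f F \<longrightarrow> opp b c \<in> K" and ne: "K \<noteq> {}"
  let ?R = "insert f F"
  define touch where "touch x c \<longleftrightarrow> c \<in> W1 \<and> \<bar>fst x - fst c\<bar> \<le> 1 \<and> \<bar>snd x - snd c\<bar> \<le> 1" for x c :: pt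
  have W1notin: "x \<notin> VG F f" if "x \<in> W1" "x \<notin> ?R" for x
    using that subsetD[OF VH_subset[OF F], of x] mids_black[OF F, of x] unfolding VG_def black_def
    by (auto simp: W0_def W1_def white_def)
  \<comment> \<open>All nine integer points in the square of a face of \<open>F\<close> belong to
    \<open>G\<close>: its centre, side midpoints and corners.\<close>
  have tF: "c \<notin> F" if "x \<notin> VG F f" "touch x c" for x c
  proof
    assume c: "c \<in> F"
    then have "odd (fst c)" "odd (snd c)" using F by (auto simp: W1_def)
    have d: "\<bar>fst x - fst c\<bar> = 0 \<or> \<bar>fst x - fst c\<bar> = 1" "\<bar>snd x - snd c\<bar> = 0 \<or> \<bar>snd x - snd c\<bar> = 1"
      using that(2) unfolding touch_def by linarith+
    then have "x = c \<or> E1adj c x \<or> \<bar>fst x - fst c\<bar> = 1 \<and> \<bar>snd x - snd c\<bar> = 1"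
      unfolding E1adj_def prod_eq_iff by arith
    then have "x \<in> VG F f" using c unfolding VG_def Un_iff VH_iff mids_iff by blast
    then show False using that(1) by simp
  qed
  have side: "c' \<in> K" if "c \<in> K" "c' \<notin> ?R" and l: "lperp_adj c c'" for c c'
  proof -
    let ?b = "((fst c + fst c') div 2, (snd c + snd c') div 2)"
    have "opp ?b c = c' \<and> E1adj c ?b"
    proof -
      consider "fst c' = fst c + 2" "snd c' = snd c" | "fst c' = fst c - 2" "snd c' = snd c"
        | "fst c' = fst c" "snd c' = snd c + 2" | "fst c' = fst c" "snd c' = snd c - 2"
      proof -
        have "fst c' = fst c + 2 \<and> snd c' = snd c \<or> fst c' = fst c - 2 \<and> snd c' = snd c
          \<or> fst c' = fst c \<and> snd c' = snd c + 2 \<or> fst c' = fst c \<and> snd c' = snd c - 2"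
          using l unfolding lperp_adj_def by arith
        then show ?thesis using that by blast
      qed
      then show ?thesis by cases (simp_all add: opp_def E1adj_def prod_eq_iff)
    qed
    then show ?thesis using cl that by metis
  qed
  have spread: "c' \<in> K" if x: "x \<notin> VG F f" and t: "touch x c" "touch x c'" and c: "c \<in> K" "c' \<noteq> f" for x c c'
  proof -
    have c'R: "c' \<notin> ?R" using tF[OF x t(2)] c(2) by simp
    have W: "c \<in> W1" "c' \<in> W1" using t by (auto simp: touch_def)
    then have o: "odd (fst c)" "odd (snd c)" "odd (fst c')" "odd (snd c')" by (auto simp: W1_def)
    have "\<bar>fst c - fst c'\<bar> \<le> 2" "\<bar>snd c - snd c'\<bar> \<le> 2" using t unfolding touch_def by linarith+
    then have d: "fst c = fst c' \<or> \<bar>fst c - fst c'\<bar> = 2" "snd c = snd c' \<or> \<bar>snd c - snd c'\<bar> = 2"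
      using o by presburger+
    show ?thesis
    proof (cases "fst c = fst c' \<or> snd c = snd c'")
      case True
      then have "c = c' \<or> lperp_adj c c'" using d unfolding lperp_adj_def prod_eq_iff by auto
      then show ?thesis using side c c'R by blast
    next
      case False
      then have d2: "\<bar>fst c - fst c'\<bar> = 2" "\<bar>snd c - snd c'\<bar> = 2" using d by auto
      \<comment> \<open>Of the two points that complete a diagonal pair to a square at most one is
        \<open>f\<close>; the detour goes through the other.\<close>
      obtain m where m: "m = (fst c, snd c') \<or> m = (fst c', snd c)" "m \<noteq> f"
        using False by (metis fst_conv)
      have "touch x m" using m(1) t W unfolding touch_def by (auto simp: W1_def)
      then have mR: "m \<notin> ?R" using tF[OF x] m(2) by blast
      have "lperp_adj c m" "lperp_adj m c'" using m(1) d2 unfolding lperp_adj_def by auto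
      then show ?thesis using side[OF c(1) mR] side[OF _ c'R] by blast
    qed
  qed
  define Inv where "Inv x \<longleftrightarrow> (\<forall>c. touch x c \<longrightarrow> c \<noteq> f \<longrightarrow> c \<in> K)" for x
  have step: "Inv y" if I: "Inv x" and x: "x \<notin> VG F f" and y: "y \<notin> VG F f" and a: "gamma_adj x y" for x y
  proof -
    have d: "\<bar>fst x - fst y\<bar> \<le> 1" "\<bar>snd x - snd y\<bar> \<le> 1"
      using a unfolding gamma_adj_def E1adj_def E2adj_def by linarith+
    have nf: "z \<noteq> f" if "z \<notin> VG F f" for z using that unfolding VG_def by auto
    \<comment> \<open>An edge with an end in \<open>W1\<close> lies in the square of that end. Any
      other edge joins a midpoint to a corner and lies in two squares, not both centred at
      \<open>f\<close>.\<close>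
    have "\<exists>c. touch x c \<and> touch y c \<and> c \<noteq> f"
    proof (cases "x \<in> W1 \<or> y \<in> W1")
      case True
      then show ?thesis
      proof
        assume "x \<in> W1" then show ?thesis using d nf[OF x] unfolding touch_def
          by (intro exI[of _ x]) (auto simp: abs_minus_commute)
      next
        assume "y \<in> W1" then show ?thesis using d nf[OF y] unfolding touch_def
          by (intro exI[of _ y]) (auto simp: abs_minus_commute)
      qed
    next
      case False
      have "E1adj x y"
      proof (rule ccontr)
        assume "\<not> E1adj x y"
        then have e: "E2adj x y" using a unfolding gamma_adj_def by blast
        then have "even (fst x)" "even (fst y)" "\<bar>fst x - fst y\<bar> = 1"
          using False unfolding E2adj_def white_def W1_def by auto
        then show False by presburger
      qed
      obtain b u where bu: "{x,y} = {b,u}" "black b" "u \<in> W0" "E1adj u b"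
      proof (cases "black x")
        case True
        then have "white y" using E1adj_white_black[of y x] \<open>E1adj x y\<close> E1adj_sym by blast
        then have "y \<in> W0" using False unfolding white_def W0_def W1_def by auto
        then show ?thesis using that[of x y] True \<open>E1adj x y\<close> E1adj_sym by blast
      next
        case nb: False
        then have "black y" "white x" using E1adj_white_black[OF \<open>E1adj x y\<close>] by (auto simp: black_def)
        then have "x \<in> W0" using False unfolding white_def W0_def W1_def by auto
        then show ?thesis using that[of y x] \<open>black y\<close> \<open>E1adj x y\<close> by blast
      qed
      obtain c where c: "c \<in> W1" "E1adj c b" using black_nbr_ex[OF bu(2)] W1_lat by metis
      define c2 where "c2 = opp b c"
      have c2: "c2 \<in> W1" "E1adj c2 b" "c2 \<noteq> c" unfolding c2_def using c opp_in_W1 opp_neq by auto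
      have t: "touch b e \<and> touch u e" if e: "e \<in> W1" "E1adj e b" for e
        using corner_of_mid[OF e(1) bu(3) e(2) bu(4)] e unfolding touch_def E1adj_def
        by (simp add: abs_minus_commute; linarith)
      obtain e where "e \<in> W1" "E1adj e b" "e \<noteq> f" using c c2 by metis
      then have "touch b e \<and> touch u e \<and> e \<noteq> f" using t by blast
      then show ?thesis using bu(1) by (metis doubleton_eq_iff)
    qed
    then obtain c where c: "touch x c" "touch y c" "c \<noteq> f" by blast
    then have "c \<in> K" using I unfolding Inv_def by blast
    then show "Inv y" unfolding Inv_def using spread[OF y c(2)] by blast
  qed
  obtain p where p: "p \<in> K" using ne by blast
  then have pn: "p \<notin> VG F f" using W1notin K by blast
  have tself: "touch x c \<longleftrightarrow> c = x" if "x \<in> W1" for x c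
  proof
    assume "touch x c"
    then have "\<bar>fst x - fst c\<bar> \<le> 1" "\<bar>snd x - snd c\<bar> \<le> 1" "odd (fst c)" "odd (snd c)" "odd (fst x)" "odd (snd x)"
      using that by (auto simp: touch_def W1_def)
    then have "fst x = fst c" "snd x = snd c" by presburger+
    then show "c = x" by (simp add: prod_eq_iff)
  qed (use that in \<open>auto simp: touch_def\<close>)
  have Ip: "Inv p" unfolding Inv_def
  proof (intro allI impI)
    fix c assume "touch p c"
    moreover have "p \<in> W1" using p K by blast
    ultimately have "c = p" using tself by blast
    then show "c \<in> K" using p by simp
  qed
  have "infinite W1"
  proof
    assume "finite W1"
    then have "finite (range (\<lambda>n::nat. (2 * int n + 1, 1::int)))"
      by (rule finite_subset[rotated]) (auto simp: W1_def)
    moreover have "inj (\<lambda>n::nat. (2 * int n + 1, 1::int))" by (auto simp: inj_def)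
    ultimately show False using finite_imageD by blast
  qed
  moreover have "finite (K \<union> ?R)" using finK finF by simp
  ultimately obtain q where q: "q \<in> W1" "q \<notin> K" "q \<notin> ?R"
    by (meson Diff_infinite_finite UnI1 UnI2 finite_subset subsetI)
  then have qn: "q \<notin> VG F f" using W1notin by blast
  have "(\<lambda>x y. x \<in> UNIV - VG F f \<and> y \<in> UNIV - VG F f \<and> gamma_adj x y)\<^sup>*\<^sup>* p q"
    using normal pn qn unfolding normal_set_def induced_connected_def by blast
  then have "Inv q" by (induction rule: rtranclp_induct) (use Ip step in blast)+
  moreover have "touch q q" using tself[OF q(1)] by simp
  ultimately have "q \<in> K" unfolding Inv_def using q(3) by blast
  then show False using q by blast
qed

text \<open>A hole of \<open>F\<close> with \<open>f\<close> removed is closed in the complement of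
  \<open>insert f F\<close>, hence empty. So the hole could only be \<open>{f}\<close>, but
  \<open>f\<close> has a neighbour outside \<open>F\<close>, which would belong to it too.\<close>

lemma no_holes_if_insert:
  assumes nh: "no_holes (insert f F)" and f: "\<exists>b. E1adj f b \<and> opp b f \<notin> F"
  shows "no_holes F"
  unfolding no_holes_def
proof (intro allI impI)
  fix K assume K: "finite K" "K \<subseteq> W1 - F" "\<forall>c\<in>K. \<forall>b. E1adj c b \<longrightarrow> opp b c \<notin> F \<longrightarrow> opp b c \<in> K"
  have "K - {f} = {}"
    by (rule nh[unfolded no_holes_def, rule_format]) (use K in blast)+
  moreover have "f \<notin> K"
  proof
    assume fK: "f \<in> K"
    obtain b where b: "E1adj f b" "opp b f \<notin> F" using f by blast
    then have "opp b f \<in> K" using K(3) fK by blast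
    then show False using \<open>K - {f} = {}\<close> opp_neq[OF b(1)] by blast
  qed
  ultimately show "K = {}" by blast
qed

section \<open>Attaching the square around \<open>f\<close>\<close>

lemma hconn_insert:
  assumes conn: "hconn F" and v: "v \<in> VH F" "v \<in> VH {f}"
  shows "hconn (insert f F)"
  unfolding hconn_def
proof (intro ballI)
  let ?R = "(hstep (mids (insert f F)))\<^sup>*\<^sup>*"
  have vr: "?R v x" if "x \<in> VH (insert f F)" for x
  proof (cases "x \<in> VH F")
    case True
    then show ?thesis using conn v hstep_rtranclp_mono[OF mids_mono[of F "insert f F"]] unfolding hconn_def by blast
  next
    case False
    then have "x \<in> VH {f}" using that VH_insert by blast
    then show ?thesis using hstep_rtranclp_mono[OF mids_mono[of "{f}" "insert f F"]] corners_connected v(2) by blast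
  qed
  fix x y assume "x \<in> VH (insert f F)" "y \<in> VH (insert f F)"
  then show "?R x y" using vr hstep_rtranclp_sym by (meson rtranclp_trans)
qed

text \<open>\<open>b1\<close> to \<open>b4\<close> are the edges of a four-cycle on
  \<open>v1\<close> to \<open>v4\<close>. A subgraph with one more vertex than edges is neither the
  full cycle nor disconnected, so a value constant along its edges is constant on its
  vertices.\<close>

lemma path_of_corners:
  fixes b1 b2 b3 b4 v1 v2 v3 v4 k1 k2 k3 k4 :: bool
  assumes b: "b1 \<longrightarrow> v1 \<and> v2" "b2 \<longrightarrow> v2 \<and> v3" "b3 \<longrightarrow> v3 \<and> v4" "b4 \<longrightarrow> v4 \<and> v1"
    and k: "b1 \<longrightarrow> k1 = k2" "b2 \<longrightarrow> k2 = k3" "b3 \<longrightarrow> k3 = k4" "b4 \<longrightarrow> k4 = k1"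
    and c: "of_bool v1 + of_bool v2 + of_bool v3 + of_bool v4
      = Suc (of_bool b1 + of_bool b2 + of_bool b3 + of_bool b4)"
  shows "(v1 \<and> v2 \<longrightarrow> k1 = k2) \<and> (v1 \<and> v3 \<longrightarrow> k1 = k3) \<and> (v1 \<and> v4 \<longrightarrow> k1 = k4)
    \<and> (v2 \<and> v3 \<longrightarrow> k2 = k3) \<and> (v2 \<and> v4 \<longrightarrow> k2 = k4) \<and> (v3 \<and> v4 \<longrightarrow> k3 = k4)"
proof -
  have "(v1 \<and> v2 \<longrightarrow> b1 \<or> b2 \<and> b3 \<and> b4) \<and> (v2 \<and> v3 \<longrightarrow> b2 \<or> b1 \<and> b3 \<and> b4)
    \<and> (v3 \<and> v4 \<longrightarrow> b3 \<or> b1 \<and> b2 \<and> b4) \<and> (v1 \<and> v4 \<longrightarrow> b4 \<or> b1 \<and> b2 \<and> b3)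
    \<and> (v1 \<and> v3 \<longrightarrow> b1 \<and> b2 \<or> b3 \<and> b4) \<and> (v2 \<and> v4 \<longrightarrow> b2 \<and> b3 \<or> b4 \<and> b1)"
    using b c by (cases v1; cases v2; cases v3; cases v4; cases b1; cases b2; cases b3; cases b4; simp)
  with k show ?thesis by argo
qed

lemma card_four_Un:
  assumes "finite A" "distinct [a,b,c,d]"
  shows "card ({a,b,c,d} \<union> A) = card A + of_bool (a \<notin> A) + of_bool (b \<notin> A) + of_bool (c \<notin> A) + of_bool (d \<notin> A)"
  using assms by (simp add: card_insert_if)

text \<open>Comparing Euler's formula for \<open>F\<close> and for \<open>F\<close> with the face \<open>f\<close> added shows that the corners
  and sides of \<open>f\<close> lying in \<open>H\<close> form a graph with one more vertex than edges, hence a path.\<close>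
lemma corners_linked:
  assumes fin: "finite F" "F \<subseteq> W1" "F \<noteq> {}" and f: "f \<in> W1" "f \<notin> F"
    and hc: "hconn F" "hconn (insert f F)" and nh: "no_holes F" "no_holes (insert f F)"
    and K: "K x" "x \<in> VH F" "x \<in> VH {f}" and y: "y \<in> VH F" "y \<in> VH {f}"
    and step: "\<And>b z. K z \<Longrightarrow> b \<in> mids F \<Longrightarrow> E1adj f b \<Longrightarrow> E1adj z b \<Longrightarrow> z \<in> W0 \<Longrightarrow> K (opp b z)"
  shows "K y"
proof -
  obtain u v where uv: "f = (u,v)" by force
  have odd: "odd u" "odd v" using f uv by (auto simp: W1_def)
  have fW: "insert f F \<subseteq> W1" using fin f by auto
  have e1: "card F + card (VH F) = card (mids F) + 1" using euler fin hc nh by blast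
  have e2: "card F + 1 + card (VH (insert f F)) = card (mids (insert f F)) + 1"
    using euler[of "insert f F"] fin f fW hc nh by simp
  have fV: "finite (VH F)" "finite (mids F)" using fin finite_VH finite_mids by auto
  let ?x1 = "(u+1,v+1)" and ?x2 = "(u+1,v-1)" and ?x3 = "(u-1,v-1)" and ?x4 = "(u-1,v+1)"
  let ?b1 = "(u+1,v)" and ?b2 = "(u,v-1)" and ?b3 = "(u-1,v)" and ?b4 = "(u,v+1)"
  have cV: "card (VH (insert f F)) = card (VH F) + of_bool (?x1 \<notin> VH F) + of_bool (?x2 \<notin> VH F)
      + of_bool (?x4 \<notin> VH F) + of_bool (?x3 \<notin> VH F)"
    by (subst VH_insert, unfold uv VH_single, rule card_four_Un[OF fV(1)]) simp
  have cM: "card (mids (insert f F)) = card (mids F) + of_bool (?b1 \<notin> mids F) + of_bool (?b3 \<notin> mids F)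
      + of_bool (?b4 \<notin> mids F) + of_bool (?b2 \<notin> mids F)"
    by (subst mids_insert, unfold uv mids_single, rule card_four_Un[OF fV(2)]) simp
  have W: "?x1 \<in> W0" "?x2 \<in> W0" "?x3 \<in> W0" "?x4 \<in> W0" using odd by (auto simp: W0_def)
  have V: "?b1 \<in> mids F \<Longrightarrow> ?x1 \<in> VH F \<and> ?x2 \<in> VH F" "?b2 \<in> mids F \<Longrightarrow> ?x2 \<in> VH F \<and> ?x3 \<in> VH F"
    "?b3 \<in> mids F \<Longrightarrow> ?x3 \<in> VH F \<and> ?x4 \<in> VH F" "?b4 \<in> mids F \<Longrightarrow> ?x4 \<in> VH F \<and> ?x1 \<in> VH F"
    using VH_if_mid[OF fin(2)] W by (auto simp: E1adj_def)
  have s: "?b1 \<in> mids F \<Longrightarrow> K ?x1 = K ?x2" "?b2 \<in> mids F \<Longrightarrow> K ?x2 = K ?x3"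
    "?b3 \<in> mids F \<Longrightarrow> K ?x3 = K ?x4" "?b4 \<in> mids F \<Longrightarrow> K ?x4 = K ?x1"
  proof -
    have two: "K z = K (opp b z)" if "b \<in> mids F" "E1adj f b" "E1adj z b" "z \<in> W0" for b z
      using step[of z b] step[of "opp b z" b] that opp_in_W0[of z b] by auto
    show "?b1 \<in> mids F \<Longrightarrow> K ?x1 = K ?x2" "?b2 \<in> mids F \<Longrightarrow> K ?x2 = K ?x3"
      "?b3 \<in> mids F \<Longrightarrow> K ?x3 = K ?x4" "?b4 \<in> mids F \<Longrightarrow> K ?x4 = K ?x1"
      using two[of ?b1 ?x1] two[of ?b2 ?x2] two[of ?b3 ?x3] two[of ?b4 ?x4] W
      by (simp_all add: uv E1adj_def opp_def)
  qed
  \<comment> \<open>Subtracting the two Euler formulas shows that \<open>f\<close> adds one more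
    side than corners. Out of four of each, the corners already in \<open>H\<close> therefore
    outnumber the sides already in \<open>H\<close> by one.\<close>
  have c: "of_bool (?x1 \<in> VH F) + of_bool (?x2 \<in> VH F) + of_bool (?x3 \<in> VH F) + of_bool (?x4 \<in> VH F)
    = Suc (of_bool (?b1 \<in> mids F) + of_bool (?b2 \<in> mids F) + of_bool (?b3 \<in> mids F) + of_bool (?b4 \<in> mids F))"
  proof -
    have n: "of_bool (\<not> p) + of_bool p = (1::nat)" for p by simp
    have lin: "p1 + p2 + p3 + p4 = Suc (q1 + q2 + q3 + q4)"
      if "A + B = E + 1" "A + 1 + (B + r1 + r2 + r4 + r3) = E + s1 + s3 + s4 + s2 + 1"
        "r1 + p1 = 1" "r2 + p2 = 1" "r3 + p3 = 1" "r4 + p4 = 1"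
        "s1 + q1 = 1" "s2 + q2 = 1" "s3 + q3 = 1" "s4 + q4 = 1"
      for A B E p1 p2 p3 p4 q1 q2 q3 q4 r1 r2 r3 r4 s1 s2 s3 s4 :: nat
      using that by linarith
    show ?thesis
      by (rule lin[OF e1 e2[unfolded cV cM] n n n n n n n n])
  qed
  have mem: "x = ?x1 \<or> x = ?x2 \<or> x = ?x3 \<or> x = ?x4" "y = ?x1 \<or> y = ?x2 \<or> y = ?x3 \<or> y = ?x4"
    using K(3) y(2) unfolding uv VH_single by auto
  have "(?x1 \<in> VH F \<and> ?x2 \<in> VH F \<longrightarrow> K ?x1 = K ?x2) \<and> (?x1 \<in> VH F \<and> ?x3 \<in> VH F \<longrightarrow> K ?x1 = K ?x3)
    \<and> (?x1 \<in> VH F \<and> ?x4 \<in> VH F \<longrightarrow> K ?x1 = K ?x4) \<and> (?x2 \<in> VH F \<and> ?x3 \<in> VH F \<longrightarrow> K ?x2 = K ?x3)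
    \<and> (?x2 \<in> VH F \<and> ?x4 \<in> VH F \<longrightarrow> K ?x2 = K ?x4) \<and> (?x3 \<in> VH F \<and> ?x4 \<in> VH F \<longrightarrow> K ?x3 = K ?x4)"
    by (rule path_of_corners[of "?b1 \<in> mids F" _ _ "?b2 \<in> mids F" _ "?b3 \<in> mids F" _ "?b4 \<in> mids F"]) (use V s c in blast)+
  then show ?thesis using mem K y by blast
qed

section \<open>Dimer coverings and impurities\<close>

lemma gamma_adj_sym: "gamma_adj v w \<longleftrightarrow> gamma_adj w v"
  using E1adj_sym E2adj_sym unfolding gamma_adj_def by blast

lemma W0_white: "x \<in> W0 \<Longrightarrow> white x" and W1_white: "c \<in> W1 \<Longrightarrow> white c"
  unfolding W0_lat W1_lat lat_def by blast+

lemma W0_W1_disjoint: "x \<in> W0 \<Longrightarrow> x \<in> W1 \<Longrightarrow> False"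
  by (auto simp: W0_def W1_def)

lemma white_cases: "white x \<Longrightarrow> x \<in> W0 \<or> x \<in> W1"
  by (auto simp: W0_def W1_def white_def)

lemma gamma_adj_black: "gamma_adj x b \<Longrightarrow> black b \<Longrightarrow> E1adj x b"
  unfolding gamma_adj_def E2adj_def black_def by blast

lemma gamma_adj_white: "gamma_adj x y \<Longrightarrow> white x \<Longrightarrow> white y \<Longrightarrow> E2adj x y"
  using E1adj_white_black unfolding gamma_adj_def black_def by blast

lemma E2adj_W0: "E2adj x c \<Longrightarrow> x \<in> W0 \<longleftrightarrow> c \<in> W1" and E2adj_W1: "E2adj x c \<Longrightarrow> x \<in> W1 \<longleftrightarrow> c \<in> W0"
  unfolding E2adj_def W0_def W1_def white_def by (simp; presburger)+

lemma E2adj_irrefl: "\<not> E2adj x x"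
  by (simp add: E2adj_def)

lemma even_at_two:
  assumes "even_at Z x" "b \<in> Z" "E1adj x b"
  obtains b' where "b' \<in> Z" "E1adj x b'" "b' \<noteq> b"
proof (rule ccontr)
  assume "\<not> thesis"
  then have "{b' \<in> Z. E1adj x b'} = {b}" using assms that by blast
  then have "card {b' \<in> Z. E1adj x b'} = 1" by (simp only: is_singletonI is_singleton_altdef[symmetric])
  then show False using assms(1) unfolding even_at_def by simp
qed

text \<open>\<open>c\<close> may lie in either lattice: the corners are the vertices of a face or
  the four faces around a vertex. In both cases the proof walks around the square.\<close>

lemma corners_invariant:
  assumes "x \<in> VH {c}" "y \<in> VH {c}" "P x"
    and step: "\<And>b z. E1adj c b \<Longrightarrow> z \<in> VH {c} \<Longrightarrow> E1adj z b \<Longrightarrow> P z \<Longrightarrow> P (opp b z)"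
  shows "P y"
proof -
  have "P y \<and> y \<in> VH {c}" using corners_connected[OF assms(1,2)]
  proof (induction rule: rtranclp_induct)
    case base
    then show ?case using assms by blast
  next
    case (step z w)
    then obtain b where b: "E1adj c b" "E1adj z b" "w = opp b z"
      unfolding hstep_def Bex_def mids_iff by blast
    have "w \<in> VH {c}"
    proof -
      obtain p q where c: "c = (p,q)" by force
      have "z \<in> VH {(p,q)}" using step c by blast
      with b(1,2) have "opp b z \<in> VH {(p,q)}" unfolding c VH_single E1adj_iff
        by (elim insertE emptyE; simp add: opp_def prod_eq_iff)
      then show ?thesis unfolding b(3) c .
    qed
    then show ?case using assms(4)[OF b(1) _ b(2)] step b(3) by blast
  qed
  then show ?thesis by blast
qed

lemma VH_single_iff: "x \<in> VH {c} \<longleftrightarrow> \<bar>fst x - fst c\<bar> = 1 \<and> \<bar>snd x - snd c\<bar> = 1"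
  by (simp add: VH_iff)

lemma VH_single_sym: "x \<in> VH {c} \<longleftrightarrow> c \<in> VH {x}"
  by (simp add: VH_single_iff abs_minus_commute)

lemma corner_mid: "c \<in> W1 \<Longrightarrow> x \<in> W0 \<Longrightarrow> E1adj c b \<Longrightarrow> E1adj x b \<Longrightarrow> x \<in> VH {c}"
  unfolding VH_single_iff by (rule corner_of_mid)

lemma E2adj_corner: "E2adj x c \<Longrightarrow> x \<in> VH {c}"
  by (simp add: VH_single_iff E2adj_def)

lemma corner_E2adj: "c \<in> W1 \<Longrightarrow> x \<in> W0 \<Longrightarrow> x \<in> VH {c} \<Longrightarrow> E2adj x c"
  by (simp add: VH_single_iff E2adj_def W0_white W1_white)

definition impurity :: "pt set set \<Rightarrow> pt \<Rightarrow> pt \<Rightarrow> bool" where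
  "impurity M x c \<longleftrightarrow> {x, c} \<in> M \<and> x \<in> W0 \<and> c \<in> W1"

text \<open>The edges of the tree attached to a covering, read off without reference to the position
  of the impurity, so that it can be followed along t-moves.\<close>

definition tree_mids :: "pt set \<Rightarrow> pt set set \<Rightarrow> pt set" where
  "tree_mids F M = {b \<in> mids F. \<exists>x\<in>W0. {x, b} \<in> M}"

text \<open>The combinatorial content of the topological hypotheses. Connectedness and absence of
  holes are recorded for \<open>F\<close> and for \<open>insert f F\<close>, so that Euler's formula
  applies to both.\<close>

locale temperley =
  fixes F :: "pt set" and f v :: pt
  assumes finF: "finite F" and FW1: "F \<subseteq> W1" and fW1: "f \<in> W1" and fF: "f \<notin> F"
    and vF: "v \<in> VH F" and vf: "v \<in> VH {f}"
    and conn: "hconn F" and nh: "no_holes F"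
    and conn_insert: "hconn (insert f F)" and nh_insert: "no_holes (insert f F)"
begin

abbreviation "R \<equiv> insert f F"
abbreviation "DC M \<equiv> dimer_covering (VG F f) M"

lemma F_ne: "F \<noteq> {}"
  using vF by (auto simp: VH_def)

lemma VH_W0: "x \<in> VH F \<Longrightarrow> x \<in> W0"
  using VH_subset[OF FW1] by blast

lemma R_W1: "c \<in> R \<Longrightarrow> c \<in> W1"
  using FW1 fW1 by blast

lemma E_black: "b \<in> mids F \<Longrightarrow> black b"
  using mids_black[OF FW1] by blast

lemma VG_iff: "x \<in> VG F f \<longleftrightarrow> x \<in> VH F \<or> x \<in> R \<or> x \<in> mids F"
  unfolding VG_def by blast

lemma VG_W0: "x \<in> VG F f \<Longrightarrow> x \<in> W0 \<Longrightarrow> x \<in> VH F"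
  using VG_iff R_W1 W0_W1_disjoint E_black W0_white unfolding black_def by blast

lemma VG_W1: "x \<in> VG F f \<Longrightarrow> x \<in> W1 \<Longrightarrow> x \<in> R"
  using VG_iff VH_W0 W0_W1_disjoint E_black W1_white unfolding black_def by blast

lemma VG_black: "x \<in> VG F f \<Longrightarrow> black x \<Longrightarrow> x \<in> mids F"
  using VG_iff VH_W0 R_W1 W0_white W1_white unfolding black_def by blast

section \<open>Partners in a covering and the unique impurity\<close>

lemma edge_props:
  assumes "DC M" "{x,y} \<in> M"
  shows "x \<in> VG F f" "y \<in> VG F f" "gamma_adj x y"
proof -
  have "{x,y} \<in> induced_edges (VG F f)" using assms unfolding dimer_covering_def by blast
  then obtain a b where "{x,y} = {a,b}" "a \<in> VG F f" "b \<in> VG F f" "gamma_adj a b"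
    unfolding induced_edges_def by blast
  then show "x \<in> VG F f" "y \<in> VG F f" "gamma_adj x y"
    using gamma_adj_sym by (metis doubleton_eq_iff)+
qed

lemma covering_unique:
  assumes "DC M" "{x,y} \<in> M" "{x,z} \<in> M"
  shows "y = z"
proof -
  have "{x,y} = {x,z}"
    using assms edge_props(1)[OF assms(1,2)] unfolding dimer_covering_def by blast
  then show ?thesis by (metis doubleton_eq_iff)
qed

lemma covering_unique':
  assumes "DC M" "{y,x} \<in> M" "{z,x} \<in> M"
  shows "y = z"
  using covering_unique[of M x y z] assms by (simp add: insert_commute)

lemma covering_ex:
  assumes "DC M" "x \<in> VG F f"
  obtains y where "{x,y} \<in> M"
proof -
  obtain e where e: "e \<in> M" "x \<in> e" using assms unfolding dimer_covering_def by blast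
  then obtain a b where "e = {a,b}" using assms(1) unfolding dimer_covering_def induced_edges_def by blast
  then have "e = {x, b} \<or> e = {x, a}" using e(2) by blast
  then show ?thesis using that e(1) by blast
qed

lemma white_count: "card (VH F \<union> R) = card (mids F) + 2"
proof -
  have "VH F \<inter> R = {}" using VH_W0 R_W1 W0_W1_disjoint by blast
  then have "card (VH F \<union> R) = card (VH F) + (card F + 1)"
    using finF fF finite_VH[OF finF] by (simp add: card_Un_disjoint)
  then show ?thesis using euler[OF finF FW1 F_ne conn nh] by simp
qed

lemma impurity_adj: "DC M \<Longrightarrow> impurity M x c \<Longrightarrow> E2adj x c \<and> x \<in> VH F \<and> c \<in> R"
  unfolding impurity_def using edge_props gamma_adj_white W0_white W1_white VG_W0 VG_W1 by meson

lemma ex1_impurity: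
  assumes M: "DC M"
  shows "\<exists>x c. impurity M x c \<and> (\<forall>x' c'. impurity M x' c' \<longrightarrow> x' = x \<and> c' = c)"
proof -
  let ?E = "mids F" and ?Wh = "VH F \<union> R"
  have wh: "white w" if "w \<in> ?Wh" for w using that VH_W0 R_W1 W0_white W1_white by blast
  have "\<forall>b\<in>?E. \<exists>w. {b,w} \<in> M" using covering_ex[OF M] VG_iff by metis
  then obtain q where q: "\<And>b. b \<in> ?E \<Longrightarrow> {b, q b} \<in> M" by metis
  have qw: "q b \<in> ?Wh" if b: "b \<in> ?E" for b
  proof -
    have "E1adj (q b) b" using edge_props(3)[OF M q[OF b]] gamma_adj_sym gamma_adj_black E_black[OF b] by blast
    then have "white (q b)" using E1adj_white_black E_black[OF b] by blast
    then show ?thesis using edge_props(2)[OF M q[OF b]] VG_iff E_black unfolding black_def by blast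
  qed
  have inj: "inj_on q ?E"
  proof (rule inj_onI)
    fix b b' assume "b \<in> ?E" "b' \<in> ?E" "q b = q b'"
    then show "b = b'" using covering_unique'[OF M, of b "q b" b'] q by metis
  qed
  \<comment> \<open>The white points not matched with a midpoint. There are two of them, and the
    partner of one is white and unmatched with a midpoint as well, so it is the other.\<close>
  define U where "U = ?Wh - q ` ?E"
  have fin: "finite ?Wh" using finF finite_VH by auto
  have cU: "card U = 2"
  proof -
    have "card U = card ?Wh - card (q ` ?E)"
      unfolding U_def
    proof (rule card_Diff_subset)
      show "finite (q ` ?E)" using finite_mids[OF finF] by (rule finite_imageI)
      show "q ` ?E \<subseteq> ?Wh" using qw by blast
    qed
    then show ?thesis using card_image[OF inj] white_count by simp
  qed
  have U: "w \<in> ?Wh \<Longrightarrow> w' \<in> ?Wh \<Longrightarrow> {w,w'} \<in> M \<Longrightarrow> w \<in> U" for w w'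
  proof (rule ccontr)
    assume w: "w \<in> ?Wh" "w' \<in> ?Wh" "{w,w'} \<in> M" "w \<notin> U"
    then obtain b where b: "b \<in> ?E" "w = q b" unfolding U_def by blast
    then have "{w,b} \<in> M" using q[OF b(1)] by (simp add: insert_commute)
    then have "w' = b" using covering_unique[OF M] w(3) by blast
    then show False using wh[OF w(2)] E_black[OF b(1)] unfolding black_def by blast
  qed
  have "U \<noteq> {}" using cU by auto
  then obtain w where w: "w \<in> U" by blast
  then have wW: "w \<in> ?Wh" by (simp add: U_def)
  then obtain w' where w': "{w,w'} \<in> M" using covering_ex[OF M] VG_iff by blast
  have "w' \<notin> ?E"
  proof
    assume b: "w' \<in> ?E"
    have "{w',w} \<in> M" using w' by (simp add: insert_commute)
    then have "w = q w'" using covering_unique[OF M] q[OF b] by blast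
    then show False using w b unfolding U_def by blast
  qed
  then have w'W: "w' \<in> ?Wh" using edge_props(2)[OF M w'] VG_iff by blast
  have w'U: "w' \<in> U" using U[OF w'W wW] w' by (simp add: insert_commute)
  have E2: "E2adj w w'" using gamma_adj_white edge_props(3)[OF M w'] wh wW w'W by blast
  then have "w \<noteq> w'" using E2adj_irrefl by blast
  then have Ueq: "U = {w,w'}"
    using w w'U cU fin unfolding U_def by (intro card_seteq[symmetric]) (auto simp: finite_subset)
  have sub: "impurity M x' c' \<Longrightarrow> x' \<in> {w,w'} \<and> c' \<in> {w,w'}" for x' c'
  proof -
    assume i: "impurity M x' c'"
    then have i': "x' \<in> ?Wh" "c' \<in> ?Wh" "{x',c'} \<in> M" "{c',x'} \<in> M"
      using impurity_adj[OF M i] unfolding impurity_def by (auto simp: insert_commute)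
    show ?thesis using U[OF i'(1,2,3)] U[OF i'(2,1,4)] Ueq by simp
  qed
  have "w \<in> W0 \<and> w' \<in> W1 \<or> w \<in> W1 \<and> w' \<in> W0"
    using wh[OF wW] white_cases E2adj_W0[OF E2] E2adj_W1[OF E2] by blast
  then show ?thesis
  proof
    assume "w \<in> W0 \<and> w' \<in> W1"
    then have "impurity M w w' \<and> (\<forall>x' c'. impurity M x' c' \<longrightarrow> x' = w \<and> c' = w')"
      using sub w' W0_W1_disjoint unfolding impurity_def by blast
    then show ?thesis by blast
  next
    assume "w \<in> W1 \<and> w' \<in> W0"
    moreover have "{w',w} \<in> M" using w' by (simp add: insert_commute)
    ultimately have "impurity M w' w \<and> (\<forall>x' c'. impurity M x' c' \<longrightarrow> x' = w' \<and> c' = w)"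
      using sub W0_W1_disjoint unfolding impurity_def by blast
    then show ?thesis by blast
  qed
qed

lemma impurity_unique: "DC M \<Longrightarrow> impurity M x c \<Longrightarrow> impurity M x' c' \<Longrightarrow> x' = x \<and> c' = c"
  using ex1_impurity by metis

lemma tree_edge:
  assumes M: "DC M" and b: "b \<in> tree_mids F M"
  obtains x where "x \<in> VH F" "E1adj x b" "{x,b} \<in> M"
proof -
  obtain x where x: "x \<in> W0" "{x,b} \<in> M" "b \<in> mids F" using b unfolding tree_mids_def by blast
  then have "E1adj x b" using edge_props[OF M x(2)] gamma_adj_black E_black by blast
  then show ?thesis using that VG_W0 edge_props[OF M x(2)] x by blast
qed

lemma cotree_edge:
  assumes M: "DC M" and b: "b \<in> mids F" "b \<notin> tree_mids F M"
  obtains c where "c \<in> R" "E1adj c b" "{c,b} \<in> M"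
proof -
  obtain c where "{b,c} \<in> M" using covering_ex[OF M] b(1) VG_iff by blast
  then have c: "{c,b} \<in> M" by (simp add: insert_commute)
  have a: "E1adj c b" using edge_props[OF M c] gamma_adj_black E_black b by blast
  then have "white c" using E1adj_white_black E_black[OF b(1)] by blast
  moreover have "c \<notin> W0" using b c unfolding tree_mids_def by blast
  ultimately have "c \<in> W1" using white_cases by blast
  then show ?thesis using that VG_W1 edge_props[OF M c] a c by blast
qed

lemma vertex_partner:
  assumes M: "DC M" and i: "impurity M x0 c0" and x: "x \<in> VH F" "x \<noteq> x0"
  obtains b where "b \<in> tree_mids F M" "E1adj x b" "{x,b} \<in> M"
proof -
  obtain b where b: "{x,b} \<in> M" using covering_ex[OF M] x(1) VG_iff by blast
  have xW: "x \<in> W0" using VH_W0 x(1) by blast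
  have "black b"
  proof (rule ccontr)
    assume "\<not> black b"
    then have w: "white b" by (simp add: black_def)
    then have "E2adj x b" using edge_props[OF M b] gamma_adj_white W0_white xW by blast
    then have "b \<in> W1" using E2adj_W0 xW by blast
    then have "impurity M x b" using b xW unfolding impurity_def by blast
    then show False using impurity_unique[OF M i] x(2) by blast
  qed
  then have "b \<in> mids F" "E1adj x b" using edge_props[OF M b] VG_black gamma_adj_black by blast+
  then show ?thesis using that b xW unfolding tree_mids_def by blast
qed

lemma face_partner:
  assumes M: "DC M" and i: "impurity M x0 c0" and c: "c \<in> R" "c \<noteq> c0"
  obtains b where "b \<in> mids F" "b \<notin> tree_mids F M" "E1adj c b" "{c,b} \<in> M"
proof -
  obtain b where b: "{c,b} \<in> M" using covering_ex[OF M] c(1) VG_iff by blast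
  have cW: "c \<in> W1" using R_W1 c(1) by blast
  have "black b"
  proof (rule ccontr)
    assume "\<not> black b"
    then have w: "white b" by (simp add: black_def)
    then have "E2adj c b" using edge_props[OF M b] gamma_adj_white W1_white cW by blast
    then have "b \<in> W0" using E2adj_W1 cW by blast
    then have "impurity M b c" using b cW unfolding impurity_def by (simp add: insert_commute)
    then show False using impurity_unique[OF M i] c(2) by blast
  qed
  then have E: "b \<in> mids F" "E1adj c b" using edge_props[OF M b] VG_black gamma_adj_black by blast+
  have "b \<notin> tree_mids F M"
  proof
    assume "b \<in> tree_mids F M"
    then obtain x where "x \<in> W0" "{x,b} \<in> M" unfolding tree_mids_def by blast
    then show False using covering_unique'[OF M b] cW W0_W1_disjoint by blast
  qed
  then show ?thesis using that b E by blast
qed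

text \<open>The move is undone by the same pattern with the roles of \<open>a\<close> and
  \<open>c\<close> exchanged. These two points are both diagonal neighbours of \<open>b\<close>,
  hence in the same sublattice, so the midpoint \<open>d\<close> does not change sides between tree
  and dual tree.\<close>

lemma tmove_dimer:
  assumes M: "DC M" and t: "tmove M M'"
  shows "DC M' \<and> tmove M' M \<and> tree_mids F M' = tree_mids F M"
proof -
  obtain a b c d where ab: "{a,b} \<in> M" and cd: "{c,d} \<in> M" and adj: "E2adj a b" "E2adj b c" "E1adj c d" "E1adj d a"
    and M': "M' = (M - {{a,b},{c,d}}) \<union> {{b,c},{d,a}}"
    using t unfolding tmove_def by blast
  have w: "white a" "white b" "white c" using adj unfolding E2adj_def by blast+
  have d: "black d" using E1adj_white_black[OF adj(3)] w by blast
  have V: "a \<in> VG F f" "b \<in> VG F f" "c \<in> VG F f" "d \<in> VG F f" using edge_props[OF M] ab cd by blast+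
  have nd: "d \<noteq> a" "d \<noteq> b" "d \<noteq> c" using d w unfolding black_def by blast+
  have ba: "{b,a} \<in> M" and dc: "{d,c} \<in> M" using ab cd by (simp_all add: insert_commute)
  have ac: "a \<noteq> c" using covering_unique[OF M ab] cd nd by blast
  have nab: "a \<noteq> b" "b \<noteq> c" using adj E2adj_irrefl by blast+
  have bc: "{b,c} \<notin> M" using covering_unique[OF M ba] ac by blast
  have da: "{d,a} \<notin> M" using covering_unique[OF M dc] ac by blast
  have old: "e = {x,y}" if "e \<in> M" "x \<in> e" "{x,y} \<in> M" for e x y
  proof -
    have "x \<in> VG F f" using edge_props(1)[OF M that(3)] .
    moreover have "x \<in> {x,y}" by blast
    ultimately show ?thesis using M that unfolding dimer_covering_def by blast
  qed
  have "DC M'"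
    unfolding dimer_covering_def
  proof
    have "{b,c} \<in> induced_edges (VG F f)" "{d,a} \<in> induced_edges (VG F f)"
      unfolding induced_edges_def gamma_adj_def using V adj by blast+
    then show "M' \<subseteq> induced_edges (VG F f)" using M unfolding M' dimer_covering_def by blast
    show "\<forall>x\<in>VG F f. \<exists>!e. e \<in> M' \<and> x \<in> e"
    proof
      fix x assume x: "x \<in> VG F f"
      consider "x = a \<or> x = d" | "x = b \<or> x = c" | "x \<noteq> a" "x \<noteq> b" "x \<noteq> c" "x \<noteq> d" by blast
      then show "\<exists>!e. e \<in> M' \<and> x \<in> e"
      proof cases
        case 1
        have "{d,a} \<in> M' \<and> x \<in> {d,a}" using 1 M' by blast
        moreover have "e = {d,a}" if "e \<in> M' \<and> x \<in> e" for e
          using that 1 old[OF _ _ ab, of e] old[OF _ _ dc, of e] nd nab ac unfolding M' by blast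
        ultimately show ?thesis by blast
      next
        case 2
        have "{b,c} \<in> M' \<and> x \<in> {b,c}" using 2 M' by blast
        moreover have "e = {b,c}" if "e \<in> M' \<and> x \<in> e" for e
          using that 2 old[OF _ _ ba, of e] old[OF _ _ cd, of e] nd nab ac unfolding M' by blast
        ultimately show ?thesis by blast
      next
        case 3
        have "e \<in> M' \<and> x \<in> e \<longleftrightarrow> e \<in> M \<and> x \<in> e" for e using 3 unfolding M' by blast
        then show ?thesis using M x unfolding dimer_covering_def by simp
      qed
    qed
  qed
  moreover have "tmove M' M"
    unfolding tmove_def
  proof (intro exI conjI)
    show "{c,b} \<in> M'" "{a,d} \<in> M'" unfolding M' by blast+
    show "E2adj c b" "E2adj b a" using adj E2adj_sym by blast+
    show "E1adj a d" "E1adj d c" using adj E1adj_sym by blast+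
    have e: "{c,b} = {b,c}" "{a,d} = {d,a}" "{b,a} = {a,b}" "{d,c} = {c,d}" by blast+
    show "M = (M' - {{c,b},{a,d}}) \<union> {{b,a},{d,c}}"
      unfolding e M' using ab cd bc da by blast
  qed
  moreover have "tree_mids F M' = tree_mids F M"
  proof -
    have "a \<in> W0 \<longleftrightarrow> c \<in> W0" using E2adj_W0[OF adj(1)] E2adj_W1[OF adj(2)] by blast
    have "(\<exists>x\<in>W0. {x,y} \<in> M') \<longleftrightarrow> (\<exists>x\<in>W0. {x,y} \<in> M)" if y: "black y" for y
    proof (cases "y = d")
      case True
      have "(\<exists>x\<in>W0. {x,d} \<in> M) \<longleftrightarrow> c \<in> W0" using covering_unique'[OF M cd] cd by blast
      moreover have "{a,d} \<in> M'" unfolding M' by blast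
      ultimately show ?thesis
        using \<open>a \<in> W0 \<longleftrightarrow> c \<in> W0\<close> covering_unique'[OF M cd] True nd nab ac w
        unfolding M' by (auto simp: doubleton_eq_iff)
    next
      case False
      have "y \<noteq> a" "y \<noteq> b" "y \<noteq> c" using y w unfolding black_def by blast+
      then have "{x,y} \<in> M' \<longleftrightarrow> {x,y} \<in> M" for x
        unfolding M' using False by (auto simp: doubleton_eq_iff)
      then show ?thesis by blast
    qed
    then show ?thesis unfolding tree_mids_def using E_black by blast
  qed
  ultimately show ?thesis by blast
qed

text \<open>\<open>t_equiv\<close> is a reflexive transitive closure; its symmetry on coverings
  comes from reversing each move.\<close>

lemma t_equiv_dimer:
  assumes M: "DC M" and t: "t_equiv M M'"
  shows "DC M' \<and> t_equiv M' M \<and> tree_mids F M' = tree_mids F M"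
  using t unfolding t_equiv_def
proof (induction rule: rtranclp_induct)
  case base
  then show ?case using M by blast
next
  case (step y z)
  then have z: "DC z" "tmove z y" "tree_mids F z = tree_mids F y" using tmove_dimer by blast+
  then have "tmove\<^sup>*\<^sup>* z M" using step by (meson converse_rtranclp_into_rtranclp)
  then show ?case using z step by simp
qed

lemma t_equiv_trans: "t_equiv A B \<Longrightarrow> t_equiv B C \<Longrightarrow> t_equiv A C"
  unfolding t_equiv_def by (rule rtranclp_trans)

end

section \<open>The tree of a dimer covering\<close>

context temperley
begin

text \<open>A directed cycle of vertex dimers would bound a disc \<open>S\<close>. By Euler's formula the disc has one more
  interior white than interior black vertex, while all its interior vertices except possibly both
  ends of the impurity are matched among themselves.\<close>
lemma no_closed:
  assumes M: "DC M" and i: "impurity M x0 c0"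
    and A: "A \<subseteq> VH F" "x0 \<notin> A" "A \<noteq> {}"
    and cl: "\<And>x b. x \<in> A \<Longrightarrow> {x,b} \<in> M \<Longrightarrow> opp b x \<in> A"
  shows False
proof -
  have "\<forall>x\<in>A. \<exists>b. b \<in> mids F \<and> E1adj x b \<and> {x,b} \<in> M"
  proof
    fix x assume "x \<in> A"
    then have "x \<in> VH F" "x \<noteq> x0" using A by blast+
    then obtain b where "b \<in> tree_mids F M" "E1adj x b" "{x,b} \<in> M" using vertex_partner[OF M i] by blast
    then show "\<exists>b. b \<in> mids F \<and> E1adj x b \<and> {x,b} \<in> M" unfolding tree_mids_def by blast
  qed
  then obtain \<beta> where \<beta>: "\<And>x. x \<in> A \<Longrightarrow> \<beta> x \<in> mids F \<and> E1adj x (\<beta> x) \<and> {x, \<beta> x} \<in> M" by metis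
  have inj: "inj_on \<beta> A"
  proof (rule inj_onI)
    fix x y assume "x \<in> A" "y \<in> A" "\<beta> x = \<beta> y"
    then show "x = y" using \<beta> covering_unique'[OF M, of x "\<beta> x" y] by metis
  qed
  have finA: "finite A" using A(1) finite_VH[OF finF] finite_subset by blast
  have AW: "A \<subseteq> lat True" using A(1) VH_W0 W0_lat by blast
  have adjA: "\<And>x. x \<in> A \<Longrightarrow> E1adj x (\<beta> x)" and clA: "\<And>x. x \<in> A \<Longrightarrow> opp (\<beta> x) x \<in> A"
    using \<beta> cl by blast+
  obtain C where C: "C \<subseteq> A" "C \<noteq> {}" and Ccl: "\<And>x. x \<in> C \<Longrightarrow> opp (\<beta> x) x \<in> C"
    and ev: "\<And>w. w \<in> lat True \<Longrightarrow> even_at (\<beta> ` C) w"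
    and min: "\<And>Z. Z \<subseteq> \<beta> ` C \<Longrightarrow> (\<And>w. w \<in> lat True \<Longrightarrow> even_at Z w) \<Longrightarrow> Z = {} \<or> Z = \<beta> ` C"
    using closed_cycle[OF finA A(3) AW adjA inj clA] by blast
  define Z where "Z = \<beta> ` C"
  have ZE: "Z \<subseteq> mids F" unfolding Z_def using \<beta> C by blast
  have finZ: "finite Z" using ZE finite_mids[OF finF] finite_subset by blast
  obtain S where S: "S \<subseteq> F" "finite S" "bnd S = Z"
    using fill_subset[OF FW1 nh finZ ZE] ev unfolding Z_def W0_lat by blast
  have SW: "S \<subseteq> W1" using S FW1 by blast
  have Sl: "S \<subseteq> lat False" using SW W1_lat by blast
  have Sne: "S \<noteq> {}" using S(3) C(2) unfolding Z_def bnd_def by blast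
  \<comment> \<open>The cycle is simple, so a finite region bounded by part of it is empty or the
    whole disc. Both hypotheses of Euler's formula for \<open>S\<close> follow from this.\<close>
  have bnd_all: "X = {} \<or> X = S" if "finite X" "X \<subseteq> W1" "bnd X \<subseteq> Z" for X
  proof -
    have Xl: "X \<subseteq> lat False" using that W1_lat by blast
    have "\<And>w. w \<in> lat True \<Longrightarrow> even_at (bnd X) w" using even_at_bnd[OF Xl] by simp
    then have "bnd X = {} \<or> bnd X = bnd S" using min[of "bnd X"] that(3) unfolding S(3) Z_def by blast
    then show ?thesis using bnd_empty_imp[OF Xl that(1)] bnd_inj[OF Xl that(1) Sl S(2)] by blast
  qed
  have "hconn S"
  proof (rule hconn_if)
    fix A' assume A': "A' \<subseteq> S" "A' \<noteq> {}"
      and c: "\<And>c c'. c \<in> A' \<Longrightarrow> c' \<in> S \<Longrightarrow> VH {c} \<inter> VH {c'} \<noteq> {} \<Longrightarrow> c' \<in> A'"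
    have "bnd A' \<subseteq> Z"
    proof
      fix b assume "b \<in> bnd A'"
      then obtain w where w: "w \<in> A'" "E1adj w b" "opp b w \<notin> A'" unfolding bnd_def by blast
      have wW: "w \<in> W1" using w A' SW by blast
      have "black b" using lat_black W1_lat wW w(2) by blast
      then obtain x where x: "x \<in> W0" "E1adj x b" using black_nbr_ex W0_lat by metis
      have "x \<in> VH {w}" "x \<in> VH {opp b w}"
        using corner_mid[OF wW x(1) w(2) x(2)] corner_mid[OF opp_in_W1[OF wW] x(1) _ x(2), of b] w(2) by simp_all
      then have "opp b w \<notin> S" using c[OF w(1)] w(3) by blast
      then show "b \<in> Z" using w A' unfolding S(3)[symmetric] bnd_def by blast
    qed
    moreover have "finite A'" using A' S finite_subset by blast
    moreover have "A' \<subseteq> W1" using A' SW by blast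
    ultimately show "A' = S" using bnd_all A'(2) by blast
  qed
  moreover have "no_holes S"
    unfolding no_holes_def
  proof (intro allI impI)
    fix K assume K: "finite K" "K \<subseteq> W1 - S" and c: "\<forall>c\<in>K. \<forall>b. E1adj c b \<longrightarrow> opp b c \<notin> S \<longrightarrow> opp b c \<in> K"
    have "bnd K \<subseteq> Z"
    proof
      fix b assume "b \<in> bnd K"
      then obtain w where w: "w \<in> K" "E1adj w b" "opp b w \<notin> K" unfolding bnd_def by blast
      then have "opp b w \<in> S" using c by blast
      moreover have "w \<in> lat False" "w \<notin> S" using w(1) K(2) W1_lat by blast+
      ultimately show "b \<in> Z" using bnd_iff[OF Sl _ w(2)] S(3) by blast
    qed
    then have "K = {} \<or> K = S" using bnd_all K by blast
    then show "K = {}" using K(2) Sne by blast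
  qed
  ultimately have euS: "card S + card (VH S) = card (mids S) + 1" using euler[OF S(2) SW Sne] by blast
  have finVS: "finite (VH S)" and finES: "finite (mids S)" using finite_VH finite_mids S(2) by blast+
  have ZS: "Z \<subseteq> mids S" using bnd_subset_mids[of S S] S(3) by blast
  have CS: "C \<subseteq> VH S"
  proof
    fix x assume x: "x \<in> C"
    then have "\<beta> x \<in> mids S" "x \<in> W0" "E1adj x (\<beta> x)" using ZS AW C \<beta> W0_lat unfolding Z_def by blast+
    then show "x \<in> VH S" using VH_if_mid[OF SW] by blast
  qed
  have cZ: "card Z = card C" unfolding Z_def using inj C(1) by (meson card_image inj_on_subset)
  define VI where "VI = VH S - C"
  define I where "I = mids S - Z"
  have VIW: "w \<in> W0" if "w \<in> VI" for w using that VH_subset[OF SW] unfolding VI_def by blast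
  have cVI: "card (VH S) = card VI + card C" unfolding VI_def
    using card_Diff_subset[OF _ CS] card_mono[OF finVS CS] finite_subset[OF CS finVS] by simp
  have cI: "card (mids S) = card I + card Z" unfolding I_def
    using card_Diff_subset[OF finZ ZS] card_mono[OF finES ZS] by simp
  \<comment> \<open>The bounding cycle has as many vertices as edges, so these cancel from Euler's
    formula.\<close>
  have count: "card S + card VI = card I + 1" using euS cVI cI cZ by simp
  have notZ: "b \<notin> Z" if w: "w \<in> VI" "E1adj w b" for w b
  proof
    assume "b \<in> Z"
    then obtain x where x: "x \<in> C" "b = \<beta> x" unfolding Z_def by blast
    have xa: "E1adj x b" "x \<in> W0" using x \<beta> C AW W0_lat by blast+
    have "w = x \<or> w = opp b x"
      using E1adj_cases[of x True w b] xa w VIW[OF w(1)] unfolding W0_lat by blast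
    then have "w \<in> C" using Ccl x by blast
    then show False using w unfolding VI_def by blast
  qed
  \<comment> \<open>No edge at an interior vertex lies on the cycle, so a turn around it never
    leaves the disc.\<close>
  have around: "c \<in> S" if w: "w \<in> VI" and c: "w \<in> VH {c}" "c \<in> W1" for w c
  proof -
    have "w \<in> VH S" using w by (simp add: VI_def)
    then obtain c' where c': "c' \<in> S" "w \<in> VH {c'}" unfolding VH_def by auto
    have "c \<in> S \<and> c \<in> W1"
    proof (rule corners_invariant[of c' w c "\<lambda>c. c \<in> S \<and> c \<in> W1"])
      show "c' \<in> VH {w}" "c \<in> VH {w}" using c' c VH_single_sym by blast+
      show "c' \<in> S \<and> c' \<in> W1" using c' SW by blast
      fix b z assume b: "E1adj w b" "E1adj z b" and z: "z \<in> S \<and> z \<in> W1"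
      then have "z \<in> lat False" using W1_lat by blast
      then have "opp b z \<in> S" using bnd_iff[OF Sl _ b(2)] notZ[OF w b(1)] z S(3) by blast
      then show "opp b z \<in> S \<and> opp b z \<in> W1" using opp_in_W1 z by blast
    qed
    then show ?thesis by blast
  qed
  have c0: "E2adj x0 c0" "x0 \<in> VH F" "c0 \<in> R" using impurity_adj[OF M i] by blast+
  have xW: "x0 \<in> W0" "c0 \<in> W1" using i unfolding impurity_def by blast+
  \<comment> \<open>The impurity does not cross the cycle: \<open>x0\<close> is off the cycle, and
    \<open>c0\<close> is one of the four faces around it.\<close>
  have xc: "x0 \<in> VI \<longleftrightarrow> c0 \<in> S"
  proof
    assume "x0 \<in> VI"
    then show "c0 \<in> S" using around E2adj_corner[OF c0(1)] xW by blast
  next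
    assume "c0 \<in> S"
    then have "x0 \<in> VH S" using E2adj_corner[OF c0(1)] VH_mono[of "{c0}" S] by blast
    then show "x0 \<in> VI" using A(2) C(1) unfolding VI_def by blast
  qed
  define W where "W = S \<union> VI"
  have WF: "w \<in> VH F \<or> w \<in> R" if "w \<in> W" for w
    using that S(1) VH_mono[OF S(1)] unfolding W_def VI_def by blast
  \<comment> \<open>Interior points have interior partners: for a face, because the midpoints on the
    cycle are matched with cycle vertices; for a vertex, because no edge at it lies on the
    cycle.\<close>
  have part: "\<exists>b. b \<in> I \<and> {w,b} \<in> M" if w: "w \<in> W" "w \<notin> {x0,c0}" for w
  proof (cases "w \<in> S")
    case True
    then have "w \<in> R" "w \<noteq> c0" using S w by blast+
    then obtain b where b: "b \<in> mids F" "b \<notin> tree_mids F M" "E1adj w b" "{w,b} \<in> M"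
      using face_partner[OF M i] by blast
    have "b \<notin> Z"
    proof
      assume "b \<in> Z"
      then obtain x where x: "x \<in> C" "b = \<beta> x" unfolding Z_def by blast
      then have "{x,b} \<in> M" "x \<in> W0" using \<beta> C AW W0_lat by blast+
      then show False using b unfolding tree_mids_def by blast
    qed
    moreover have "b \<in> mids S" using True b mids_iff by blast
    ultimately show ?thesis using b unfolding I_def by blast
  next
    case False
    then have wI: "w \<in> VI" using w unfolding W_def by blast
    then have "w \<in> VH F" "w \<noteq> x0" using VH_mono[OF S(1)] w unfolding VI_def by blast+
    then obtain b where b: "b \<in> tree_mids F M" "E1adj w b" "{w,b} \<in> M" using vertex_partner[OF M i] by blast
    then have "b \<in> mids F" unfolding tree_mids_def by blast
    then obtain c where c: "c \<in> F" "E1adj c b" using mids_iff by blast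
    then have cW: "c \<in> W1" using FW1 by blast
    have "c \<in> S" using around[OF wI corner_mid[OF cW VIW[OF wI] c(2) b(2)] cW] .
    then have "b \<in> mids S" using c mids_iff by blast
    then show ?thesis using notZ[OF wI b(2)] b unfolding I_def by blast
  qed
  then obtain p where p: "\<And>w. w \<in> W - {x0,c0} \<Longrightarrow> p w \<in> I \<and> {w, p w} \<in> M" by (metis DiffE)
  have "bij_betw p (W - {x0,c0}) I"
  proof (rule bij_betw_imageI)
    show "inj_on p (W - {x0,c0})"
    proof (rule inj_onI)
      fix x y assume "x \<in> W - {x0,c0}" "y \<in> W - {x0,c0}" "p x = p y"
      then show "x = y" using p covering_unique'[OF M, of x "p x" y] by metis
    qed
    show "p ` (W - {x0,c0}) = I"
    proof
      show "p ` (W - {x0,c0}) \<subseteq> I" using p by blast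
      show "I \<subseteq> p ` (W - {x0,c0})"
      proof
        fix b assume b: "b \<in> I"
        then have bS: "b \<in> mids S" "b \<notin> bnd S" using S(3) unfolding I_def by blast+
        have bE: "b \<in> mids F" using bS mids_mono[OF S(1)] by blast
        obtain c where c: "c \<in> S" "E1adj c b" using bS mids_iff by blast
        have cl': "c \<in> lat False" using c Sl by blast
        have c2: "opp b c \<in> S" using c bS(2) unfolding bnd_def by blast
        have "\<exists>y. y \<in> W \<and> {y,b} \<in> M"
        proof (cases "b \<in> tree_mids F M")
          case True
          then obtain x where x: "x \<in> VH F" "E1adj x b" "{x,b} \<in> M" using tree_edge[OF M] by blast
          have "x \<in> VH S" using VH_if_mid[OF SW bS(1)] x VH_W0 by blast
          moreover have "x \<notin> C"
          proof
            assume "x \<in> C"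
            then have "b = \<beta> x" using \<beta>[of x] C covering_unique[OF M x(3)] by blast
            then show False using \<open>x \<in> C\<close> b unfolding I_def Z_def by blast
          qed
          ultimately show ?thesis using x unfolding W_def VI_def by blast
        next
          case False
          then obtain c' where c': "c' \<in> R" "E1adj c' b" "{c',b} \<in> M" using cotree_edge[OF M bE] by blast
          have "c' = c \<or> c' = opp b c"
            using E1adj_cases[OF cl' _ c(2) c'(2)] R_W1[OF c'(1)] W1_lat by blast
          then show ?thesis using c c2 c' unfolding W_def by blast
        qed
        then obtain y where y: "y \<in> W" "{y,b} \<in> M" by blast
        have "y \<notin> {x0,c0}"
        proof
          assume "y \<in> {x0,c0}"
          then have "b = c0 \<or> b = x0"
            using covering_unique[OF M y(2), of c0] covering_unique[OF M y(2), of x0] i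
            unfolding impurity_def by (auto simp: insert_commute)
          then have "white b" using xW W0_white W1_white by blast
          then show False using E_black[OF bE] unfolding black_def by blast
        qed
        then have "y \<in> W - {x0,c0}" using y by blast
        moreover have "p y = b" using p[OF calculation] covering_unique[OF M y(2)] by blast
        ultimately show "b \<in> p ` (W - {x0,c0})" by blast
      qed
    qed
  qed
  then have "card (W - {x0,c0}) = card I" by (rule bij_betw_same_card)
  moreover have finW: "finite W" unfolding W_def VI_def using S(2) finVS by blast
  moreover have "S \<inter> VI = {}" using SW VIW W0_W1_disjoint by blast
  then have "card W = card S + card VI"
    unfolding W_def using S(2) finVS unfolding VI_def by (intro card_Un_disjoint) auto
  \<comment> \<open>Of the \<open>card I + 1\<close> points of \<open>W\<close>, none or two are
    removed, so the number left cannot be \<open>card I\<close>.\<close>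
  moreover have "W \<inter> {x0,c0} = {} \<or> {x0,c0} \<subseteq> W"
    using xc SW VIW W0_W1_disjoint xW unfolding W_def by blast
  moreover have "card {x0,c0} = 2" using W0_W1_disjoint xW by (metis card_2_iff)
  ultimately show False
  proof -
    assume a: "card (W - {x0,c0}) = card I" "finite W" "card W = card S + card VI"
      "W \<inter> {x0,c0} = {} \<or> {x0,c0} \<subseteq> W" "card {x0,c0} = 2"
    from a(4) show False
    proof
      assume "W \<inter> {x0,c0} = {}"
      then have "W - {x0,c0} = W" by blast
      then show False using a count by simp
    next
      assume s: "{x0,c0} \<subseteq> W"
      then have "card (W - {x0,c0}) = card W - 2" "card W \<ge> 2"
        using card_Diff_subset[of "{x0,c0}" W] card_mono[OF a(2) s] a(5) by simp_all
      then show False using a count by simp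
    qed
  qed
qed

text \<open>The vertices that cannot reach \<open>x0\<close> would be closed under following their
  dimers.\<close>

lemma reach_root:
  assumes M: "DC M" and i: "impurity M x0 c0" and x: "x \<in> VH F"
  shows "(hstep (tree_mids F M))\<^sup>*\<^sup>* x x0"
proof (rule ccontr)
  let ?A = "{x \<in> VH F. \<not> (hstep (tree_mids F M))\<^sup>*\<^sup>* x x0}"
  assume n: "\<not> ?thesis"
  show False
  proof (rule no_closed[OF M i, of ?A])
    show "?A \<subseteq> VH F" "x0 \<notin> ?A" "?A \<noteq> {}" using n x by blast+
    fix y b assume y: "y \<in> ?A" "{y,b} \<in> M"
    then have "y \<in> VH F" "y \<noteq> x0" by blast+
    then obtain b' where b': "b' \<in> tree_mids F M" "E1adj y b'" "{y,b'} \<in> M" using vertex_partner[OF M i] by blast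
    then have "b' = b" using covering_unique[OF M y(2)] by blast
    then have b: "b \<in> tree_mids F M" "E1adj y b" using b' by blast+
    then have s: "hstep (tree_mids F M) y (opp b y)" unfolding hstep_def by blast
    have "opp b y \<in> VH F"
      using VH_if_mid[OF FW1, of b "opp b y"] b opp_in_W0[OF VH_W0] y(1) unfolding tree_mids_def by simp
    then show "opp b y \<in> ?A" using s y(1) converse_rtranclp_into_rtranclp by (metis (mono_tags, lifting) mem_Collect_eq)
  qed
qed

text \<open>Of two tree edges inside \<open>X\<close> at a vertex at most one is its own dimer; the
  other is the dimer of its far end, so every vertex of \<open>X\<close> receives an arrow from
  \<open>X\<close>. Since each vertex sends at most one, all of them send one and the successor map
  permutes \<open>X\<close>, which is thus closed under arrows. Even edge sets and cycles given as
  vertex lists both reduce to this.\<close>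

lemma no_min_degree_two:
  assumes M: "DC M" and X: "X \<subseteq> VH F" "X \<noteq> {}"
    and deg: "\<And>x. x \<in> X \<Longrightarrow> \<exists>b1 b2. b1 \<noteq> b2 \<and> (\<forall>b\<in>{b1,b2}. b \<in> tree_mids F M \<and> E1adj x b \<and> opp b x \<in> X)"
  shows False
proof -
  obtain x0 c0 where i: "impurity M x0 c0" using ex1_impurity[OF M] by blast
  define A where "A = {y \<in> X. \<exists>b\<in>mids F. {y,b} \<in> M}"
  then have "\<forall>y\<in>A. \<exists>b. b \<in> mids F \<and> {y,b} \<in> M" by blast
  then obtain \<beta> where \<beta>: "\<And>y. y \<in> A \<Longrightarrow> \<beta> y \<in> mids F \<and> {y, \<beta> y} \<in> M" by metis
  define g where "g y = opp (\<beta> y) y" for y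
  have Xg: "X \<subseteq> g ` A"
  proof
    fix x assume x: "x \<in> X"
    obtain b1 b2 where b12: "b1 \<noteq> b2" "\<And>b. b \<in> {b1,b2} \<Longrightarrow> b \<in> tree_mids F M \<and> E1adj x b \<and> opp b x \<in> X"
      using deg[OF x] by blast
    have "\<not> ({x,b1} \<in> M \<and> {x,b2} \<in> M)" using covering_unique[OF M] b12(1) by blast
    then obtain b where b: "b \<in> {b1,b2}" "{x,b} \<notin> M" by blast
    then have bb: "b \<in> tree_mids F M" "E1adj x b" "opp b x \<in> X" using b12(2) by blast+
    obtain y where y: "y \<in> VH F" "E1adj y b" "{y,b} \<in> M" using tree_edge[OF M bb(1)] by blast
    have "y = x \<or> y = opp b x"
      using E1adj_cases[of x True y b] X(1) x VH_W0 y bb(2) unfolding W0_lat[symmetric] by blast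
    then have yo: "y = opp b x" using y(3) b(2) by blast
    have "b \<in> mids F" using bb(1) unfolding tree_mids_def by blast
    then have yA: "y \<in> A" unfolding A_def using yo bb(3) y(3) by blast
    then have "\<beta> y = b" using \<beta> covering_unique[OF M y(3)] by blast
    then have "g y = x" unfolding g_def yo by simp
    then show "x \<in> g ` A" using yA by blast
  qed
  have AX: "A \<subseteq> X" unfolding A_def by blast
  have finX: "finite X" using X(1) finite_VH[OF finF] finite_subset by blast
  then have finA: "finite A" using AX finite_subset by blast
  have "card X \<le> card (g ` A)" "card (g ` A) \<le> card A" "card A \<le> card X"
    using card_mono[OF finite_imageI[OF finA] Xg] card_image_le[OF finA, of g] card_mono[OF finX AX]
    by blast+
  then have AeqX: "A = X" and gX: "g ` A = X"
    using card_seteq[OF finX AX] card_seteq[OF finite_imageI[OF finA] Xg] by simp_all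
  show False
  proof (rule no_closed[OF M i X(1) _ X(2)])
    show "x0 \<notin> X"
    proof
      assume "x0 \<in> X"
      then have b: "\<beta> x0 \<in> mids F" "{x0, \<beta> x0} \<in> M" using \<beta> AeqX by blast+
      then have "\<beta> x0 = c0" using covering_unique[OF M] i unfolding impurity_def by blast
      then show False using E_black[OF b(1)] i W1_white unfolding impurity_def black_def by blast
    qed
    fix x b assume x: "x \<in> X" "{x,b} \<in> M"
    then have "b = \<beta> x" using \<beta> AeqX covering_unique[OF M x(2)] by blast
    then show "opp b x \<in> X" using gX AeqX x unfolding g_def by blast
  qed
qed

lemma no_even_tree:
  assumes M: "DC M" and Z: "Z \<subseteq> tree_mids F M" and ev: "\<And>w. w \<in> W0 \<Longrightarrow> even_at Z w"
  shows "Z = {}"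
proof (rule ccontr)
  assume ne: "Z \<noteq> {}"
  let ?X = "{x \<in> W0. \<exists>b\<in>Z. E1adj x b}"
  have ZE: "b \<in> mids F" if "b \<in> Z" for b using that Z unfolding tree_mids_def by blast
  show False
  proof (rule no_min_degree_two[OF M, of ?X])
    show "?X \<subseteq> VH F" using VH_if_mid[OF FW1] ZE by blast
    obtain b where b: "b \<in> Z" using ne by blast
    then obtain x where "x \<in> VH F" "E1adj x b" using tree_edge[OF M] Z by blast
    then show "?X \<noteq> {}" using b VH_W0 by blast
    fix x assume "x \<in> ?X"
    then obtain b1 where x: "x \<in> W0" and b1: "b1 \<in> Z" "E1adj x b1" by blast
    obtain b2 where b2: "b2 \<in> Z" "E1adj x b2" "b2 \<noteq> b1" using even_at_two[OF ev[OF x] b1] by blast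
    have "opp b x \<in> ?X" if "b \<in> Z" "E1adj x b" for b using that opp_in_W0[OF x] E1adj_opp by blast
    then show "\<exists>b1 b2. b1 \<noteq> b2 \<and> (\<forall>b\<in>{b1,b2}. b \<in> tree_mids F M \<and> E1adj x b \<and> opp b x \<in> ?X)"
      using b1 b2 Z by blast
  qed
qed

lemma no_cycle:
  assumes M: "DC M"
  shows "\<not> has_cycle (ed ` tree_mids F M)"
proof
  assume "has_cycle (ed ` tree_mids F M)"
  then obtain vs where n: "length vs \<ge> 3" and d: "distinct vs"
    and e: "\<And>i. i < length vs \<Longrightarrow> {vs ! i, vs ! ((i + 1) mod length vs)} \<in> ed ` tree_mids F M"
    unfolding has_cycle_def by blast
  let ?n = "length vs"
  have nb: "\<exists>b\<in>tree_mids F M. E1adj x b \<and> y = opp b x \<and> x \<in> VH F"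
    if xy: "{x,y} \<in> ed ` tree_mids F M" for x y
  proof -
    obtain b where b: "b \<in> tree_mids F M" "ed b = {x,y}" using xy by (metis imageE)
    then have x: "x \<in> W0" "E1adj x b" unfolding ed_def by blast+
    have "{x,y} = {x, opp b x}" using ed_eq[OF x] b(2) by simp
    then have "y = opp b x" by (metis doubleton_eq_iff)
    moreover have "x \<in> VH F" using VH_if_mid[OF FW1 _ x] b(1) unfolding tree_mids_def by blast
    ultimately show ?thesis using b x by blast
  qed
  have nbrs: "\<exists>y1\<in>set vs. \<exists>y2\<in>set vs. y1 \<noteq> y2 \<and> {x,y1} \<in> ed ` tree_mids F M \<and> {x,y2} \<in> ed ` tree_mids F M"
    if x: "x \<in> set vs" for x
  proof -
    obtain i where i: "i < ?n" "x = vs ! i" using x by (metis in_set_conv_nth)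
    \<comment> \<open>Cyclic successor and predecessor of position \<open>i\<close>; they differ
      because the cycle has at least three vertices.\<close>
    let ?j = "(i + 1) mod ?n" and ?k = "if i = 0 then ?n - 1 else i - 1"
    have j: "?j < ?n" using n by (intro mod_less_divisor) linarith
    have k: "?k < ?n" "(?k + 1) mod ?n = i" using i n by auto
    have "?j \<noteq> ?k"
    proof (cases "i + 1 = ?n")
      case True
      then show ?thesis using n by auto
    next
      case False
      then have "?j = i + 1" using i by simp
      then show ?thesis using n i False by auto
    qed
    then have "vs ! ?j \<noteq> vs ! ?k" using d j k(1) by (simp add: nth_eq_iff_index_eq)
    moreover have "{x, vs ! ?j} \<in> ed ` tree_mids F M" using e[OF i(1)] i(2) by simp
    moreover have "{x, vs ! ?k} \<in> ed ` tree_mids F M" using e[OF k(1)] k(2) i(2) by (simp add: insert_commute)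
    ultimately show ?thesis using j k(1) by (meson nth_mem)
  qed
  show False
  proof (rule no_min_degree_two[OF M, of "set vs"])
    show "set vs \<subseteq> VH F" using nbrs nb by blast
    show "set vs \<noteq> {}" using n by auto
    fix x assume x: "x \<in> set vs"
    then obtain y1 y2 where y: "y1 \<in> set vs" "y2 \<in> set vs" "y1 \<noteq> y2"
      "{x,y1} \<in> ed ` tree_mids F M" "{x,y2} \<in> ed ` tree_mids F M" using nbrs by meson
    obtain b1 where b1: "b1 \<in> tree_mids F M" "E1adj x b1" "y1 = opp b1 x" using nb[OF y(4)] by blast
    obtain b2 where b2: "b2 \<in> tree_mids F M" "E1adj x b2" "y2 = opp b2 x" using nb[OF y(5)] by blast
    have "b1 \<noteq> b2" using y(3) b1(3) b2(3) by blast
    then show "\<exists>b1 b2. b1 \<noteq> b2 \<and> (\<forall>b\<in>{b1,b2}. b \<in> tree_mids F M \<and> E1adj x b \<and> opp b x \<in> set vs)"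
      using b1 b2 y by blast
  qed
qed

text \<open>A nonempty even set in the dual bounds a finite set \<open>U\<close> of vertices and
  separates the ends of each of its edges, whereas the tree joins these ends through
  \<open>x0\<close> without crossing it.\<close>

lemma no_even_cotree:
  assumes M: "DC M" and Z: "Z \<subseteq> mids F - tree_mids F M" and ev: "\<And>w. w \<in> W1 \<Longrightarrow> even_at Z w"
  shows "Z = {}"
proof (rule ccontr)
  assume "Z \<noteq> {}"
  then obtain b where b: "b \<in> Z" by blast
  have bE: "b \<in> mids F" using b Z by blast
  have finZ: "finite Z" using Z finite_mids[OF finF] finite_subset by blast
  have bl: "\<And>b. b \<in> Z \<Longrightarrow> black b" using Z E_black by blast
  obtain U where U: "finite U" "U \<subseteq> lat True" "bnd U = Z"
    using fill[of Z True, OF finZ bl] ev unfolding W1_lat by auto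
  obtain x where x: "x \<in> U" "E1adj x b" "opp b x \<notin> U" using b U(3) unfolding bnd_def by blast
  have xW: "x \<in> W0" using x U W0_lat by blast
  obtain x0 c0 where i: "impurity M x0 c0" using ex1_impurity[OF M] by blast
  have "x \<in> VH F" "opp b x \<in> VH F"
    using VH_if_mid[OF FW1 bE xW x(2)] VH_if_mid[OF FW1 bE opp_in_W0[OF xW]] x(2) by simp_all
  then have "(hstep (tree_mids F M))\<^sup>*\<^sup>* x (opp b x)"
    using reach_root[OF M i] hstep_rtranclp_sym by (meson rtranclp_trans)
  then have "opp b x \<in> U \<and> opp b x \<in> lat True"
  proof (induction rule: rtranclp_induct)
    case base
    then show ?case using x U by blast
  next
    case (step y z)
    then obtain b' where b': "b' \<in> tree_mids F M" "E1adj y b'" "z = opp b' y" unfolding hstep_def by blast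
    have "b' \<notin> bnd U" using b'(1) Z U(3) by blast
    then show ?case using bnd_iff[OF U(2) _ b'(2)] step.IH b'(3) opp_in_lat by blast
  qed
  then show False using x by blast
qed

end

section \<open>Moving the impurity\<close>

text \<open>\<open>d x\<close> is the least number of steps from \<open>x\<close> to a point outside
  \<open>A\<close>; the first step of a shortest walk leaves \<open>A\<close> or lowers it. This
  orients a tree towards its root.\<close>

lemma descent:
  fixes r :: "'a \<Rightarrow> 'a \<Rightarrow> bool"
  assumes "\<And>x. x \<in> A \<Longrightarrow> \<exists>y. y \<notin> A \<and> r\<^sup>*\<^sup>* x y"
  obtains d :: "'a \<Rightarrow> nat" where "\<And>x. x \<in> A \<Longrightarrow> \<exists>z. r x z \<and> (z \<in> A \<longrightarrow> d z < d x)"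
proof -
  define d where "d x = (LEAST n. \<exists>y. y \<notin> A \<and> (r ^^ n) x y)" for x
  have "\<exists>z. r x z \<and> (z \<in> A \<longrightarrow> d z < d x)" if x: "x \<in> A" for x
  proof -
    have "\<exists>n y. y \<notin> A \<and> (r ^^ n) x y" using assms[OF x] rtranclp_imp_relpowp by metis
    then have "\<exists>y. y \<notin> A \<and> (r ^^ d x) x y" unfolding d_def by (rule LeastI_ex)
    then obtain y where y: "y \<notin> A" "(r ^^ d x) x y" by blast
    show ?thesis
    proof (cases "d x")
      case 0
      then show ?thesis using x y by simp
    next
      case (Suc m)
      then obtain z where z: "r x z" "(r ^^ m) z y" using y(2) relpowp_Suc_D2 by metis
      have "d z \<le> m" unfolding d_def by (rule Least_le) (use z y in blast)
      then show ?thesis using z(1) Suc by auto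
    qed
  qed
  then show ?thesis using that by blast
qed

context temperley
begin

section \<open>Shifts of the impurity along the contour\<close>

lemma root_W: "v \<in> W0" "f \<in> W1"
  using VH_W0[OF vF] fW1 by blast+

lemma impurity_root: "impurity M v f \<longleftrightarrow> {f,v} \<in> M"
  unfolding impurity_def using root_W by (simp add: insert_commute)

text \<open>\<open>x\<close> is taken by the impurity, so the tree edge \<open>b\<close> is matched
  with its far end; together with \<open>x\<close> and \<open>c\<close> these two points admit a
  t-move.\<close>

lemma move_vertex:
  assumes M: "DC M" and i: "impurity M x c" and b: "b \<in> tree_mids F M" "E1adj x b" "E1adj c b"
  shows "\<exists>M'. tmove M M' \<and> impurity M' (opp b x) c"
proof -
  have W: "x \<in> W0" "c \<in> W1" "{x,c} \<in> M" using i unfolding impurity_def by blast+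
  have bb: "black b" using b(1) E_black unfolding tree_mids_def by blast
  obtain y where y: "y \<in> VH F" "E1adj y b" "{y,b} \<in> M" using tree_edge[OF M b(1)] by blast
  have yW: "y \<in> W0" using y VH_W0 by blast
  have "y \<noteq> x"
  proof
    assume "y = x"
    then have "b = c" using covering_unique[OF M W(3)] y(3) by blast
    then show False using bb W1_white W(2) unfolding black_def by blast
  qed
  moreover have "y = x \<or> y = opp b x"
    using E1adj_cases[OF _ _ b(2) y(2)] W(1) yW unfolding W0_lat by blast
  ultimately have yo: "y = opp b x" by blast
  have "E2adj y c" using corner_E2adj[OF W(2) yW corner_mid[OF W(2) yW b(3) y(2)]] .
  then have adj: "E2adj x c" "E2adj c y" "E1adj y b" "E1adj b x"
    using impurity_adj[OF M i] y(2) b(2) E1adj_sym E2adj_sym by blast+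
  define M' where "M' = (M - {{x,c},{y,b}}) \<union> {{c,y},{b,x}}"
  have "tmove M M'" unfolding tmove_def using adj W(3) y(3) M'_def by blast
  moreover have "impurity M' y c" unfolding impurity_def M'_def using yW W(2) by (simp add: insert_commute)
  ultimately show ?thesis unfolding yo by blast
qed

text \<open>Dually, \<open>c\<close> is taken, so the non-tree midpoint \<open>b\<close> is matched
  with \<open>opp b c\<close>. In particular that point belongs to \<open>G\<close>: the impurity is
  never pushed out across a boundary edge.\<close>

lemma move_face:
  assumes M: "DC M" and i: "impurity M x c" and b: "b \<in> mids F" "b \<notin> tree_mids F M" "E1adj x b" "E1adj c b"
  shows "opp b c \<in> R \<and> (\<exists>M'. tmove M M' \<and> impurity M' x (opp b c))"
proof -
  have W: "x \<in> W0" "c \<in> W1" "{c,x} \<in> M" using i unfolding impurity_def by (simp_all add: insert_commute)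
  obtain y where y: "y \<in> R" "E1adj y b" "{y,b} \<in> M" using cotree_edge[OF M b(1,2)] by blast
  have yW: "y \<in> W1" using y R_W1 by blast
  have "y \<noteq> c"
  proof
    assume "y = c"
    then have "b = x" using covering_unique[OF M W(3)] y(3) by blast
    then show False using E_black[OF b(1)] W0_white W(1) unfolding black_def by blast
  qed
  moreover have "y = c \<or> y = opp b c"
    using E1adj_cases[OF _ _ b(4) y(2)] W(2) yW unfolding W1_lat by blast
  ultimately have yo: "y = opp b c" by blast
  have "E2adj x y" using corner_E2adj[OF yW W(1) corner_mid[OF yW W(1) y(2) b(3)]] .
  then have adj: "E2adj c x" "E2adj x y" "E1adj y b" "E1adj b c"
    using impurity_adj[OF M i] y(2) b(4) E1adj_sym E2adj_sym by blast+
  define M' where "M' = (M - {{c,x},{y,b}}) \<union> {{x,y},{b,c}}"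
  have "tmove M M'" unfolding tmove_def using adj W(3) y(3) M'_def by blast
  moreover have "impurity M' x y" unfolding impurity_def M'_def using yW W(1) by simp
  ultimately show ?thesis using y(1) unfolding yo by blast
qed

text \<open>\<open>K x c\<close> says that the impurity can be moved to \<open>{x, c}\<close>. Moves follow the contour of the tree, so the
  edges not in the tree across which \<open>K\<close> changes form an even subgraph of the dual tree and there are none.
  Hence \<open>K\<close> does not depend on the corner of a face of \<open>F\<close>.\<close>
lemma reach_e1:
  assumes M: "DC M"
  shows "\<exists>M'. t_equiv M M' \<and> {f,v} \<in> M'"
proof -
  let ?T = "tree_mids F M"
  define K where "K x c \<longleftrightarrow> (\<exists>M'. t_equiv M M' \<and> impurity M' x c)" for x c
  have t_step: "t_equiv M M''" if "t_equiv M M'" "tmove M' M''" for M' M''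
    using that unfolding t_equiv_def by (rule rtranclp.rtrancl_into_rtrancl)
  have KV: "x \<in> VH F \<and> c \<in> R \<and> x \<in> VH {c} \<and> x \<in> W0 \<and> c \<in> W1" if Kx: "K x c" for x c
  proof -
    obtain M' where "t_equiv M M'" "impurity M' x c" using Kx unfolding K_def by blast
    then have "E2adj x c \<and> x \<in> VH F \<and> c \<in> R" using t_equiv_dimer[OF M] impurity_adj by blast
    then show ?thesis using E2adj_corner VH_W0 R_W1 by blast
  qed
  have K1: "K (opp b x) c" if Kx: "K x c" and b: "b \<in> ?T" "E1adj x b" "E1adj c b" for x c b
  proof -
    obtain M' where M': "t_equiv M M'" "impurity M' x c" using Kx unfolding K_def by blast
    then have D: "DC M'" "b \<in> tree_mids F M'" using t_equiv_dimer[OF M] b(1) by blast+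
    obtain M'' where "tmove M' M''" "impurity M'' (opp b x) c"
      using move_vertex[OF D(1) M'(2) D(2) b(2,3)] by blast
    then show ?thesis using t_step M'(1) unfolding K_def by blast
  qed
  have K2: "opp b c \<in> R \<and> K x (opp b c)"
    if Kx: "K x c" and b: "b \<in> mids F" "b \<notin> ?T" "E1adj x b" "E1adj c b" for x c b
  proof -
    obtain M' where M': "t_equiv M M'" "impurity M' x c" using Kx unfolding K_def by blast
    then have D: "DC M'" "b \<notin> tree_mids F M'" using t_equiv_dimer[OF M] b(2) by blast+
    then have "opp b c \<in> R \<and> (\<exists>M''. tmove M' M'' \<and> impurity M'' x (opp b c))"
      using move_face[OF D(1) M'(2) b(1) D(2) b(3,4)] by blast
    then show ?thesis using t_step M'(1) unfolding K_def by blast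
  qed
  have K2_iff: "K x c \<longleftrightarrow> K x (opp b c)"
    if b: "b \<in> mids F" "b \<notin> ?T" "E1adj x b" "E1adj c b" for x c b
    using K2[OF _ b] K2[of x "opp b c" b] b by auto
  define Z where "Z = {b \<in> mids F - ?T. \<exists>x c. c \<in> F \<and> E1adj c b \<and> E1adj x b \<and> K x c \<and> \<not> K (opp b x) c}"
  \<comment> \<open>Membership in \<open>Z\<close> can be tested at either end and from any adjacent
    face in \<open>F\<close>: \<open>K\<close> is carried across a non-tree edge and does not change
    along a tree edge.\<close>
  have change: "b \<in> Z \<longleftrightarrow> K x c \<noteq> K (opp b x) c"
    if c: "c \<in> F" "E1adj c b" and x: "x \<in> W0" "E1adj x b" for b c x
  proof (cases "b \<in> ?T")
    case True
    then have "K x c = K (opp b x) c" using K1[of x c b] K1[of "opp b x" c b] c x by auto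
    then show ?thesis using True unfolding Z_def by blast
  next
    case False
    have bE: "b \<in> mids F" using c mids_iff by blast
    show ?thesis
    proof
      assume "b \<in> Z"
      then obtain x' c' where w: "c' \<in> F" "E1adj c' b" "E1adj x' b" "K x' c'" "\<not> K (opp b x') c'"
        unfolding Z_def by blast
      have "c' = c \<or> c' = opp b c"
        using E1adj_cases[OF _ _ c(2) w(2)] c(1) w(1) FW1 unfolding W1_lat by blast
      then have "K x' c" "\<not> K (opp b x') c"
        using w K2_iff[OF bE False w(3) c(2)] K2_iff[OF bE False _ c(2), of "opp b x'"] by auto
      moreover have "x' = x \<or> x' = opp b x"
        using E1adj_cases[OF _ _ x(2) w(3)] x(1) KV[OF w(4)] unfolding W0_lat by blast
      ultimately show "K x c \<noteq> K (opp b x) c" by auto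
    next
      assume "K x c \<noteq> K (opp b x) c"
      then obtain x' where x': "E1adj x' b" "K x' c" "\<not> K (opp b x') c"
        using x(2) E1adj_opp[of b x] opp_opp[of b x] by metis
      have "b \<in> mids F - ?T" using bE False by blast
      moreover have "\<exists>x c. c \<in> F \<and> E1adj c b \<and> E1adj x b \<and> K x c \<and> \<not> K (opp b x) c"
        using c x' by (intro exI[of _ x'] exI[of _ c]) simp
      ultimately show "b \<in> Z" unfolding Z_def by simp
    qed
  qed
  have ZE: "Z \<subseteq> mids F - ?T" unfolding Z_def by blast
  have ev: "even_at Z c" if cW: "c \<in> W1" and cf: "c \<noteq> f" for c
  proof (cases "c \<in> F")
    case True
    obtain p q where c: "c = (p,q)" by force
    have o: "odd p" "odd q" using cW c by (auto simp: W1_def)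
    have "(p+1,q) \<in> Z \<longleftrightarrow> K (p+1,q+1) c \<noteq> K (p+1,q-1) c"
      using change[OF True, of "(p+1,q)" "(p+1,q+1)"] o by (simp add: c E1adj_def opp_def W0_def)
    moreover have "(p-1,q) \<in> Z \<longleftrightarrow> K (p-1,q+1) c \<noteq> K (p-1,q-1) c"
      using change[OF True, of "(p-1,q)" "(p-1,q+1)"] o by (simp add: c E1adj_def opp_def W0_def)
    moreover have "(p,q+1) \<in> Z \<longleftrightarrow> K (p+1,q+1) c \<noteq> K (p-1,q+1) c"
      using change[OF True, of "(p,q+1)" "(p+1,q+1)"] o by (simp add: c E1adj_def opp_def W0_def)
    moreover have "(p,q-1) \<in> Z \<longleftrightarrow> K (p+1,q-1) c \<noteq> K (p-1,q-1) c"
      using change[OF True, of "(p,q-1)" "(p+1,q-1)"] o by (simp add: c E1adj_def opp_def W0_def)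
    ultimately show ?thesis unfolding c even_at_iff by argo
  next
    case False
    \<comment> \<open>An edge of \<open>Z\<close> has a reached face on one side, so the face on its
      other side is in \<open>F\<close> or is \<open>f\<close>.\<close>
    have "\<not> E1adj c b" if bZ: "b \<in> Z" for b
    proof
      assume a: "E1adj c b"
      obtain x' c' where w: "c' \<in> F" "E1adj c' b" "E1adj x' b" "K x' c'" using bZ unfolding Z_def by blast
      have "opp b c' \<in> R" using K2[OF w(4) _ _ w(3,2)] ZE bZ by blast
      moreover have "c = c' \<or> c = opp b c'"
        using E1adj_cases[OF _ _ w(2) a] cW w(1) FW1 unfolding W1_lat by blast
      ultimately show False using False cf w(1) by blast
    qed
    then have "{b \<in> Z. E1adj c b} = {}" by blast
    then show ?thesis unfolding even_at_def by (simp only: card.empty dvd_0_right)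
  qed
  have finZ: "finite Z" using ZE finite_mids[OF finF] finite_subset by blast
  have blZ: "\<And>b. b \<in> Z \<Longrightarrow> black b" using ZE E_black by blast
  have "even_at Z f"
    using even_at_handshake[OF finZ blZ, of f False] ev fW1 unfolding W1_lat by blast
  then have "Z = {}" using no_even_cotree[OF M ZE] ev by blast
  then have const: "K (opp b x) c" if "c \<in> F" "E1adj c b" "E1adj x b" "K x c" for b c x
    using change[OF that(1,2) _ that(3)] KV[OF that(4)] that(4) by blast
  have around: "K y c" if c: "c \<in> F" and y: "y \<in> VH {c}" and x: "K x c" for x y c
    by (rule corners_invariant[of x c y "\<lambda>z. K z c"]) (use KV[OF x] y x const[OF c] in blast)+
  obtain x0 c0 where i: "impurity M x0 c0" using ex1_impurity[OF M] by blast
  have K0: "K x0 c0" unfolding K_def t_equiv_def using i by blast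
  have "\<exists>x. K x f"
  proof (rule ccontr)
    assume n: "\<nexists>x. K x f"
    \<comment> \<open>If \<open>f\<close> is never reached, a reached face leads to a reached face
      of \<open>F\<close> across each non-tree side. The boundary of \<open>S\<close> then lies in
      the tree, which contains no nonempty even set.\<close>
    define S where "S = {c \<in> F. \<exists>x. K x c}"
    have Sl: "S \<subseteq> lat False" using FW1 W1_lat unfolding S_def by blast
    have "bnd S \<subseteq> ?T"
    proof
      fix b assume "b \<in> bnd S"
      then obtain c where c: "c \<in> S" "E1adj c b" "opp b c \<notin> S" unfolding bnd_def by blast
      then have cF: "c \<in> F" and cW: "c \<in> W1" using FW1 unfolding S_def by blast+
      have bE: "b \<in> mids F" using c cF mids_iff by blast
      obtain x where x: "x \<in> W0" "E1adj x b" using black_nbr_ex[OF E_black[OF bE]] W0_lat by metis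
      obtain x' where "K x' c" using c unfolding S_def by blast
      then have Kx: "K x c" using around[OF cF corner_mid[OF cW x(1) c(2) x(2)]] by blast
      show "b \<in> ?T"
      proof (rule ccontr)
        assume "b \<notin> ?T"
        then have "opp b c \<in> R" "K x (opp b c)" using K2[OF Kx bE _ x(2) c(2)] by blast+
        then have "opp b c \<in> S" using n unfolding S_def by blast
        then show False using c(3) by blast
      qed
    qed
    moreover have "\<And>w. w \<in> W0 \<Longrightarrow> even_at (bnd S) w" using even_at_bnd[OF Sl] W0_lat by simp
    ultimately have "bnd S = {}" by (rule no_even_tree[OF M])
    moreover have "finite S" using finF unfolding S_def by simp
    ultimately have "S = {}" using bnd_empty_imp[OF Sl] by blast
    moreover have "c0 \<in> S"
    proof -
      have "c0 \<in> R" using KV[OF K0] by blast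
      then show ?thesis using K0 n unfolding S_def by blast
    qed
    ultimately show False by blast
  qed
  then obtain x where x: "K x f" by blast
  have "K v f"
  proof (rule corners_linked[OF finF FW1 F_ne fW1 fF conn conn_insert nh nh_insert, of "\<lambda>x. K x f" x v])
    show "K x f" "x \<in> VH F" "x \<in> VH {f}" "v \<in> VH F" "v \<in> VH {f}" using x KV[OF x] vF vf by blast+
    fix b z assume z: "K z f" and b: "b \<in> mids F" "E1adj f b" "E1adj z b"
    show "K (opp b z) f"
    proof (cases "b \<in> ?T")
      case True
      then show ?thesis using K1 z b by blast
    next
      case False
      \<comment> \<open>A non-tree side of \<open>f\<close> is passed in three stages: the impurity
        crosses to the face of \<open>F\<close> behind it, goes to the other end of \<open>b\<close>
        there, and crosses back.\<close>
      then have "opp b f \<in> R" "K z (opp b f)" using K2[OF z b(1) _ b(3,2)] by blast+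
      moreover have "opp b f \<noteq> f" using opp_neq[OF b(2)] .
      ultimately have "K (opp b z) (opp b f)" using const[of "opp b f" b z] b by simp
      then show ?thesis using K2_iff[OF b(1) False, of "opp b z" f] b by simp
    qed
  qed
  then show ?thesis unfolding K_def impurity_root by blast
qed

text \<open>Where the coverings disagree at a vertex, its edge in \<open>M2\<close> is used by
  \<open>M1\<close> from the far end, so they disagree there too. Disagreement is thus closed under
  the arrows of \<open>M2\<close>.\<close>

lemma covering_determined_aux:
  assumes M1: "DC M1" and M2: "DC M2" and e: "{f,v} \<in> M1" "{f,v} \<in> M2"
    and T: "tree_mids F M1 = tree_mids F M2"
  shows "M1 \<subseteq> M2"
proof -
  have i1: "impurity M1 v f" and i2: "impurity M2 v f" using e impurity_root by blast+
  have verts: "{x,b} \<in> M2" if x: "x \<in> VH F" "x \<noteq> v" "{x,b} \<in> M1" for x b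
  proof (rule ccontr)
    assume n: "{x,b} \<notin> M2"
    define A where "A = {x \<in> VH F. x \<noteq> v \<and> (\<exists>b. {x,b} \<in> M1 \<and> {x,b} \<notin> M2)}"
    show False
    proof (rule no_closed[OF M2 i2, of A])
      show "A \<subseteq> VH F" "v \<notin> A" "A \<noteq> {}" using x n unfolding A_def by blast+
      fix y b2 assume y: "y \<in> A" "{y,b2} \<in> M2"
      then obtain b1 where b1: "y \<in> VH F" "y \<noteq> v" "{y,b1} \<in> M1" "{y,b1} \<notin> M2" unfolding A_def by blast
      obtain b' where b': "b' \<in> tree_mids F M2" "E1adj y b'" "{y,b'} \<in> M2"
        using vertex_partner[OF M2 i2 b1(1,2)] by blast
      have "b' = b2" using covering_unique[OF M2 b'(3) y(2)] .
      then have b2: "b2 \<in> tree_mids F M1" "E1adj y b2" using b' T by blast+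
      obtain z where z: "z \<in> VH F" "E1adj z b2" "{z,b2} \<in> M1" using tree_edge[OF M1 b2(1)] by blast
      have "z \<noteq> y" using covering_unique[OF M1 b1(3)] b1(4) y(2) z(3) by blast
      moreover have "z = y \<or> z = opp b2 y"
        using E1adj_cases[OF _ _ b2(2) z(2)] b1(1) z(1) VH_W0 unfolding W0_lat by blast
      moreover have "z \<noteq> v"
      proof
        assume "z = v"
        then have "b2 = f" using covering_unique[OF M1 z(3)] i1 unfolding impurity_def by blast
        then show False using b2(1) E_black W1_white root_W unfolding tree_mids_def black_def by blast
      qed
      moreover have "{z,b2} \<notin> M2" using covering_unique'[OF M2 y(2)] \<open>z \<noteq> y\<close> by blast
      ultimately show "opp b2 y \<in> A" using z unfolding A_def by blast
    qed
  qed
  \<comment> \<open>The same propagation among faces; here a directed cycle of arrows is a nonempty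
    even set of non-tree edges in the dual.\<close>
  have faces: "{c,b} \<in> M2" if c: "c \<in> R" "c \<noteq> f" "{c,b} \<in> M1" for c b
  proof (rule ccontr)
    assume n: "{c,b} \<notin> M2"
    define A where "A = {c \<in> R. c \<noteq> f \<and> (\<exists>b. {c,b} \<in> M1 \<and> {c,b} \<notin> M2)}"
    have "\<forall>y\<in>A. \<exists>b. b \<in> mids F \<and> b \<notin> tree_mids F M2 \<and> E1adj y b \<and> {y,b} \<in> M2"
    proof
      fix y assume "y \<in> A"
      then have "y \<in> R" "y \<noteq> f" unfolding A_def by blast+
      then show "\<exists>b. b \<in> mids F \<and> b \<notin> tree_mids F M2 \<and> E1adj y b \<and> {y,b} \<in> M2"
        using face_partner[OF M2 i2] by blast
    qed
    then obtain \<gamma> where \<gamma>: "\<And>y. y \<in> A \<Longrightarrow> \<gamma> y \<in> mids F \<and> \<gamma> y \<notin> tree_mids F M2 \<and> E1adj y (\<gamma> y) \<and> {y, \<gamma> y} \<in> M2"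
      by metis
    have "opp (\<gamma> y) y \<in> A" if y: "y \<in> A" for y
    proof -
      obtain b1 where b1: "y \<in> R" "y \<noteq> f" "{y,b1} \<in> M1" "{y,b1} \<notin> M2" using y unfolding A_def by blast
      have g: "\<gamma> y \<in> mids F" "\<gamma> y \<notin> tree_mids F M1" "E1adj y (\<gamma> y)" "{y, \<gamma> y} \<in> M2" using \<gamma>[OF y] T by blast+
      obtain z where z: "z \<in> R" "E1adj z (\<gamma> y)" "{z, \<gamma> y} \<in> M1" using cotree_edge[OF M1 g(1,2)] by blast
      have "z \<noteq> y" using covering_unique[OF M1 b1(3)] b1(4) g(4) z(3) by blast
      moreover have "z = y \<or> z = opp (\<gamma> y) y"
        using E1adj_cases[OF _ _ g(3) z(2)] b1(1) z(1) R_W1 unfolding W1_lat by blast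
      moreover have "z \<noteq> f"
      proof
        assume "z = f"
        then have "\<gamma> y = v" using covering_unique[OF M1 z(3)] e(1) by blast
        then show False using g(1) E_black W0_white root_W unfolding black_def by blast
      qed
      moreover have "{z, \<gamma> y} \<notin> M2" using covering_unique'[OF M2 g(4)] \<open>z \<noteq> y\<close> by blast
      ultimately show ?thesis using z unfolding A_def by blast
    qed
    moreover have "inj_on \<gamma> A"
    proof (rule inj_onI)
      fix x y assume "x \<in> A" "y \<in> A" "\<gamma> x = \<gamma> y"
      then show "x = y" using \<gamma> covering_unique'[OF M2, of x "\<gamma> x" y] by metis
    qed
    moreover have "finite A" using finF unfolding A_def by simp
    moreover have "A \<noteq> {}" using c n unfolding A_def by blast
    moreover have "A \<subseteq> lat False" using R_W1 W1_lat unfolding A_def by blast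
    moreover have "\<And>y. y \<in> A \<Longrightarrow> E1adj y (\<gamma> y)" using \<gamma> by blast
    ultimately obtain C where C: "C \<subseteq> A" "C \<noteq> {}" "\<And>w. w \<in> lat False \<Longrightarrow> even_at (\<gamma> ` C) w"
      using closed_cycle[of A False \<gamma>] by metis
    have "\<gamma> ` C \<subseteq> mids F - tree_mids F M2" using C(1) \<gamma> by blast
    then have "\<gamma> ` C = {}" using no_even_cotree[OF M2] C(3) W1_lat by metis
    then show False using C(2) by blast
  qed
  show ?thesis
  proof
    fix e assume eM: "e \<in> M1"
    then obtain a b where ab: "e = {a,b}" using M1 unfolding dimer_covering_def induced_edges_def by blast
    have aux: "{x,y} \<in> M2" if xy: "{x,y} \<in> M1" "white x" for x y
    proof (cases "x = v \<or> x = f")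
      case True
      have "{v,f} \<in> M1" "{v,f} \<in> M2" using e by (simp_all add: insert_commute)
      then show ?thesis using True covering_unique[OF M1 xy(1)] e by blast
    next
      case False
      then show ?thesis
        using verts[OF _ _ xy(1)] faces[OF _ _ xy(1)] white_cases[OF xy(2)] edge_props(1)[OF M1 xy(1)] VG_W0 VG_W1
        by blast
    qed
    have "white a \<or> white b"
      using edge_props(3)[OF M1, of a b] eM ab E1adj_white_black gamma_adj_black unfolding black_def by blast
    then show "e \<in> M2" using aux[of a b] aux[of b a] eM ab by (auto simp: insert_commute)
  qed
qed

lemma covering_determined:
  assumes "DC M1" "DC M2" "{f,v} \<in> M1" "{f,v} \<in> M2" "tree_mids F M1 = tree_mids F M2"
  shows "M1 = M2"
  using covering_determined_aux[of M1 M2] covering_determined_aux[of M2 M1] assms by simp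

text \<open>The inverse construction: each vertex except \<open>v\<close> takes a tree edge that
  brings it closer to \<open>v\<close>, each face of \<open>F\<close> a non-tree edge that brings it
  closer to the outside, and \<open>f\<close> is matched with \<open>v\<close>.\<close>

lemma covering_of_tree:
  assumes T: "spanning_tree (VH F) (EH F) T"
  shows "\<exists>M. DC M \<and> {f,v} \<in> M \<and> ed ` tree_mids F M = T"
proof -
  let ?E = "mids F"
  define tb where "tb = {b \<in> ?E. ed b \<in> T}"
  have "T \<subseteq> ed ` ?E" using T EH_eq[OF FW1] unfolding spanning_tree_def by simp
  then have TE: "T = ed ` tb" unfolding tb_def by auto
  have step: "hstep tb x y" if xy: "{x,y} \<in> T" for x y
  proof -
    obtain b where b: "b \<in> tb" "ed b = {x,y}" using xy TE by (metis imageE)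
    then have x: "x \<in> W0" "E1adj x b" unfolding ed_def by blast+
    have "{x,y} = {x, opp b x}" using ed_eq[OF x] b(2) by simp
    then have "y = opp b x" by (metis doubleton_eq_iff)
    then show ?thesis using b x unfolding hstep_def by blast
  qed
  have "(hstep tb)\<^sup>*\<^sup>* x y" if "reach T x y" for x y
    using that unfolding reach_def
    by (induction rule: rtranclp_induct) (auto intro: rtranclp.rtrancl_into_rtrancl step)
  then have "\<exists>y. y \<notin> VH F - {v} \<and> (hstep tb)\<^sup>*\<^sup>* x y" if "x \<in> VH F - {v}" for x
    using that T vF unfolding spanning_tree_def by (intro exI[of _ v]) blast
  then obtain d1 :: "pt \<Rightarrow> nat" where d1: "\<And>x. x \<in> VH F - {v} \<Longrightarrow> \<exists>z. hstep tb x z \<and> (z \<in> VH F - {v} \<longrightarrow> d1 z < d1 x)"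
    using descent[of "VH F - {v}" "hstep tb"] by blast
  have "\<forall>x\<in>VH F - {v}. \<exists>b. b \<in> tb \<and> E1adj x b \<and> (opp b x \<in> VH F - {v} \<longrightarrow> d1 (opp b x) < d1 x)"
    using d1 unfolding hstep_def by blast
  then obtain \<beta> where \<beta>: "\<And>x. x \<in> VH F - {v} \<Longrightarrow> \<beta> x \<in> tb \<and> E1adj x (\<beta> x) \<and> (opp (\<beta> x) x \<in> VH F - {v} \<longrightarrow> d1 (opp (\<beta> x) x) < d1 x)"
    by metis
  \<comment> \<open>Any point outside \<open>F\<close> may serve as target, since all of them stand
    for the outer face. A set of faces that cannot get out has its boundary in the tree, and this
    boundary contains a cycle.\<close>
  have "\<exists>y. y \<notin> F \<and> (hstep (?E - tb))\<^sup>*\<^sup>* c y" if c: "c \<in> F" for c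
  proof (rule ccontr)
    assume n: "\<not> ?thesis"
    define S where "S = {y. (hstep (?E - tb))\<^sup>*\<^sup>* c y}"
    have SF: "S \<subseteq> F" using n unfolding S_def by blast
    have Sl: "S \<subseteq> lat False" using SF FW1 W1_lat by blast
    have finS: "finite S" using SF finF finite_subset by blast
    have sub: "bnd S \<subseteq> tb"
    proof
      fix b assume "b \<in> bnd S"
      then obtain w where w: "w \<in> S" "E1adj w b" "opp b w \<notin> S" unfolding bnd_def by blast
      have "b \<in> ?E" using w SF mids_iff by blast
      moreover have "\<not> hstep (?E - tb) w (opp b w)"
        using w unfolding S_def by (metis mem_Collect_eq rtranclp.rtrancl_into_rtrancl)
      ultimately show "b \<in> tb" using w(2) unfolding hstep_def by blast
    qed
    have "bnd S \<noteq> {}"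
    proof
      assume "bnd S = {}"
      then have "S = {}" using bnd_empty_imp[OF Sl finS] by blast
      then show False unfolding S_def by blast
    qed
    moreover have "\<And>b. b \<in> bnd S \<Longrightarrow> black b" using sub E_black unfolding tb_def by blast
    moreover have "\<And>w. w \<in> W0 \<Longrightarrow> even_at (bnd S) w" using even_at_bnd[OF Sl] W0_lat by simp
    ultimately have "has_cycle (ed ` bnd S)" using even_imp_has_cycle[OF finite_bnd[OF finS]] by blast
    then have "has_cycle T" using sub TE unfolding has_cycle_def by blast
    then show False using T unfolding spanning_tree_def by blast
  qed
  then obtain d2 :: "pt \<Rightarrow> nat" where d2: "\<And>c. c \<in> F \<Longrightarrow> \<exists>z. hstep (?E - tb) c z \<and> (z \<in> F \<longrightarrow> d2 z < d2 c)"
    using descent[of F "hstep (?E - tb)"] by blast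
  have "\<forall>c\<in>F. \<exists>b. b \<in> ?E - tb \<and> E1adj c b \<and> (opp b c \<in> F \<longrightarrow> d2 (opp b c) < d2 c)"
    using d2 unfolding hstep_def by blast
  then obtain \<gamma> where \<gamma>: "\<And>c. c \<in> F \<Longrightarrow> \<gamma> c \<in> ?E - tb \<and> E1adj c (\<gamma> c) \<and> (opp (\<gamma> c) c \<in> F \<longrightarrow> d2 (opp (\<gamma> c) c) < d2 c)"
    by metis
  \<comment> \<open>Two points choosing the same edge are its two ends, and the distance would have
    to drop in both directions.\<close>
  have inj_desc: "inj_on \<delta> A" if A: "A \<subseteq> lat P"
    and \<delta>: "\<And>x. x \<in> A \<Longrightarrow> E1adj x (\<delta> x) \<and> (opp (\<delta> x) x \<in> A \<longrightarrow> d (opp (\<delta> x) x) < d x)"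
    for A P \<delta> and d :: "pt \<Rightarrow> nat"
  proof (rule inj_onI, rule ccontr)
    fix x y assume x: "x \<in> A" and y: "y \<in> A" and eq: "\<delta> x = \<delta> y" and ne: "x \<noteq> y"
    have "y = x \<or> y = opp (\<delta> x) x" using E1adj_cases[of x P y "\<delta> x"] A x y \<delta>[OF x] \<delta>[OF y] eq by auto
    then have yo: "y = opp (\<delta> x) x" using ne by blast
    then have xo: "opp (\<delta> y) y = x" unfolding eq[symmetric] using yo by simp
    have "d y < d x" using \<delta>[OF x] y unfolding yo[symmetric] by blast
    moreover have "d x < d y" using \<delta>[OF y] x unfolding xo by blast
    ultimately show False by simp
  qed
  define D where "D = (VH F - {v}) \<union> F"
  define q where "q w = (if w \<in> VH F then \<beta> w else \<gamma> w)" for w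
  have disj: "w \<notin> VH F" if "w \<in> F" for w using that FW1 VH_W0 W0_W1_disjoint by blast
  have q1: "q w = \<beta> w" "q w \<in> tb" "E1adj w (q w)" if "w \<in> VH F - {v}" for w
    using that \<beta>[OF that] unfolding q_def by auto
  have q2: "q w = \<gamma> w" "q w \<in> ?E - tb" "E1adj w (q w)" if "w \<in> F" for w
    using disj[OF that] \<gamma>[OF that] unfolding q_def by auto
  have tbE: "tb \<subseteq> ?E" unfolding tb_def by blast
  have qE: "q w \<in> ?E" "E1adj w (q w)" if "w \<in> D" for w
    using that q1[of w] q2[of w] tbE unfolding D_def by blast+
  have inj: "inj_on q D"
  proof -
    have "inj_on \<beta> (VH F - {v})"
      by (rule inj_desc[where P = True and d = d1]) (use VH_W0 W0_lat \<beta> in blast)+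
    then have "inj_on q (VH F - {v})" using inj_on_cong[of "VH F - {v}" q \<beta>] q1(1) by blast
    moreover have "inj_on \<gamma> F"
      by (rule inj_desc[where P = False and d = d2]) (use FW1 W1_lat \<gamma> in blast)+
    then have "inj_on q F" using inj_on_cong[of F q \<gamma>] q2(1) by blast
    moreover have "q x \<noteq> q y" if "x \<in> VH F - {v}" "y \<in> F" for x y
      using q1(2)[OF that(1)] q2(2)[OF that(2)] by force
    ultimately show ?thesis unfolding D_def inj_on_def by (metis Un_iff)
  qed
  \<comment> \<open>By Euler's formula \<open>D\<close> has as many points as there are midpoints,
    so the injection leaves none over.\<close>
  have qD: "q ` D = ?E"
  proof (rule card_seteq[OF finite_mids[OF finF]])
    show "q ` D \<subseteq> ?E" using qE by blast
    have "card D = card (VH F - {v}) + card F"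
      unfolding D_def using finite_VH[OF finF] finF disj by (intro card_Un_disjoint) auto
    also have "\<dots> = card ?E"
      using euler[OF finF FW1 F_ne conn nh] vF finite_VH[OF finF] card_gt_0_iff[of "VH F"] by auto
    finally show "card ?E \<le> card (q ` D)" using card_image[OF inj] by simp
  qed
  have Dw: "white w" "w \<noteq> v" "w \<noteq> f" if "w \<in> D" for w
    using that VH_W0 FW1 W0_white W1_white fF root_W W0_W1_disjoint unfolding D_def by blast+
  have Eb: "\<not> white b" if "b \<in> ?E" for b using that E_black unfolding black_def by blast
  define M where "M = (\<lambda>w. {w, q w}) ` D \<union> {{f,v}}"
  have fvw: "white f" "white v" using root_W W0_white W1_white by blast+
  have "DC M"
    unfolding dimer_covering_def
  proof
    show "M \<subseteq> induced_edges (VG F f)"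
    proof
      fix e assume "e \<in> M"
      then consider w where "w \<in> D" "e = {w, q w}" | "e = {f,v}" unfolding M_def by blast
      then show "e \<in> induced_edges (VG F f)"
      proof cases
        case 1
        then have "w \<in> VG F f" "q w \<in> VG F f" "gamma_adj w (q w)"
          using qE[OF 1(1)] unfolding VG_iff gamma_adj_def D_def by blast+
        then show ?thesis unfolding induced_edges_def 1(2) by blast
      next
        case 2
        have "gamma_adj f v" using corner_E2adj[OF fW1 root_W(1) vf] E2adj_sym unfolding gamma_adj_def by blast
        moreover have "f \<in> VG F f" "v \<in> VG F f" using vF unfolding VG_iff by blast+
        ultimately show ?thesis unfolding induced_edges_def 2 by blast
      qed
    qed
    show "\<forall>x\<in>VG F f. \<exists>!e. e \<in> M \<and> x \<in> e"
    proof
      fix x assume "x \<in> VG F f"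
      then consider "x \<in> D" | "x = v \<or> x = f" | "x \<in> ?E" unfolding VG_iff D_def by blast
      then show "\<exists>!e. e \<in> M \<and> x \<in> e"
      proof cases
        case 1
        show ?thesis
        proof (rule ex1I[of _ "{x, q x}"])
          show "{x, q x} \<in> M \<and> x \<in> {x, q x}" unfolding M_def using 1 by blast
          fix e assume e: "e \<in> M \<and> x \<in> e"
          then obtain w where w: "w \<in> D" "e = {w, q w}" using Dw[OF 1] unfolding M_def by blast
          have "x \<noteq> q w" using Dw(1)[OF 1] Eb qE(1)[OF w(1)] by blast
          then show "e = {x, q x}" using e w by blast
        qed
      next
        case 2
        show ?thesis
        proof (rule ex1I[of _ "{f,v}"])
          show "{f,v} \<in> M \<and> x \<in> {f,v}" unfolding M_def using 2 by blast
          fix e assume e: "e \<in> M \<and> x \<in> e"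
          have "x \<notin> {w, q w}" if "w \<in> D" for w using Dw[OF that] Eb qE(1)[OF that] 2 fvw by blast
          then show "e = {f,v}" using e unfolding M_def by blast
        qed
      next
        case 3
        then obtain w where w: "w \<in> D" "x = q w" using qD by blast
        show ?thesis
        proof (rule ex1I[of _ "{w, q w}"])
          show "{w, q w} \<in> M \<and> x \<in> {w, q w}" unfolding M_def using w by blast
          fix e assume e: "e \<in> M \<and> x \<in> e"
          have "x \<noteq> f" "x \<noteq> v" using Eb[OF 3] fvw by blast+
          then obtain w' where w': "w' \<in> D" "e = {w', q w'}" using e unfolding M_def by blast
          have "x \<noteq> w'" using Dw(1)[OF w'(1)] Eb[OF 3] by blast
          then have "q w' = q w" using e w' w by blast
          then show "e = {w, q w}" using inj w w' unfolding inj_on_def by blast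
        qed
      qed
    qed
  qed
  moreover have "tree_mids F M = tb"
  proof (intro equalityI subsetI)
    fix b assume "b \<in> tree_mids F M"
    then obtain x where x: "b \<in> ?E" "x \<in> W0" "{x,b} \<in> M" unfolding tree_mids_def by blast
    have "b \<noteq> f" "b \<noteq> v" using Eb[OF x(1)] fvw by blast+
    then have "{x,b} \<noteq> {f,v}" by blast
    then obtain w where w: "w \<in> D" "{x,b} = {w, q w}" using x(3) unfolding M_def by blast
    have "b \<noteq> w" using Dw(1)[OF w(1)] Eb[OF x(1)] by blast
    then have "x = w" "b = q w" using w(2) by (metis doubleton_eq_iff)+
    then have "w \<in> VH F - {v}" using w(1) x(2) FW1 W0_W1_disjoint unfolding D_def by blast
    then show "b \<in> tb" using q1(2) \<open>b = q w\<close> by blast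
  next
    fix b assume b: "b \<in> tb"
    then have bE: "b \<in> ?E" using tbE by blast
    then obtain w where w: "w \<in> D" "b = q w" using qD by blast
    have "w \<in> VH F - {v}" using w b q2(2) unfolding D_def by blast
    then have "w \<in> W0" using VH_W0 by blast
    moreover have "{w,b} \<in> M" unfolding M_def using w by blast
    ultimately show "b \<in> tree_mids F M" using bE unfolding tree_mids_def by blast
  qed
  moreover have "{f,v} \<in> M" unfolding M_def by blast
  ultimately show ?thesis using TE by blast
qed

lemma spanning_tree_of_covering:
  assumes M: "DC M"
  shows "spanning_tree (VH F) (EH F) (ed ` tree_mids F M)"
  unfolding spanning_tree_def
proof (intro conjI ballI)
  show "ed ` tree_mids F M \<subseteq> EH F" unfolding EH_eq[OF FW1] tree_mids_def by blast
  show "\<not> has_cycle (ed ` tree_mids F M)" by (rule no_cycle[OF M])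
  fix x y assume x: "x \<in> VH F" and y: "y \<in> VH F"
  obtain x0 c0 where i: "impurity M x0 c0" using ex1_impurity[OF M] by blast
  have "(hstep (tree_mids F M))\<^sup>*\<^sup>* x y"
    using reach_root[OF M i x] reach_root[OF M i y] hstep_rtranclp_sym by (meson rtranclp_trans)
  then have "reach (ed ` tree_mids F M) x y \<and> y \<in> W0"
  proof (induction rule: rtranclp_induct)
    case base
    then show ?case using VH_W0[OF x] unfolding reach_def by blast
  next
    case (step y z)
    then obtain b where b: "b \<in> tree_mids F M" "E1adj y b" "z = opp b y" unfolding hstep_def by blast
    have "{y,z} = ed b" using ed_eq[of y b] b step by simp
    then have "{y,z} \<in> ed ` tree_mids F M" using b(1) by simp
    moreover have "z \<in> W0" using b(3) step opp_in_W0 by blast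
    ultimately show ?case
      using step unfolding reach_def by (meson rtranclp.rtrancl_into_rtrancl)
  qed
  then show "reach (ed ` tree_mids F M) x y" by blast
qed

text \<open>\<open>phi_map\<close> does not ask \<open>b\<close> to be black; with the only impurity
  \<open>{f,v}\<close> deleted, all remaining partners of vertices of \<open>H\<close> are
  midpoints.\<close>

lemma phi_map_eq:
  assumes M: "DC M" and e: "{f,v} \<in> M"
  shows "phi_map (VH F) (pi_map {f,v} M) = ed ` tree_mids F M"
    and "phi_map (VH F) (pi_map {f,v} M) = {{x, (2 * fst b - fst x, 2 * snd b - snd x)} | x b.
              x \<in> VH F \<and> black b \<and> {x, b} \<in> M - {{f,v}}}"
proof -
  have i: "impurity M v f" using e impurity_root by blast
  have bl: "black b" if x: "x \<in> VH F" and b: "{x,b} \<in> M - {{f,v}}" for x b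
  proof (rule ccontr)
    assume "\<not> black b"
    then have w: "white b" by (simp add: black_def)
    have "E2adj x b" using edge_props(3)[OF M, of x b] b gamma_adj_white w VH_W0[OF x] W0_white by blast
    then have "impurity M x b" using b VH_W0[OF x] E2adj_W0 unfolding impurity_def by blast
    then have "{x,b} = {f,v}" using impurity_unique[OF M i, of x b] by blast
    then show False using b by blast
  qed
  show "phi_map (VH F) (pi_map {f,v} M) = {{x, (2 * fst b - fst x, 2 * snd b - snd x)} | x b.
              x \<in> VH F \<and> black b \<and> {x, b} \<in> M - {{f,v}}}"
    unfolding phi_map_def pi_map_def using bl by blast
  show "phi_map (VH F) (pi_map {f,v} M) = ed ` tree_mids F M"
  proof (intro equalityI subsetI)
    fix t assume "t \<in> phi_map (VH F) (pi_map {f,v} M)"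
    then obtain x b where x: "x \<in> VH F" "{x,b} \<in> M - {{f,v}}" "t = {x, opp b x}"
      unfolding phi_map_def pi_map_def opp_def by blast
    then have xM: "{x,b} \<in> M" by blast
    have bb: "black b" using bl x by blast
    have "E1adj x b" using edge_props(3)[OF M xM] gamma_adj_black bb by blast
    then have "t = ed b" using ed_eq VH_W0[OF x(1)] x(3) by blast
    moreover have "b \<in> mids F" using VG_black edge_props(2)[OF M xM] bb by blast
    then have "b \<in> tree_mids F M" using xM VH_W0[OF x(1)] unfolding tree_mids_def by blast
    ultimately show "t \<in> ed ` tree_mids F M" by blast
  next
    fix t assume "t \<in> ed ` tree_mids F M"
    then obtain b where b: "b \<in> tree_mids F M" "t = ed b" by blast
    obtain x where x: "x \<in> VH F" "E1adj x b" "{x,b} \<in> M" using tree_edge[OF M b(1)] by blast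
    have t: "t = {x, opp b x}" using ed_eq VH_W0[OF x(1)] x(2) b(2) by blast
    have "black b" using b(1) E_black unfolding tree_mids_def by blast
    then have "b \<noteq> f" "b \<noteq> v" using root_W W0_white W1_white unfolding black_def by blast+
    then have "{x,b} \<noteq> {f,v}" by blast
    then show "t \<in> phi_map (VH F) (pi_map {f,v} M)"
      unfolding phi_map_def pi_map_def t opp_def using x by blast
  qed
qed

lemma tree_mids_inj:
  assumes "ed ` tree_mids F M1 = ed ` tree_mids F M2"
  shows "tree_mids F M1 = tree_mids F M2"
proof -
  have "inj_on ed (mids F)" by (rule inj_onI) (use ed_inj E_black in blast)
  moreover have "tree_mids F M1 \<subseteq> mids F" "tree_mids F M2 \<subseteq> mids F" unfolding tree_mids_def by blast+
  ultimately show ?thesis using assms inj_on_image_eq_iff by metis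
qed

end

section \<open>The bijection between classes of coverings and spanning trees\<close>

theorem mainTheorem7:
  fixes F :: "pt set" and fstar vstar :: pt
  assumes finF: "finite F"
    and FW1: "F \<subseteq> W1"
    and scF: "simply_connected (face_union F)"
    and fW1: "fstar \<in> W1"
    and fnotF: "fstar \<notin> F"
    and scdual: "simply_connected (lperp_complex (F \<union> {fstar}))"
    and vH: "vstar \<in> VH F"
    and vouter: "on_outer_face F vstar"
    and vdiag: "\<bar>fst vstar - fst fstar\<bar> = 1 \<and> \<bar>snd vstar - snd fstar\<bar> = 1"
    and normalG: "normal_set (VG F fstar)"
  defines "Ms \<equiv> {M. dimer_covering (VG F fstar) M}"
    and "Ts \<equiv> {T. spanning_tree (VH F) (EH F) T}"
    and "e1 \<equiv> {fstar, vstar}"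
    and "R \<equiv> {(M1, M2). dimer_covering (VG F fstar) M1 \<and> dimer_covering (VG F fstar) M2 \<and> t_equiv M1 M2}"
  shows "(\<forall>M\<in>Ms. \<exists>!M'. M' \<in> Ms \<and> t_equiv M' M \<and> e1 \<in> M')
    \<and> (\<forall>M'\<in>Ms. e1 \<in> M' \<longrightarrow> phi_map (VH F) (pi_map e1 M') =
          {{x, (2 * fst b - fst x, 2 * snd b - snd x)} | x b.
              x \<in> VH F \<and> black b \<and> {x, b} \<in> M' - {e1}})
    \<and> bij_betw (\<lambda>C. phi_map (VH F) (pi_map e1 (THE M'. M' \<in> C \<and> e1 \<in> M'))) (Ms // R) Ts"
proof -
  have vf: "vstar \<in> VH {fstar}" using vdiag by (simp add: VH_single_iff)
  have hF: "hconn F" by (rule hconn_if_connected[OF finF FW1 simply_connected_imp_connected[OF scF]])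
  have nhR: "no_holes (insert fstar F)" by (rule no_holes_insert[OF normalG finF FW1 fW1])
  interpret temperley F fstar vstar
    using finF FW1 fW1 fnotF vH vf hF nhR no_holes_if_insert[OF nhR not_all_neighbours[OF scF FW1 fW1 fnotF]]
      hconn_insert[OF hF vH vf]
    by unfold_locales
  have Ms: "M \<in> Ms \<longleftrightarrow> DC M" for M by (simp add: Ms_def)
  have uniq: "M1 = M2"
    if M: "DC M" and M1: "t_equiv M M1" "e1 \<in> M1" and M2: "t_equiv M M2" "e1 \<in> M2" for M M1 M2
    using covering_determined[of M1 M2] t_equiv_dimer[OF M M1(1)] t_equiv_dimer[OF M M2(1)] M1(2) M2(2)
    unfolding e1_def by simp
  have ex: "\<exists>M'. t_equiv M M' \<and> e1 \<in> M'" if "DC M" for M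
    using reach_e1[OF that] unfolding e1_def .
  have ex1: "\<exists>!M'. M' \<in> Ms \<and> t_equiv M' M \<and> e1 \<in> M'" if M: "DC M" for M
  proof -
    obtain M' where M': "t_equiv M M'" "e1 \<in> M'" using ex[OF M] by blast
    show ?thesis
    proof (rule ex1I[of _ M'])
      show "M' \<in> Ms \<and> t_equiv M' M \<and> e1 \<in> M'" using M' t_equiv_dimer[OF M M'(1)] Ms by blast
      fix M'' assume "M'' \<in> Ms \<and> t_equiv M'' M \<and> e1 \<in> M''"
      then have "t_equiv M M''" "e1 \<in> M''" using t_equiv_dimer[of M'' M] Ms by blast+
      then show "M'' = M'" using uniq[OF M _ _ M'] by blast
    qed
  qed
  have cls: "R `` {M} = {M'. DC M' \<and> t_equiv M M'}" if "DC M" for M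
    using that unfolding R_def by blast
  let ?g = "\<lambda>C. phi_map (VH F) (pi_map e1 (THE M'. M' \<in> C \<and> e1 \<in> M'))"
  \<comment> \<open>The tree is invariant under t-moves, so the value on a class can be read off
    from any member, not only from the one containing \<open>e1\<close>.\<close>
  have g: "?g (R `` {M}) = ed ` tree_mids F M" if M: "DC M" for M
  proof -
    obtain M' where M': "t_equiv M M'" "e1 \<in> M'" using ex[OF M] by blast
    have D: "DC M'" "tree_mids F M' = tree_mids F M" using t_equiv_dimer[OF M M'(1)] by blast+
    have "(THE M'. M' \<in> R `` {M} \<and> e1 \<in> M') = M'"
    proof (rule the_equality)
      show "M' \<in> R `` {M} \<and> e1 \<in> M'" using M' D cls[OF M] by blast
      fix M'' assume "M'' \<in> R `` {M} \<and> e1 \<in> M''"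
      then show "M'' = M'" using uniq[OF M _ _ M'] cls[OF M] by blast
    qed
    then show ?thesis using phi_map_eq(1)[OF D(1)] M'(2) D(2) unfolding e1_def by simp
  qed
  have "bij_betw ?g (Ms // R) Ts"
  proof (rule bij_betw_imageI)
    show "inj_on ?g (Ms // R)"
    proof (rule inj_onI)
      fix C1 C2 assume C: "C1 \<in> Ms // R" "C2 \<in> Ms // R" and eq: "?g C1 = ?g C2"
      obtain M1 where M1: "DC M1" "C1 = R `` {M1}" using C(1) Ms by (auto elim: quotientE)
      obtain M2 where M2: "DC M2" "C2 = R `` {M2}" using C(2) Ms by (auto elim: quotientE)
      obtain M1' where M1': "t_equiv M1 M1'" "e1 \<in> M1'" using ex[OF M1(1)] by blast
      obtain M2' where M2': "t_equiv M2 M2'" "e1 \<in> M2'" using ex[OF M2(1)] by blast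
      have D1: "DC M1'" "t_equiv M1' M1" "tree_mids F M1' = tree_mids F M1"
        using t_equiv_dimer[OF M1(1) M1'(1)] by blast+
      have D2: "DC M2'" "t_equiv M2' M2" "tree_mids F M2' = tree_mids F M2"
        using t_equiv_dimer[OF M2(1) M2'(1)] by blast+
      have "ed ` tree_mids F M1 = ed ` tree_mids F M2"
        using eq unfolding M1(2) M2(2) g[OF M1(1)] g[OF M2(1)] .
      then have "tree_mids F M1 = tree_mids F M2" by (rule tree_mids_inj)
      then have "M1' = M2'"
        using covering_determined[OF D1(1) D2(1)] M1'(2) M2'(2) D1(3) D2(3) unfolding e1_def by simp
      then have "t_equiv M1 M2" "t_equiv M2 M1"
        using t_equiv_trans[OF M1'(1)] t_equiv_trans[OF M2'(1)] D1(2) D2(2) by simp_all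
      then show "C1 = C2" unfolding M1(2) M2(2) cls[OF M1(1)] cls[OF M2(1)] using t_equiv_trans by blast
    qed
    show "?g ` (Ms // R) = Ts"
    proof (intro equalityI subsetI)
      fix T assume "T \<in> ?g ` (Ms // R)"
      then obtain C where C: "C \<in> Ms // R" "T = ?g C" by blast
      obtain M where M: "DC M" "C = R `` {M}" using C(1) Ms by (auto elim: quotientE)
      then have "T = ed ` tree_mids F M" using C(2) g by blast
      then show "T \<in> Ts" using spanning_tree_of_covering[OF M(1)] unfolding Ts_def by blast
    next
      fix T assume "T \<in> Ts"
      then obtain M where M: "DC M" "ed ` tree_mids F M = T"
        using covering_of_tree unfolding Ts_def by blast
      have "R `` {M} \<in> Ms // R" using M(1) Ms by (blast intro: quotientI)
      then show "T \<in> ?g ` (Ms // R)" using g[OF M(1)] M(2) by (intro image_eqI[of _ _ "R `` {M}"]) simp_all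
    qed
  qed
  moreover have "\<forall>M\<in>Ms. \<exists>!M'. M' \<in> Ms \<and> t_equiv M' M \<and> e1 \<in> M'" using ex1 Ms by blast
  moreover have "\<forall>M'\<in>Ms. e1 \<in> M' \<longrightarrow> phi_map (VH F) (pi_map e1 M') =
          {{x, (2 * fst b - fst x, 2 * snd b - snd x)} | x b.
              x \<in> VH F \<and> black b \<and> {x, b} \<in> M' - {e1}}"
    using phi_map_eq(2) Ms unfolding e1_def by blast
  ultimately show ?thesis by blast
qed

end
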